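(* Let $k$ be a field, let $A$ be a split finite-dimensional $k$-algebra with Jacobson radical $J=\operatorname{rad}A$, and let $s$ be the number of isomorphism classes of simple $A$-modules. Assume that $J^3=0$. Let $M$ be a finitely generated left $A$-module such that $\operatorname{Ext}_A^i(M,A)=0$ for all $i>0$. Then the following conditions are equivalent: (i) $M$ is projective. (ii) $\operatorname{Ext}_A^q(M,M)=0$ for all integers $q$ with $1\le q\le 3s+1$.
   Context: All modules are finitely generated left modules. A finite-dimensional $k$-algebra is called split if the endomorphism ring of every simple module is $k$. *)

theory Defs
  imports Complex_Main "HOL-Library.Function_Algebras"
begin

text \<open>
  The ring \<open>A\<close> is a type \<open>'a\<close> of sort \<open>{ring, monoid_mult}\<close>, i.e. an associative unital ring
  that need not be commutative; unlike \<^class>\<open>ring_1\<close>, this sort does not exclude the zero ring.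
  A left module has an explicit carrier inside an abelian group type, whose addition it inherits;
  the values of \<open>act\<close> off the carrier are irrelevant.
\<close>

record ('a, 'm) lmod =
  carr :: "'m set"
  act :: "'a \<Rightarrow> 'm \<Rightarrow> 'm"

locale lmodule =
  fixes M :: "('a::{ring,monoid_mult}, 'm::ab_group_add) lmod"
  assumes zero_closed: "0 \<in> carr M"
    and add_closed: "\<lbrakk>x \<in> carr M; y \<in> carr M\<rbrakk> \<Longrightarrow> x + y \<in> carr M"
    and uminus_closed: "x \<in> carr M \<Longrightarrow> - x \<in> carr M"
    and act_closed: "x \<in> carr M \<Longrightarrow> act M a x \<in> carr M"
    and act_add_right: "\<lbrakk>x \<in> carr M; y \<in> carr M\<rbrakk> \<Longrightarrow> act M a (x + y) = act M a x + act M a y"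
    and act_add_left: "x \<in> carr M \<Longrightarrow> act M (a + b) x = act M a x + act M b x"
    and act_mult: "x \<in> carr M \<Longrightarrow> act M (a * b) x = act M a (act M b x)"
    and act_one: "x \<in> carr M \<Longrightarrow> act M 1 x = x"

definition submodule :: "('a, 'm::ab_group_add) lmod \<Rightarrow> 'm set \<Rightarrow> bool" where
  "submodule M N \<longleftrightarrow> N \<subseteq> carr M \<and> 0 \<in> N \<and> (\<forall>x\<in>N. \<forall>y\<in>N. x + y \<in> N) \<and>
     (\<forall>x\<in>N. - x \<in> N) \<and> (\<forall>a. \<forall>x\<in>N. act M a x \<in> N)"

definition fg_module :: "('a::{ring,monoid_mult}, 'm::ab_group_add) lmod \<Rightarrow> bool" where
  "fg_module M \<longleftrightarrow> lmodule M \<and>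
     (\<exists>G. finite G \<and> G \<subseteq> carr M \<and> (\<forall>N. submodule M N \<and> G \<subseteq> N \<longrightarrow> N = carr M))"

definition simple_module :: "('a::{ring,monoid_mult}, 'm::ab_group_add) lmod \<Rightarrow> bool" where
  "simple_module M \<longleftrightarrow> lmodule M \<and> carr M \<noteq> {0} \<and>
     (\<forall>N. submodule M N \<longrightarrow> N = {0} \<or> N = carr M)"

text \<open>
  Homomorphisms are normalised to be \<open>0\<close> off the carrier of the source, so that each one is
  represented by exactly one function and \<open>lhom M N\<close> is an abelian group under pointwise addition.
\<close>

definition lhom ::
  "('a, 'm::ab_group_add) lmod \<Rightarrow> ('a, 'n::ab_group_add) lmod \<Rightarrow> ('m \<Rightarrow> 'n) set" where
  "lhom M N = {f. (\<forall>x\<in>carr M. f x \<in> carr N) \<and>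
     (\<forall>x\<in>carr M. \<forall>y\<in>carr M. f (x + y) = f x + f y) \<and>
     (\<forall>a. \<forall>x\<in>carr M. f (act M a x) = act N a (f x)) \<and>
     (\<forall>x. x \<notin> carr M \<longrightarrow> f x = 0)}"

definition isomorphic ::
  "('a, 'm::ab_group_add) lmod \<Rightarrow> ('a, 'n::ab_group_add) lmod \<Rightarrow> bool" where
  "isomorphic M N \<longleftrightarrow> (\<exists>f\<in>lhom M N. bij_betw f (carr M) (carr N))"

definition regular_module :: "('a::{ring,monoid_mult}, 'a) lmod" where
  "regular_module = \<lparr>carr = UNIV, act = (*)\<rparr>"

text \<open>
  Where a definition ranges over all (finitely generated) modules, it ranges over modules carried
  by the fixed type \<open>nat \<Rightarrow> 'a\<close>. If \<open>'a\<close> is a finite-dimensional algebra over a field \<open>k\<close>, nothing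
  is lost: a finitely generated \<open>'a\<close>-module is a finite-dimensional \<open>k\<close>-space, which embeds
  additively into \<open>nat \<Rightarrow> 'a\<close>, and its action can be transported along this embedding since the
  carrier and the action of a module are arbitrary.
\<close>

type_synonym 'a std_mod = "('a, nat \<Rightarrow> 'a) lmod"

definition simple_rel :: "('a::{ring,monoid_mult} std_mod \<times> 'a std_mod) set" where
  "simple_rel = {(S, T). simple_module S \<and> simple_module T \<and> isomorphic S T}"

definition num_simples :: "'a::{ring,monoid_mult} itself \<Rightarrow> nat" where
  "num_simples _ = card ({S :: 'a std_mod. simple_module S} // simple_rel)"

text \<open>The lifting property in the category of finitely generated modules.\<close>

definition projective :: "('a::{ring,monoid_mult}, 'm::ab_group_add) lmod \<Rightarrow> bool" where
  "projective M \<longleftrightarrow>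
     (\<forall>(X :: 'a std_mod) (Y :: 'a std_mod). \<forall>g\<in>lhom X Y. \<forall>f\<in>lhom M Y.
        fg_module X \<and> fg_module Y \<and> g ` carr X = carr Y \<longrightarrow>
        (\<exists>h\<in>lhom M X. \<forall>x\<in>carr M. g (h x) = f x))"

text \<open>
  \<open>\<dots> \<rightarrow> P 2 \<rightarrow> P 1 \<rightarrow> P 0 \<rightarrow> M \<rightarrow> 0\<close> is exact, with differentials \<open>d n : P (n + 1) \<rightarrow> P n\<close> and
  augmentation \<open>e : P 0 \<rightarrow> M\<close>.
\<close>

definition projective_resolution ::
  "('a::{ring,monoid_mult}, 'm::ab_group_add) lmod \<Rightarrow> (nat \<Rightarrow> ('a, 'p::ab_group_add) lmod) \<Rightarrow>
   (nat \<Rightarrow> 'p \<Rightarrow> 'p) \<Rightarrow> ('p \<Rightarrow> 'm) \<Rightarrow> bool" where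
  "projective_resolution M P d e \<longleftrightarrow>
     (\<forall>n. fg_module (P n) \<and> projective (P n)) \<and>
     (\<forall>n. d n \<in> lhom (P (Suc n)) (P n)) \<and>
     e \<in> lhom (P 0) M \<and>
     e ` carr (P 0) = carr M \<and>
     d 0 ` carr (P 1) = {x \<in> carr (P 0). e x = 0} \<and>
     (\<forall>n. d (Suc n) ` carr (P (Suc (Suc n))) = {x \<in> carr (P (Suc n)). d n x = 0})"

definition cocycles ::
  "(nat \<Rightarrow> ('a, 'p::ab_group_add) lmod) \<Rightarrow> (nat \<Rightarrow> 'p \<Rightarrow> 'p) \<Rightarrow> ('a, 'n::ab_group_add) lmod \<Rightarrow>
   nat \<Rightarrow> ('p \<Rightarrow> 'n) set" where
  "cocycles P d N i = {f \<in> lhom (P i) N. f \<circ> d i = 0}"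

fun coboundaries ::
  "(nat \<Rightarrow> ('a, 'p::ab_group_add) lmod) \<Rightarrow> (nat \<Rightarrow> 'p \<Rightarrow> 'p) \<Rightarrow> ('a, 'n::ab_group_add) lmod \<Rightarrow>
   nat \<Rightarrow> ('p \<Rightarrow> 'n) set" where
  "coboundaries P d N 0 = {0}"
| "coboundaries P d N (Suc i) = {h \<circ> d i | h. h \<in> lhom (P i) N}"

text \<open>
  The elements of \<open>Ext i M N\<close> are the cosets of the \<open>i\<close>-coboundaries in the group of \<open>i\<close>-cocycles of
  \<open>Hom (P, N)\<close>, where \<open>P\<close> is a chosen projective resolution of \<open>M\<close> (any two choices give isomorphic
  groups). It is the zero group iff this set is a singleton.
\<close>

definition some_resolution ::
  "('a::{ring,monoid_mult}, 'm::ab_group_add) lmod \<Rightarrow>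
   (nat \<Rightarrow> 'a std_mod) \<times> (nat \<Rightarrow> (nat \<Rightarrow> 'a) \<Rightarrow> (nat \<Rightarrow> 'a))" where
  "some_resolution M = (SOME (P, d). \<exists>e. projective_resolution M P d e)"

definition Ext ::
  "nat \<Rightarrow> ('a::{ring,monoid_mult}, 'm::ab_group_add) lmod \<Rightarrow> ('a, 'n::ab_group_add) lmod \<Rightarrow>
   ((nat \<Rightarrow> 'a) \<Rightarrow> 'n) set set" where
  "Ext i M N = (case some_resolution M of (P, d) \<Rightarrow>
     (\<lambda>f. (+) f ` coboundaries P d N i) ` cocycles P d N i)"

definition Ext_zero ::
  "nat \<Rightarrow> ('a::{ring,monoid_mult}, 'm::ab_group_add) lmod \<Rightarrow> ('a, 'n::ab_group_add) lmod \<Rightarrow> bool"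
  where "Ext_zero i M N \<longleftrightarrow> is_singleton (Ext i M N)"

definition left_ideal :: "'a::{ring,monoid_mult} set \<Rightarrow> bool" where
  "left_ideal L \<longleftrightarrow> submodule regular_module L"

definition maximal_left_ideal :: "'a::{ring,monoid_mult} set \<Rightarrow> bool" where
  "maximal_left_ideal L \<longleftrightarrow> left_ideal L \<and> L \<noteq> UNIV \<and>
     (\<forall>L'. left_ideal L' \<and> L \<subseteq> L' \<longrightarrow> L' = L \<or> L' = UNIV)"

definition jacobson_radical :: "'a::{ring,monoid_mult} set" where
  "jacobson_radical = \<Inter> {L. maximal_left_ideal L}"

definition ideal_product :: "'a::{ring,monoid_mult} set \<Rightarrow> 'a set \<Rightarrow> 'a set" where
  "ideal_product I J =
     {\<Sum>i<n. x i * y i | (n::nat) x y. \<forall>i<n. x i \<in> I \<and> y i \<in> J}"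

locale fd_algebra = vector_space scale
  for scale :: "'k::field \<Rightarrow> 'a::{ring,monoid_mult} \<Rightarrow> 'a" +
  assumes scale_mult_left: "scale c x * y = scale c (x * y)"
    and scale_mult_right: "x * scale c y = scale c (x * y)"
    and finite_dim: "\<exists>B. finite B \<and> span B = UNIV"

text \<open>
  The field \<open>k\<close> acts on every module through \<open>c \<mapsto> scale c 1\<close>; split means that for simple \<open>S\<close> the
  canonical map from \<open>k\<close> to the endomorphism ring of \<open>S\<close> is bijective.
\<close>

locale split_fd_algebra = fd_algebra scale
  for scale :: "'k::field \<Rightarrow> 'a::{ring,monoid_mult} \<Rightarrow> 'a" +
  assumes split: "\<lbrakk>simple_module (S :: 'a std_mod); f \<in> lhom S S\<rbrakk> \<Longrightarrow>
    \<exists>!c. \<forall>x\<in>carr S. f x = act S (scale c 1) x"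

end

theory Submission
  imports Defs
begin

text \<open>
  Let \<open>X\<close> be the first syzygy of \<open>M\<close>; it suffices to show \<open>X = 0\<close>. All higher syzygies have Loewy length
  at most two, so each has a dimension vector \<open>(t, r)\<close> recording top and radical. If \<open>K\<close> is the syzygy of
  \<open>C\<close>, with projective cover \<open>P\<close>, then \<open>(t, r)\<close> changes to \<open>(A1 t - r, A2 t)\<close>, up to an error \<open>(s, -s)\<close> that
  counts the simple direct summands of \<open>K\<close> inside \<open>J\<^sup>2 P\<close>. The vanishing of \<open>Ext(M, A)\<close> gives, by comparing
  dimensions of \<open>Hom(-, J P\<^sub>l)\<close>, a backward recurrence with the transposed matrices, so the linear map
  \<open>(t, r) \<mapsto> (A1 t - r, A2 t)\<close> is invertible on the vectors that occur. The vanishing of \<open>Ext\<^sup>q(X, X)\<close> makes an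
  Euler form vanish on the iterates \<open>1, \<dots>, 2s\<close> of the dimension vector of \<open>X\<close>. These span the iterate \<open>0\<close>
  by invertibility, but there the form is \<open>dim Hom(X, J X) - dim End X < 0\<close> if \<open>X\<close> is not zero. The error
  terms do no harm because the simple summands themselves satisfy the same vanishing conditions.
\<close>

section \<open>Modules and homomorphisms\<close>

text \<open>Dimension counts suffice because A is split: with End S = k, dim Hom(P_l, C) is the
  multiplicity of S_l in C, so all vectors and matrices are built from dimensions of Hom spaces and
  no composition series occur. J^3 = 0 enters by squeezing the syzygy K of a module of Loewy length
  two, with cover P, between J^2 P and J P, so that two layers describe it. A vector (t, r) has at
  most 2s coordinates, which is the origin of 2s. The obstacle: once an error occurs, the iterates
  of the linear map are no longer dimension vectors of modules. Hence modules are not followed along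
  the iteration; instead linear functionals that vanish on a class of modules are pulled back along
  the map. An error is a combination of vectors (e, -e), with e the unit vector of a simple summand
  S. The map sends (0, e) to (-e, 0), hence (e, -e) to the image of (e, 0) plus (e, 0); and (e, 0)
  is the vector of S, which belongs to the class again. The functionals are an Euler form against X
  and, for each P_l, a relation that expresses t_l through the next iterate.\<close>

lemma lhomI:
  assumes "\<And>x. x \<in> carr M \<Longrightarrow> f x \<in> carr N"
    and "\<And>x y. x \<in> carr M \<Longrightarrow> y \<in> carr M \<Longrightarrow> f (x + y) = f x + f y"
    and "\<And>a x. x \<in> carr M \<Longrightarrow> f (act M a x) = act N a (f x)"
    and "\<And>x. x \<notin> carr M \<Longrightarrow> f x = 0"
  shows "f \<in> lhom M N"
  using assms by (simp add: lhom_def)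

lemma
  assumes "f \<in> lhom M N"
  shows lhom_closed: "x \<in> carr M \<Longrightarrow> f x \<in> carr N"
    and lhom_add: "x \<in> carr M \<Longrightarrow> y \<in> carr M \<Longrightarrow> f (x + y) = f x + f y"
    and lhom_act: "x \<in> carr M \<Longrightarrow> f (act M a x) = act N a (f x)"
    and lhom_off: "x \<notin> carr M \<Longrightarrow> f x = 0"
  using assms by (auto simp: lhom_def)

lemma lhom_zero: "f \<in> lhom M N \<Longrightarrow> 0 \<in> carr M \<Longrightarrow> f 0 = 0"
  using lhom_add[of f M N 0 0] by simp

lemma lhom_uminus:
  assumes "f \<in> lhom M N" "lmodule M" "x \<in> carr M" shows "f (- x) = - f x"
proof -
  interpret lmodule M by fact
  have "f (x + - x) = f x + f (- x)" using assms uminus_closed by (intro lhom_add)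
  moreover have "f (x + - x) = 0" using lhom_zero[OF assms(1) zero_closed] by simp
  ultimately show ?thesis by (metis minus_unique)
qed

lemma (in lmodule) diff_closed: "x \<in> carr M \<Longrightarrow> y \<in> carr M \<Longrightarrow> x - y \<in> carr M"
  using add_closed[of x "- y"] uminus_closed by simp

lemma lhom_diff:
  assumes "f \<in> lhom M N" "lmodule M" "x \<in> carr M" "y \<in> carr M" shows "f (x - y) = f x - f y"
  using assms lhom_add[OF assms(1), of x "- y"] lhom_uminus[OF assms(1,2), of y]
    lmodule.uminus_closed[OF assms(2), of y] by simp

lemma (in lmodule) sum_closed: "(\<And>i. i \<in> I \<Longrightarrow> x i \<in> carr M) \<Longrightarrow> sum x I \<in> carr M"
  by (induction I rule: infinite_finite_induct) (auto simp: zero_closed add_closed)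

lemma lhom_sum:
  assumes "f \<in> lhom M N" "lmodule M" "\<And>i. i \<in> I \<Longrightarrow> x i \<in> carr M"
  shows "f (sum x I) = (\<Sum>i\<in>I. f (x i))"
  using assms(3)
proof (induction I rule: infinite_finite_induct)
  case (insert i I)
  have "sum x I \<in> carr M" using insert by (intro lmodule.sum_closed[OF assms(2)]) auto
  then show ?case using insert lhom_add[OF assms(1), of "x i" "sum x I"] by simp
qed (simp_all add: lhom_zero[OF assms(1) lmodule.zero_closed[OF assms(2)]])

lemma lhom_comp:
  assumes "f \<in> lhom M N" "g \<in> lhom N L" "lmodule N" shows "(\<lambda>x. g (f x)) \<in> lhom M L"
proof (rule lhomI)
  fix x assume "x \<notin> carr M"
  then show "g (f x) = 0" using assms lhom_off[OF assms(1)] lhom_zero lmodule.zero_closed by metis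
qed (simp_all add: lhom_closed[OF assms(2)] lhom_closed[OF assms(1)] lhom_add[OF assms(1)]
    lhom_add[OF assms(2)] lhom_act[OF assms(1)] lhom_act[OF assms(2)])

lemma (in lmodule) act_zero: "act M a 0 = 0"
  using act_add_right[of 0 0 a] zero_closed by simp

lemma (in lmodule) act_uminus: "x \<in> carr M \<Longrightarrow> act M a (- x) = - act M a x"
  using act_add_right[of x "- x" a] uminus_closed act_zero by (simp add: minus_unique)

lemma (in lmodule) act_zero_left: "x \<in> carr M \<Longrightarrow> act M 0 x = 0"
  using act_add_left[of x 0 0] by simp

lemma (in lmodule) act_uminus_left: "x \<in> carr M \<Longrightarrow> act M (- a) x = - act M a x"
  using act_add_left[of x a "- a"] act_zero_left[of x] by (simp add: minus_unique)

lemma (in lmodule) act_sum: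
  "(\<And>i. i \<in> I \<Longrightarrow> x i \<in> carr M) \<Longrightarrow> act M a (sum x I) = (\<Sum>i\<in>I. act M a (x i))"
  by (induction I rule: infinite_finite_induct) (auto simp: act_zero act_add_right sum_closed)

lemma lhom_plus:
  assumes "f \<in> lhom M N" "g \<in> lhom M N" "lmodule N" shows "(\<lambda>x. f x + g x) \<in> lhom M N"
  using assms
  by (intro lhomI) (simp_all add: lhom_closed lhom_add lhom_act lhom_off algebra_simps
      lmodule.add_closed lmodule.act_add_right)

lemma lhom_neg:
  assumes "f \<in> lhom M N" "lmodule N" shows "(\<lambda>x. - f x) \<in> lhom M N"
  using assms
  by (intro lhomI) (simp_all add: lhom_closed lhom_add lhom_act lhom_off
      lmodule.uminus_closed lmodule.act_uminus)

lemma lhom_minus: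
  assumes "f \<in> lhom M N" "g \<in> lhom M N" "lmodule N" shows "(\<lambda>x. f x - g x) \<in> lhom M N"
  using lhom_plus[OF assms(1) lhom_neg[OF assms(2,3)] assms(3)] by simp

lemma lhom_0: "lmodule N \<Longrightarrow> (\<lambda>x. 0) \<in> lhom M N"
  by (intro lhomI) (simp_all add: lmodule.zero_closed lmodule.act_zero)

text \<open>Members of \<open>lhom\<close> vanish off their source, so a restriction to a submodule,
  or a map given by a formula, has to be cut off there.\<close>

definition restrict0 :: "'m set \<Rightarrow> ('m \<Rightarrow> 'n::zero) \<Rightarrow> 'm \<Rightarrow> 'n" where
  "restrict0 C f x = (if x \<in> C then f x else 0)"

lemma restrict0_in [simp]: "x \<in> C \<Longrightarrow> restrict0 C f x = f x"
  and restrict0_out: "x \<notin> C \<Longrightarrow> restrict0 C f x = 0"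
  by (simp_all add: restrict0_def)

abbreviation on :: "('a, 'm) lmod \<Rightarrow> 'm set \<Rightarrow> ('a, 'm) lmod" where
  "on M C \<equiv> M\<lparr>carr := C\<rparr>"

lemma lmodule_on: "lmodule M \<Longrightarrow> submodule M C \<Longrightarrow> lmodule (on M C)"
  by (rule lmodule.intro)
    (auto simp: submodule_def subset_iff lmodule.act_add_right lmodule.act_add_left lmodule.act_mult
      lmodule.act_one)

lemma lhom_restrict0:
  assumes "f \<in> lhom M N" "submodule M C" shows "restrict0 C f \<in> lhom (on M C) N"
proof (rule lhomI)
qed (use assms in \<open>auto simp: submodule_def restrict0_def lhom_closed lhom_add lhom_act subset_iff\<close>)

lemma lhom_codom: "f \<in> lhom M N \<Longrightarrow> f ` carr M \<subseteq> D \<Longrightarrow> f \<in> lhom M (on N D)"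
  by (auto simp: lhom_def)

lemma lhom_codomD: "f \<in> lhom M (on N D) \<Longrightarrow> D \<subseteq> carr N \<Longrightarrow> f \<in> lhom M N"
  by (auto simp: lhom_def)

lemma lhom_id: "lmodule M \<Longrightarrow> restrict0 (carr M) (\<lambda>x. x) \<in> lhom M M"
  by (intro lhomI) (auto simp: restrict0_def lmodule.add_closed lmodule.act_closed)

lemma lhom_incl: "submodule M C \<Longrightarrow> restrict0 C (\<lambda>x. x) \<in> lhom (on M C) M"
  by (intro lhomI) (auto simp: restrict0_def submodule_def)

lemma lhom_ext: "f \<in> lhom M N \<Longrightarrow> g \<in> lhom M N' \<Longrightarrow> (\<And>x. x \<in> carr M \<Longrightarrow> f x = g x) \<Longrightarrow> f = g"
  by (rule ext) (metis lhom_off)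

lemma submodule_ker:
  assumes "f \<in> lhom M N" "lmodule M" "lmodule N" shows "submodule M {x \<in> carr M. f x = 0}"
  using assms by (auto simp: submodule_def lmodule.zero_closed lmodule.add_closed lmodule.uminus_closed
      lmodule.act_closed lhom_zero lhom_add lhom_uminus lhom_act lmodule.act_zero)

lemma submodule_image:
  assumes f: "f \<in> lhom M N" and M: "lmodule M" and C: "submodule M C"
  shows "submodule N (f ` C)"
  unfolding submodule_def
proof (intro conjI ballI allI)
  have s: "C \<subseteq> carr M" using C by (simp add: submodule_def)
  show "f ` C \<subseteq> carr N" using lhom_closed[OF f] s by auto
  show "0 \<in> f ` C" using lhom_zero[OF f] lmodule.zero_closed[OF M] C
    by (metis image_eqI submodule_def)
  fix x assume "x \<in> f ` C"
  then obtain u where u: "u \<in> C" "x = f u" by auto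
  have "- u \<in> C" using C u by (simp add: submodule_def)
  then show "- x \<in> f ` C" using lhom_uminus[OF f M, of u] u s by (metis image_eqI subsetD)
  fix y assume "y \<in> f ` C"
  then obtain w where w: "w \<in> C" "y = f w" by auto
  have "u + w \<in> C" using C u w by (simp add: submodule_def)
  then show "x + y \<in> f ` C" using lhom_add[OF f, of u w] u w s by (metis image_eqI subsetD)
next
  have s: "C \<subseteq> carr M" using C by (simp add: submodule_def)
  fix a x assume "x \<in> f ` C"
  then obtain u where u: "u \<in> C" "x = f u" by auto
  have "act M a u \<in> C" using C u by (simp add: submodule_def)
  then show "act N a x \<in> f ` C" using lhom_act[OF f, of u a] u s by (metis image_eqI subsetD)
qed

lemma submodule_vimage:
  assumes f: "f \<in> lhom M N" and "lmodule M" and "submodule N D"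
  shows "submodule M {x \<in> carr M. f x \<in> D}"
  using assms by (auto simp: submodule_def lmodule.zero_closed lmodule.add_closed lmodule.uminus_closed
      lmodule.act_closed lhom_zero lhom_add lhom_uminus lhom_act)

lemma submodule_self: "lmodule M \<Longrightarrow> submodule M (carr M)"
  by (simp add: submodule_def lmodule.zero_closed lmodule.add_closed lmodule.uminus_closed lmodule.act_closed)

lemma submodule_Int: "submodule M C \<Longrightarrow> submodule M D \<Longrightarrow> submodule M (C \<inter> D)"
  by (auto simp: submodule_def)

lemma submodule_plus:
  assumes M: "lmodule M" and C: "submodule M C" and D: "submodule M D"
  shows "submodule M {x + y | x y. x \<in> C \<and> y \<in> D}"
  unfolding submodule_def
proof (intro conjI ballI allI)
  interpret lmodule M by fact
  have s: "x \<in> carr M" if "x \<in> C \<or> x \<in> D" for x using C D that by (auto simp: submodule_def)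
  show "{x + y | x y. x \<in> C \<and> y \<in> D} \<subseteq> carr M" using s add_closed by blast
  show "0 \<in> {x + y | x y. x \<in> C \<and> y \<in> D}"
    using C D by (auto simp: submodule_def intro!: exI[of _ 0])
  fix u assume "u \<in> {x + y | x y. x \<in> C \<and> y \<in> D}"
  then obtain x y where u: "u = x + y" "x \<in> C" "y \<in> D" by auto
  have "- u = - x + - y" "- x \<in> C" "- y \<in> D" using u C D by (auto simp: submodule_def)
  then show "- u \<in> {x + y | x y. x \<in> C \<and> y \<in> D}" by blast
  fix w assume "w \<in> {x + y | x y. x \<in> C \<and> y \<in> D}"
  then obtain x' y' where w: "w = x' + y'" "x' \<in> C" "y' \<in> D" by auto
  have "u + w = (x + x') + (y + y')" "x + x' \<in> C" "y + y' \<in> D"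
    using u w C D by (auto simp: submodule_def algebra_simps)
  then show "u + w \<in> {x + y | x y. x \<in> C \<and> y \<in> D}" by blast
next
  interpret lmodule M by fact
  fix a u assume "u \<in> {x + y | x y. x \<in> C \<and> y \<in> D}"
  then obtain x y where u: "u = x + y" "x \<in> C" "y \<in> D" by auto
  have "act M a u = act M a x + act M a y" "act M a x \<in> C" "act M a y \<in> D"
    using u C D by (auto simp: submodule_def subset_iff intro!: act_add_right)
  then show "act M a u \<in> {x + y | x y. x \<in> C \<and> y \<in> D}" by blast
qed

text \<open>The induced map is read off from arbitrary preimages under \<open>p\<close>; the kernel
  condition makes the choice immaterial. This often replaces quotient modules: a map out of
  \<open>Y\<close> is given by a map out of a module above it.\<close>

lemma lhom_factor:
  assumes p: "p \<in> lhom P Y" "p ` carr P = carr Y" and f: "f \<in> lhom P Z" and P: "lmodule P"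
    and ker: "\<And>x. x \<in> carr P \<Longrightarrow> p x = 0 \<Longrightarrow> f x = 0"
  obtains g where "g \<in> lhom Y Z" "\<And>x. x \<in> carr P \<Longrightarrow> g (p x) = f x"
proof -
  interpret lmodule P by fact
  define c where "c y = (SOME x. x \<in> carr P \<and> p x = y)" for y
  have c: "c y \<in> carr P" "p (c y) = y" if "y \<in> carr Y" for y
  proof -
    have "\<exists>x. x \<in> carr P \<and> p x = y" using that p(2) by force
    from someI_ex[OF this] show "c y \<in> carr P" "p (c y) = y" by (auto simp: c_def)
  qed
  have wd: "f x = f x'" if "x \<in> carr P" "x' \<in> carr P" "p x = p x'" for x x'
    using ker[of "x - x'"] lhom_diff[OF f P, of x x'] lhom_diff[OF p(1) P, of x x'] that diff_closed by simp
  define g where "g = restrict0 (carr Y) (\<lambda>y. f (c y))"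
  have gp: "g (p x) = f x" if "x \<in> carr P" for x
    using wd[of "c (p x)" x] c[of "p x"] that lhom_closed[OF p(1) that] by (simp add: g_def)
  have "g \<in> lhom Y Z"
  proof (rule lhomI)
    fix y assume "y \<in> carr Y" then show "g y \<in> carr Z"
      using c f by (simp add: g_def lhom_closed)
  next
    fix y y' assume y: "y \<in> carr Y" "y' \<in> carr Y"
    have "g (p (c y + c y')) = f (c y) + f (c y')"
      using c y gp lhom_add[OF f] add_closed by simp
    then show "g (y + y') = g y + g y'"
      using c y lhom_add[OF p(1), of "c y" "c y'"] by (simp add: g_def)
  next
    fix a y assume y: "y \<in> carr Y"
    have "g (p (act P a (c y))) = act Z a (f (c y))"
      using c[OF y] gp lhom_act[OF f] act_closed by simp
    then show "g (act Y a y) = act Z a (g y)"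
      using c[OF y] y lhom_act[OF p(1), of "c y"] by (simp add: g_def)
  qed (simp add: g_def restrict0_out)
  then show ?thesis using gp that by blast
qed

lemma lhom_inverse:
  assumes f: "f \<in> lhom M N" "bij_betw f (carr M) (carr N)" and M: "lmodule M"
  obtains g where "g \<in> lhom N M" "\<And>x. x \<in> carr M \<Longrightarrow> g (f x) = x" "\<And>y. y \<in> carr N \<Longrightarrow> f (g y) = y"
proof -
  have s: "f ` carr M = carr N" and i: "inj_on f (carr M)" using f(2) by (auto simp: bij_betw_def)
  have z: "f 0 = 0" using lhom_zero[OF f(1)] lmodule.zero_closed[OF M] by simp
  have k: "restrict0 (carr M) (\<lambda>x. x) x = 0" if "x \<in> carr M" "f x = 0" for x
    using inj_onD[OF i, of x 0] that z lmodule.zero_closed[OF M] by (simp add: restrict0_def)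
  obtain g where g: "g \<in> lhom N M" "\<And>x. x \<in> carr M \<Longrightarrow> g (f x) = restrict0 (carr M) (\<lambda>x. x) x"
    using lhom_factor[OF f(1) s lhom_id[OF M] M k] by blast
  show ?thesis
  proof (rule that[OF g(1)])
    show "g (f x) = x" if "x \<in> carr M" for x using g(2) that by simp
    show "f (g y) = y" if y: "y \<in> carr N" for y
    proof -
      obtain x where x: "x \<in> carr M" "y = f x" using s y by blast
      then show ?thesis using g(2) by simp
    qed
  qed
qed

text \<open>
  Almost all modules in the proof are submodules of some \<open>A\<^sup>n\<close> with coordinatewise action. They are
  represented by their carriers \<open>C\<close>, sets of finitely supported functions (\<open>sub C\<close>), and \<open>md C\<close> is the
  module itself; \<open>psub C\<close> says that it is moreover a retract of \<open>A\<^sup>n\<close>, and \<open>rfree\<close> is the corresponding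
  isomorphism-invariant notion.
\<close>

definition fmul :: "'a::{ring,monoid_mult} \<Rightarrow> (nat \<Rightarrow> 'a) \<Rightarrow> nat \<Rightarrow> 'a" where
  "fmul a x = (\<lambda>i. a * x i)"

definition md :: "(nat \<Rightarrow> 'a::{ring,monoid_mult}) set \<Rightarrow> 'a std_mod" where
  "md C = \<lparr>carr = C, act = fmul\<rparr>"

definition free :: "nat \<Rightarrow> (nat \<Rightarrow> 'a::{ring,monoid_mult}) set" where
  "free n = {x. \<forall>i\<ge>n. x i = 0}"

lemma md_simps [simp]: "carr (md C) = C" "act (md C) = fmul" "on (md C) D = md D"
  by (simp_all add: md_def)

lemma fmul_simps: "fmul a (x + y) = fmul a x + fmul a y" "fmul (a + b) x = fmul a x + fmul b x"
  "fmul (a * b) x = fmul a (fmul b x)" "fmul 1 x = x" "fmul a 0 = 0" "fmul a (- x) = - fmul a x"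
  "fmul 0 x = 0" "fmul a (x - y) = fmul a x - fmul a y"
  by (auto simp: fmul_def fun_eq_iff distrib_left distrib_right mult.assoc right_diff_distrib
      intro: minus_mult_right[symmetric])

lemma lmodule_free: "lmodule (md (free n))"
  by unfold_locales (auto simp: fmul_simps, auto simp: free_def fmul_def)

definition sub :: "(nat \<Rightarrow> 'a::{ring,monoid_mult}) set \<Rightarrow> bool" where
  "sub C \<longleftrightarrow> (\<exists>n. submodule (md (free n)) C)"

lemma sub_free: "sub (free n)"
  using submodule_self[OF lmodule_free] by (auto simp: sub_def)

lemma subI: "submodule (md C) D \<Longrightarrow> sub C \<Longrightarrow> sub D"
  unfolding sub_def
proof (elim exE)
  fix n assume "submodule (md C) D" "submodule (md (free n)) C"
  then have "submodule (md (free n)) D" by (simp add: submodule_def subset_iff)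
  then show "\<exists>n. submodule (md (free n)) D" ..
qed

lemma lmodule_sub: "sub C \<Longrightarrow> lmodule (md C)"
  using lmodule_on[OF lmodule_free] by (auto simp: sub_def)

lemma
  assumes "sub C"
  shows sub_0: "0 \<in> C" and sub_add: "x \<in> C \<Longrightarrow> y \<in> C \<Longrightarrow> x + y \<in> C"
    and sub_uminus: "x \<in> C \<Longrightarrow> - x \<in> C" and sub_fmul: "x \<in> C \<Longrightarrow> fmul a x \<in> C"
    and sub_diff: "x \<in> C \<Longrightarrow> y \<in> C \<Longrightarrow> x - y \<in> C"
proof -
  interpret lmodule "md C" using lmodule_sub[OF assms] .
  show "0 \<in> C" "x \<in> C \<Longrightarrow> y \<in> C \<Longrightarrow> x + y \<in> C" "x \<in> C \<Longrightarrow> - x \<in> C" "x \<in> C \<Longrightarrow> fmul a x \<in> C"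
    "x \<in> C \<Longrightarrow> y \<in> C \<Longrightarrow> x - y \<in> C"
    using zero_closed add_closed[of x y] uminus_closed[of x] act_closed[of x a] diff_closed[of x y] by simp_all
qed

lemma submodule_md: "sub C \<Longrightarrow> sub D \<Longrightarrow> D \<subseteq> C \<Longrightarrow> submodule (md C) D"
  by (auto simp: submodule_def sub_0 sub_add sub_uminus sub_fmul)

lemma submodule_md_iff: 
  assumes C: "sub C" shows "submodule (md C) D \<longleftrightarrow> sub D \<and> D \<subseteq> C"
proof
  assume D: "submodule (md C) D"
  then have "D \<subseteq> C" by (simp add: submodule_def)
  then show "sub D \<and> D \<subseteq> C" using subI[OF D C] by simp
qed (simp add: submodule_md C)

lemma submodule_mdD: "submodule (md C) D \<Longrightarrow> sub C \<Longrightarrow> sub D \<and> D \<subseteq> C"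
  by (simp add: submodule_md_iff)

definition unitv :: "nat \<Rightarrow> nat \<Rightarrow> 'a::{ring,monoid_mult}" where
  "unitv i = (\<lambda>j. if j = i then 1 else 0)"

lemma sum_fun_apply: "(\<Sum>i\<in>I. f i) x = (\<Sum>i\<in>I. f i x)"
  for f :: "'i \<Rightarrow> 'b \<Rightarrow> 'c::comm_monoid_add"
  by (induction I rule: infinite_finite_induct) auto

lemma unitv_free: "i < n \<Longrightarrow> unitv i \<in> free n"
  by (auto simp: unitv_def free_def)

lemma free_expand: "x \<in> free n \<Longrightarrow> x = (\<Sum>i<n. fmul (x i) (unitv i))"
proof (rule ext)
  fix j assume x: "x \<in> free n"
  have "(\<Sum>i<n. fmul (x i) (unitv i)) j = (\<Sum>i<n. if j = i then x i else 0)"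
    by (simp add: sum_fun_apply fmul_def unitv_def if_distrib[of "(*) _"] cong: if_cong)
  also have "\<dots> = x j" using x by (auto simp: free_def)
  finally show "x j = (\<Sum>i<n. fmul (x i) (unitv i)) j" by simp
qed

lemma lhom_from_free:
  fixes X :: "('a::{ring,monoid_mult}, 'm::ab_group_add) lmod"
  assumes X: "lmodule X" and v: "\<And>i. i < n \<Longrightarrow> v i \<in> carr X"
  obtains f where "f \<in> lhom (md (free n)) X" "\<And>i. i < n \<Longrightarrow> f (unitv i) = v i"
proof -
  interpret lmodule X by fact
  define f where "f = restrict0 (free n) (\<lambda>x. \<Sum>i<n. act X (x i) (v i))"
  have "f \<in> lhom (md (free n)) X"
  proof (rule lhomI)
    fix x :: "nat \<Rightarrow> 'a" assume "x \<in> carr (md (free n))" then show "f x \<in> carr X"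
      using v by (auto simp: f_def intro!: sum_closed act_closed)
  next
    fix x y :: "nat \<Rightarrow> 'a" assume "x \<in> carr (md (free n))" "y \<in> carr (md (free n))"
    moreover from this have "x + y \<in> free n" using sub_add[OF sub_free] by auto
    ultimately show "f (x + y) = f x + f y"
      using v by (simp add: f_def act_add_left sum.distrib)
  next
    fix a :: 'a and x :: "nat \<Rightarrow> 'a" assume x: "x \<in> carr (md (free n))"
    then have "fmul a x \<in> free n" using sub_fmul[OF sub_free] by auto
    then show "f (act (md (free n)) a x) = act X a (f x)"
      using x v act_sum[of "{..<n}" "\<lambda>i. act X (x i) (v i)" a]
      by (simp add: f_def fmul_def act_mult act_closed)
  qed (simp add: f_def restrict0_out)
  moreover have "f (unitv i) = v i" if "i < n" for i
  proof -
    have "f (unitv i) = (\<Sum>j<n. act X (unitv i j) (v j))" 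
      unfolding f_def by (rule restrict0_in[OF unitv_free[OF that]])
    also have "\<dots> = (\<Sum>j<n. if j = i then v j else 0)"
      using v by (intro sum.cong) (auto simp: unitv_def act_one act_zero_left)
    finally show ?thesis using that by simp
  qed
  ultimately show ?thesis using that by blast
qed

lemma lhom_free_eq:
  fixes X :: "('a::{ring,monoid_mult}, 'm::ab_group_add) lmod"
  assumes "f \<in> lhom (md (free n)) X" "g \<in> lhom (md (free n)) X"
    and "\<And>i. i < n \<Longrightarrow> f (unitv i) = g (unitv i)"
  shows "f = g"
proof (rule lhom_ext[OF assms(1,2)])
  fix x :: "nat \<Rightarrow> 'a" assume x: "x \<in> carr (md (free n))"
  have c: "fmul (x i) (unitv i) \<in> free n" if "i < n" for i
    using sub_fmul[OF sub_free unitv_free[OF that]] .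
  have e: "h x = (\<Sum>i<n. act X (x i) (h (unitv i)))" if h: "h \<in> lhom (md (free n)) X" for h
  proof -
    have "h x = h (\<Sum>i<n. fmul (x i) (unitv i))" using arg_cong[OF free_expand, of x n h] x by simp
    also have "\<dots> = (\<Sum>i<n. h (fmul (x i) (unitv i)))" using c by (intro lhom_sum[OF h lmodule_free]) auto
    also have "\<dots> = (\<Sum>i<n. act X (x i) (h (unitv i)))"
      using lhom_act[OF h] unitv_free by (intro sum.cong) (fastforce simp:)+
    finally show ?thesis .
  qed
  show "f x = g x" using e[OF assms(1)] e[OF assms(2)] assms(3) by simp
qed

definition rfree :: "('a::{ring,monoid_mult}, 'm::ab_group_add) lmod \<Rightarrow> bool" where
  "rfree P \<longleftrightarrow> lmodule P \<and> (\<exists>n. \<exists>i\<in>lhom P (md (free n)). \<exists>r\<in>lhom (md (free n)) P. \<forall>x\<in>carr P. r (i x) = x)"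

text \<open>Lifting needs only preimages for the images of the \<open>n\<close> unit vectors. In
  contrast to the lifting property in \<open>projective\<close>, \<open>X\<close> and
  \<open>Y\<close> may live over any types, and it is enough that the image of \<open>f\<close> lies
  in that of \<open>g\<close>.\<close>

lemma rfree_lift:
  assumes P: "rfree P" and g: "g \<in> lhom X Y" and X: "lmodule X" and Y: "lmodule Y"
    and f: "f \<in> lhom P Y" and im: "f ` carr P \<subseteq> g ` carr X"
  obtains h where "h \<in> lhom P X" "\<And>x. x \<in> carr P \<Longrightarrow> g (h x) = f x"
proof -
  obtain n i r where i: "i \<in> lhom P (md (free n))" and r: "r \<in> lhom (md (free n)) P"
    and ri: "\<And>x. x \<in> carr P \<Longrightarrow> r (i x) = x" and lP: "lmodule P" using P by (auto simp: rfree_def)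
  have "\<exists>v. v \<in> carr X \<and> g v = f (r (unitv j))" if "j < n" for j
  proof -
    have "r (unitv j) \<in> carr P" using lhom_closed[OF r] unitv_free[OF that] by simp
    then show ?thesis using im by (metis (no_types, lifting) image_iff subsetD)
  qed
  then obtain v where v: "\<And>j. j < n \<Longrightarrow> v j \<in> carr X" "\<And>j. j < n \<Longrightarrow> g (v j) = f (r (unitv j))"
    by metis
  obtain h where h: "h \<in> lhom (md (free n)) X" "\<And>j. j < n \<Longrightarrow> h (unitv j) = v j"
    using lhom_from_free[OF X, of n v] v by blast
  have "(\<lambda>x. g (h x)) = (\<lambda>x. f (r x))"
    using v h lhom_comp[OF h(1) g X] lhom_comp[OF r f lP] by (intro lhom_free_eq) auto
  then have e: "g (h x) = f (r x)" for x by (rule fun_cong)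
  show ?thesis
  proof (rule that)
    show "(\<lambda>x. h (i x)) \<in> lhom P X" using lhom_comp[OF i h(1) lmodule_free] .
    show "g (h (i x)) = f x" if "x \<in> carr P" for x using e ri that by simp
  qed
qed

lemma fg_surj_free:
  assumes Y: "fg_module Y"
  obtains n p where "p \<in> lhom (md (free n)) Y" "p ` free n = carr Y"
proof -
  have lY: "lmodule Y" using Y by (simp add: fg_module_def)
  obtain G where G: "finite G" "G \<subseteq> carr Y" "\<And>N. submodule Y N \<Longrightarrow> G \<subseteq> N \<Longrightarrow> N = carr Y"
    using Y by (auto simp: fg_module_def)
  obtain xs where xs: "set xs = G" using finite_list[OF G(1)] by blast
  have "xs ! i \<in> carr Y" if "i < length xs" for i using xs G(2) that nth_mem by blast
  then obtain p where p: "p \<in> lhom (md (free (length xs))) Y" "\<And>i. i < length xs \<Longrightarrow> p (unitv i) = xs ! i"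
    using lhom_from_free[OF lY, of "length xs" "\<lambda>i. xs ! i"] by blast
  have "submodule Y (p ` free (length xs))"
    using submodule_image[OF p(1) lmodule_free submodule_self[OF lmodule_free]] by simp
  moreover have "G \<subseteq> p ` free (length xs)"
  proof
    fix x assume "x \<in> G" then obtain i where "i < length xs" "x = xs ! i" using xs by (metis in_set_conv_nth)
    then show "x \<in> p ` free (length xs)" using p(2) unitv_free by (metis image_eqI)
  qed
  ultimately have "p ` free (length xs) = carr Y" by (rule G(3))
  then show ?thesis by (rule that[OF p(1)])
qed

lemma rfree_free: "rfree (md (free n))"
  unfolding rfree_def
  by (intro conjI lmodule_free exI[of _ n] bexI[OF _ lhom_id[OF lmodule_free]]) simp

lemma rfree_imp_projective: "rfree P \<Longrightarrow> projective P"
  unfolding projective_def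
proof (intro allI ballI impI, elim conjE)
  fix X Y :: "'a std_mod" and g f
  assume "rfree P" "g \<in> lhom X Y" "f \<in> lhom P Y" "fg_module X" "fg_module Y" "g ` carr X = carr Y"
  then show "\<exists>h\<in>lhom P X. \<forall>x\<in>carr P. g (h x) = f x"
    using rfree_lift[of P g X Y f] lhom_closed by (metis fg_module_def image_subsetI)
qed

lemma fg_free: "fg_module (md (free n))"
  unfolding fg_module_def
proof (intro conjI lmodule_free exI[of _ "unitv ` {..<n}"] allI impI)
  fix N :: "(nat \<Rightarrow> 'a) set" assume N: "submodule (md (free n)) N \<and> unitv ` {..<n} \<subseteq> N"
  then have sN: "sub N" "N \<subseteq> free n" using submodule_mdD sub_free by blast+
  have "x \<in> N" if "x \<in> free n" for x
  proof -
    have "fmul (x i) (unitv i) \<in> N" if "i < n" for i using N that sub_fmul[OF sN(1)] by auto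
    then have "(\<Sum>i<n. fmul (x i) (unitv i)) \<in> carr (md N)"
      by (intro lmodule.sum_closed[OF lmodule_sub[OF sN(1)]]) auto
    then show ?thesis using free_expand[OF that] by simp
  qed
  then show "N = carr (md (free n))" using sN by auto
qed (auto simp: unitv_free)

text \<open>The identity of \<open>P\<close> is lifted along a surjection from a free module. This
  is possible directly only for a \<open>std_mod\<close>, because \<open>projective\<close> tests
  against targets of that type.\<close>

lemma rfree_if_projective:
  fixes P :: "'a::{ring,monoid_mult} std_mod"
  assumes fg: "fg_module P" and pr: "projective P"
  shows "rfree P"
proof -
  obtain n p where p: "p \<in> lhom (md (free n)) P" "p ` free n = carr P" by (rule fg_surj_free[OF fg])
  have l: "lmodule P" using fg by (simp add: fg_module_def)
  obtain h where "h \<in> lhom P (md (free n))" "\<forall>x\<in>carr P. p (h x) = restrict0 (carr P) (\<lambda>x. x) x"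
    using pr p lhom_id[OF l] fg fg_free[of n] unfolding projective_def by (metis md_simps(1))
  then show ?thesis using l p(1) by (auto simp: rfree_def)
qed

lemma isomorphic_via_rfree:
  assumes "rfree P" "f \<in> lhom P M" "bij_betw f (carr P) (carr M)" "lmodule M"
  shows "rfree M"
proof -
  have lP: "lmodule P" using assms by (simp add: rfree_def)
  obtain g where g: "g \<in> lhom M P" "\<And>x. x \<in> carr P \<Longrightarrow> g (f x) = x" "\<And>y. y \<in> carr M \<Longrightarrow> f (g y) = y"
    using lhom_inverse[OF assms(2,3) lP] by metis
  obtain n i r where i: "i \<in> lhom P (md (free n))" and r: "r \<in> lhom (md (free n)) P"
    and ri: "\<And>x. x \<in> carr P \<Longrightarrow> r (i x) = x" using assms(1) by (auto simp: rfree_def)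
  have "(\<lambda>x. i (g x)) \<in> lhom M (md (free n))" "(\<lambda>x. f (r x)) \<in> lhom (md (free n)) M"
    using lhom_comp[OF g(1) i lP] lhom_comp[OF r assms(2) lP] by auto
  moreover have "\<forall>x\<in>carr M. f (r (i (g x))) = x" using ri g(3) lhom_closed[OF g(1)] by simp
  ultimately show ?thesis using assms(4) unfolding rfree_def by meson
qed

definition psub :: "(nat \<Rightarrow> 'a::{ring,monoid_mult}) set \<Rightarrow> bool" where
  "psub P \<longleftrightarrow> sub P \<and> (\<exists>n. P \<subseteq> free n \<and> (\<exists>r\<in>lhom (md (free n)) (md P). \<forall>x\<in>P. r x = x))"

lemma psub_sub: "psub P \<Longrightarrow> sub P" by (simp add: psub_def)

lemma psub_rfree: "psub P \<Longrightarrow> rfree (md P)"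
proof -
  assume P: "psub P"
  then obtain n r where n: "P \<subseteq> free n" "r \<in> lhom (md (free n)) (md P)" "\<forall>x\<in>P. r x = x"
    by (auto simp: psub_def)
  have "restrict0 P (\<lambda>x. x) \<in> lhom (on (md (free n)) P) (md (free n))"
    using n psub_sub[OF P] sub_free by (intro lhom_incl submodule_md)
  then have i: "restrict0 P (\<lambda>x. x) \<in> lhom (md P) (md (free n))" by simp
  have "\<forall>x\<in>carr (md P). r (restrict0 P (\<lambda>x. x) x) = x" using n(3) by simp
  then show ?thesis using i n(2) lmodule_sub[OF psub_sub[OF P]] unfolding rfree_def by blast
qed

lemma psub_retract:
  assumes P: "psub P" and Q: "sub Q" "Q \<subseteq> P" and e: "e \<in> lhom (md P) (md Q)" "\<And>x. x \<in> Q \<Longrightarrow> e x = x"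
  shows "psub Q"
proof -
  obtain n r where n: "P \<subseteq> free n" "r \<in> lhom (md (free n)) (md P)" "\<forall>x\<in>P. r x = x"
    using P by (auto simp: psub_def)
  have "(\<lambda>x. e (r x)) \<in> lhom (md (free n)) (md Q)"
    using lhom_comp[OF n(2) e(1)] lmodule_sub psub_sub[OF P] by blast
  moreover have "\<forall>x\<in>Q. e (r x) = x" using n(3) Q e(2) by (simp add: subset_iff)
  moreover have "Q \<subseteq> free n" using Q n(1) by blast
  ultimately show ?thesis using Q(1) unfolding psub_def by meson
qed

section \<open>Dimensions of spaces of homomorphisms\<close>

context vector_space begin

text \<open>The ambient spaces of functions need not be finite-dimensional, so finiteness is
  recorded for each subset.\<close>

definition fdim :: "'b set \<Rightarrow> bool" where
  "fdim U \<longleftrightarrow> (\<exists>B. finite B \<and> U \<subseteq> span B)"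

lemma fdim_subset: "local.fdim W \<Longrightarrow> U \<subseteq> W \<Longrightarrow> local.fdim U"
  by (auto simp: fdim_def)

lemma fdim_independent: "local.fdim U \<Longrightarrow> B \<subseteq> U \<Longrightarrow> independent B \<Longrightarrow> finite B"
  unfolding fdim_def using independent_span_bound by (meson subset_trans)

lemma fdim_basis:
  assumes "local.fdim U"
  obtains B where "finite B" "B \<subseteq> U" "independent B" "U \<subseteq> span B" "card B = dim U"
  using basis_exists[of U] fdim_independent[OF assms] by metis

lemma fdim_extend_basis:
  assumes "local.fdim W" "U \<subseteq> W"
  obtains B0 B where "finite B" "B0 \<subseteq> B" "B0 \<subseteq> U" "B \<subseteq> W" "independent B" "U \<subseteq> span B0" "W \<subseteq> span B"
    "card B0 = dim U" "card B = dim W"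
proof -
  obtain B0 where B0: "B0 \<subseteq> U" "independent B0" "U \<subseteq> span B0" "card B0 = dim U"
    using basis_exists[of U] by blast
  obtain B where B: "B0 \<subseteq> B" "B \<subseteq> W" "independent B" "W \<subseteq> span B"
    using maximal_independent_subset_extend[of B0 W] B0 assms(2) by (metis subset_trans)
  show ?thesis
    using that[of B B0] B0 B fdim_independent[OF assms(1) B(2,3)] basis_card_eq_dim[of B W] by auto
qed

lemma dim_mono_fd: "local.fdim W \<Longrightarrow> U \<subseteq> W \<Longrightarrow> dim U \<le> dim W"
  by (metis card_mono fdim_extend_basis)

lemma dim_psubset_fd:
  assumes "local.fdim W" "U \<subseteq> W" "subspace U" "U \<noteq> W" shows "dim U < dim W"
proof -
  obtain B0 B where B: "finite B" "B0 \<subseteq> B" "B0 \<subseteq> U" "W \<subseteq> span B"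
    "card B0 = dim U" "card B = dim W" using fdim_extend_basis[OF assms(1,2)] by metis
  have "B0 \<noteq> B"
  proof
    assume "B0 = B"
    then have "W \<subseteq> U" using B(3,4) span_minimal[OF B(3) assms(3)] by auto
    then show False using assms by auto
  qed
  then show ?thesis using B psubset_card_mono[of B B0] by auto
qed

text \<open>Codimension one, in the form in which it arises for endomorphisms: each one differs from
  a multiple of the identity by a map into the radical.\<close>

lemma dim_insert_compl:
  assumes U: "subspace U" "subspace W" "U \<subseteq> W" "local.fdim W" and v: "v \<in> W" "v \<notin> U"
    and W: "\<And>w. w \<in> W \<Longrightarrow> \<exists>c. w - scale c v \<in> U"
  shows "dim W = Suc (dim U)"
proof -
  obtain B where B: "finite B" "B \<subseteq> U" "independent B" "U \<subseteq> span B" "card B = dim U"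
    using fdim_basis[OF fdim_subset[OF U(4,3)]] by metis
  have s: "span B = U" using B U span_minimal by blast
  have "independent (insert v B)" using B v s independent_insertI by auto
  moreover have "W \<subseteq> span (insert v B)" using W s by (auto simp: span_insert)
  moreover have "insert v B \<subseteq> W" using v B U by auto
  ultimately have "card (insert v B) = dim W" by (intro basis_card_eq_dim)
  moreover have "v \<notin> B" using v B by auto
  ultimately show ?thesis using B by simp
qed

end

context vector_space_pair begin

text \<open>Linearity is demanded on \<open>U\<close> alone because composing with a homomorphism is
  additive only for maps that take values in its source.\<close>

definition linear_on :: "'b set \<Rightarrow> ('b \<Rightarrow> 'c) \<Rightarrow> bool" where
  "linear_on U F \<longleftrightarrow> (\<forall>x\<in>U. \<forall>y\<in>U. F (x + y) = F x + F y) \<and> (\<forall>c. \<forall>x\<in>U. F (s1 c x) = s2 c (F x))"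

lemma linear_on_extend:
  assumes U: "vs1.subspace U" and F: "local.linear_on U F"
    and B: "B \<subseteq> U" "vs1.independent B" "U \<subseteq> vs1.span B"
  obtains G where "Vector_Spaces.linear s1 s2 G" "\<And>x. x \<in> U \<Longrightarrow> G x = F x"
proof -
  obtain G where G: "Vector_Spaces.linear s1 s2 G" "\<forall>x\<in>B. G x = F x"
    using linear_independent_extend[OF B(2), of F] by blast
  interpret G: Vector_Spaces.linear s1 s2 G by fact
  have F0: "F 0 = 0" using F U vs1.subspace_0[OF U] unfolding linear_on_def
    by (metis add_cancel_right_right)
  have "vs1.span B \<subseteq> {x \<in> U. G x = F x}"
  proof (rule vs1.span_minimal)
    show "B \<subseteq> {x \<in> U. G x = F x}" using B G by auto
    show "vs1.subspace {x \<in> U. G x = F x}"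
      using U F F0 unfolding linear_on_def
      by (intro vs1.subspaceI) (auto simp: G.add G.scale vs1.subspace_0 vs1.subspace_add vs1.subspace_scale)
  qed
  then show ?thesis using that[OF G(1)] B(3) by auto
qed

text \<open>A basis of the kernel is extended to a basis of \<open>U\<close>, and the added vectors
  map to a basis of the image. \<open>F\<close> is first replaced by a globally linear map that
  agrees with it on \<open>U\<close>.\<close>

theorem rank_nullity_on:
  assumes U: "vs1.subspace U" "vs1.fdim U" and F: "local.linear_on U F"
  shows "vs1.dim U = vs1.dim {x \<in> U. F x = 0} + vs2.dim (F ` U)"
proof -
  define N where "N = {x \<in> U. F x = 0}"
  obtain B0 B where B: "finite B" "B0 \<subseteq> B" "B0 \<subseteq> N" "B \<subseteq> U" "vs1.independent B" "N \<subseteq> vs1.span B0"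
    "U \<subseteq> vs1.span B" "card B0 = vs1.dim N" "card B = vs1.dim U"
    using vs1.fdim_extend_basis[OF U(2), of N] by (metis (no_types, lifting) N_def mem_Collect_eq subsetI)
  obtain G where G: "Vector_Spaces.linear s1 s2 G" "\<And>x. x \<in> U \<Longrightarrow> G x = F x"
    using linear_on_extend[OF U(1) F B(4,5,7)] by metis
  interpret G: Vector_Spaces.linear s1 s2 G by fact
  have sB: "vs1.span B = U" using B(4,7) U(1) vs1.span_minimal by blast
  let ?C = "B - B0"
  have iC: "vs1.independent ?C" using B(5) vs1.independent_mono by blast
  have sC: "vs1.span ?C \<subseteq> U" using sB vs1.span_mono[of ?C B] by auto
  \<comment> \<open>Such an \<open>x\<close> lies in the kernel and hence also in the span of
    \<open>B0\<close>; its coordinates are supported both on \<open>B0\<close> and on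
    \<open>B - B0\<close>, so all of them vanish.\<close>
  have k: "x = 0" if x: "x \<in> vs1.span ?C" "G x = 0" for x
  proof -
    have "x \<in> N" using x sC G(2) by (auto simp: N_def)
    then have x0: "x \<in> vs1.span B0" using B(6) by auto
    have r1: "vs1.representation B x = vs1.representation B0 x"
      using vs1.representation_extend[OF B(5) x0 B(2)] .
    have r2: "vs1.representation B x = vs1.representation ?C x"
      using vs1.representation_extend[OF B(5) x(1)] by auto
    have "vs1.representation B x b = 0" for b
      using r1 r2 vs1.representation_ne_zero[of B0 x b] vs1.representation_ne_zero[of ?C x b] by auto
    then show "x = 0"
      using vs1.sum_nonzero_representation_eq[OF B(5), of x] x sC sB by auto
  qed
  then have inj: "inj_on G (vs1.span ?C)"
    using G.inj_on_iff_eq_0[of "vs1.span ?C"] by simp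
  have "vs2.independent (G ` ?C)" using G.independent_injective_image[OF iC inj] .
  moreover have "vs2.span (G ` ?C) = F ` U"
  proof -
    have "F ` U = G ` vs1.span (B0 \<union> ?C)" using sB B(2) G(2) by (simp add: Un_absorb1 cong: image_cong)
    also have "\<dots> = G ` vs1.span ?C"
    proof
      show "G ` vs1.span (B0 \<union> ?C) \<subseteq> G ` vs1.span ?C"
      proof
        fix y assume "y \<in> G ` vs1.span (B0 \<union> ?C)"
        then obtain a b where ab: "y = G (a + b)" "a \<in> vs1.span B0" "b \<in> vs1.span ?C"
          unfolding vs1.span_Un by blast
        have "vs1.span B0 \<subseteq> {x. G x = 0}"
          using B(3) G(2) by (intro vs1.span_minimal G.subspace_kernel) (auto simp: N_def)
        then show "y \<in> G ` vs1.span ?C" using ab by (auto simp: G.add)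
      qed
    qed (use vs1.span_mono[of ?C "B0 \<union> ?C"] in auto)
    finally show ?thesis by (simp add: G.span_image)
  qed
  ultimately have "vs2.dim (F ` U) = card (G ` ?C)" using vs2.dim_span_eq_card_independent[of "G ` ?C"] by simp
  also have "\<dots> = card ?C" by (intro card_image inj_on_subset[OF inj vs1.span_superset])
  also have "\<dots> = card B - card B0" using B(1,2) by (simp add: card_Diff_subset finite_subset)
  finally show ?thesis using B(8,9) card_mono[OF B(1,2)] by (simp add: N_def)
qed

end

section \<open>Homomorphism spaces over the base field\<close>

context fd_algebra begin

definition vsc :: "'k \<Rightarrow> (nat \<Rightarrow> 'a) \<Rightarrow> nat \<Rightarrow> 'a" where
  "vsc c x = (\<lambda>i. scale c (x i))"

definition hsc :: "'k \<Rightarrow> ('x \<Rightarrow> nat \<Rightarrow> 'a) \<Rightarrow> 'x \<Rightarrow> nat \<Rightarrow> 'a" where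
  "hsc c f = (\<lambda>x. vsc c (f x))"

lemma vsc_fmul: "vsc c x = fmul (scale c 1) x"
  by (simp add: vsc_def fmul_def scale_mult_left)

sublocale V: vector_space vsc
  by unfold_locales (auto simp: vsc_def fun_eq_iff scale_right_distrib scale_left_distrib)

sublocale H: vector_space hsc
  by unfold_locales (auto simp: hsc_def vsc_def fun_eq_iff scale_right_distrib scale_left_distrib)

sublocale VV: vector_space_pair vsc vsc ..
sublocale HH: vector_space_pair hsc hsc ..
sublocale SV: vector_space_pair scale vsc ..

text \<open>The elements \<open>scale c 1\<close> are central in the algebra. This makes multiples
  of homomorphisms homomorphisms again.\<close>

lemma act_scale_comm: "lmodule W \<Longrightarrow> y \<in> carr W \<Longrightarrow>
    act W a (act W (scale c 1) y) = act W (scale c 1) (act W a y)"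
  using lmodule.act_mult[of W y a "scale c 1"] lmodule.act_mult[of W y "scale c 1" a]
    scale_mult_left[of c 1 a] scale_mult_right[of a c 1] by simp

text \<open>Dimensions are taken for the pointwise scaling \<open>vsc\<close>, whereas the action of
  a module may be arbitrary; here the two structures over k agree. The notion is needed for the
  quotients of \<open>quotient_exists\<close>, whose action is not \<open>fmul\<close>.\<close>

definition natural :: "('a, nat \<Rightarrow> 'a) lmod \<Rightarrow> bool" where
  "natural W \<longleftrightarrow> lmodule W \<and> (\<forall>c. \<forall>x\<in>carr W. act W (scale c 1) x = vsc c x)"

lemma natural_sub: "sub C \<Longrightarrow> natural (md C)"
  by (simp add: natural_def lmodule_sub vsc_fmul)

lemma subspace_sub: "sub C \<Longrightarrow> V.subspace C"
  by (intro V.subspaceI) (auto simp: vsc_fmul sub_0 sub_add sub_fmul)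

lemma subspace_lhom:
  assumes W: "natural W" shows "H.subspace (lhom N W)"
proof (rule H.subspaceI)
  have lW: "lmodule W" using W by (simp add: natural_def)
  show "0 \<in> lhom N W" using lhom_0[OF lW] by (simp add: zero_fun_def)
  fix f g assume f: "f \<in> lhom N W"
  show "g \<in> lhom N W \<Longrightarrow> f + g \<in> lhom N W" using lhom_plus[OF f _ lW] by (simp add: plus_fun_def)
  fix c
  have e: "vsc c y = act W (scale c 1) y" if "y \<in> carr W" for y using W that by (simp add: natural_def)
  show "hsc c f \<in> lhom N W" unfolding hsc_def
    using f lW by (intro lhomI) (simp_all add: e lhom_closed lhom_add lhom_act lhom_off lmodule.add_closed
        lmodule.act_closed lmodule.act_add_right act_scale_comm)
qed

lemma lhom_vsc:
  assumes f: "f \<in> lhom N W" and "natural N" "natural W" and x: "x \<in> carr N" shows "f (vsc c x) = vsc c (f x)"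
  using lhom_act[OF f x, of "scale c 1"] lhom_closed[OF f x] assms by (simp add: natural_def)

lemma fdim_free: "V.fdim (free n)"
proof -
  obtain B where B: "finite B" "span B = UNIV" using finite_dim by blast
  define ins :: "nat \<Rightarrow> 'a \<Rightarrow> nat \<Rightarrow> 'a" where "ins i y = (\<lambda>j. if j = i then y else 0)" for i y
  define D where "D = (\<Union>i<n. ins i ` B)"
  have "x \<in> V.span D" if x: "x \<in> free n" for x
  proof -
    have e: "x = (\<Sum>i<n. ins i (x i))"
      using x by (auto simp: fun_eq_iff sum_fun_apply ins_def free_def cong: if_cong)
    have "ins i (x i) \<in> V.span D" if i: "i < n" for i
    proof -
      interpret L: Vector_Spaces.linear scale vsc "ins i"
        by unfold_locales (auto simp: ins_def vsc_def fun_eq_iff)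
      have "ins i (x i) \<in> ins i ` span B" using B by auto
      also have "\<dots> = V.span (ins i ` B)" by (simp add: L.span_image)
      also have "\<dots> \<subseteq> V.span D" using i by (intro V.span_mono) (auto simp: D_def)
      finally show ?thesis .
    qed
    then have "(\<Sum>i<n. ins i (x i)) \<in> V.span D" by (intro V.span_sum) auto
    then show ?thesis using e by simp
  qed
  then show ?thesis unfolding V.fdim_def using B(1) by (intro exI[of _ D]) (auto simp: D_def)
qed

lemma fdim_sub: "sub C \<Longrightarrow> V.fdim C"
  using V.fdim_subset[OF fdim_free] by (auto simp: sub_def submodule_def)

lemma fg_sub: assumes C: "sub (C :: (nat \<Rightarrow> 'a) set)" shows "fg_module (md C)"
proof -
  obtain B where B: "finite B" "B \<subseteq> C" "C \<subseteq> V.span B" using V.fdim_basis[OF fdim_sub[OF C]] by metis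
  show ?thesis
    unfolding fg_module_def
  proof (intro conjI lmodule_sub C exI[of _ B] allI impI)
    fix N assume N: "submodule (md C) N \<and> B \<subseteq> N"
    then have "sub N" "N \<subseteq> C" using submodule_mdD C by blast+
    then have "V.span B \<subseteq> N" using N by (intro V.span_minimal subspace_sub) auto
    then show "N = carr (md C)" using B \<open>N \<subseteq> C\<close> by auto
  qed (use B in auto)
qed

lemma psub_projective: "psub (P :: (nat \<Rightarrow> 'a) set) \<Longrightarrow> fg_module (md P) \<and> projective (md P)"
  by (simp add: fg_sub psub_sub rfree_imp_projective psub_rfree)

abbreviation hom :: "(nat \<Rightarrow> 'a) set \<Rightarrow> (nat \<Rightarrow> 'a) set \<Rightarrow> ((nat \<Rightarrow> 'a) \<Rightarrow> nat \<Rightarrow> 'a) set" where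
  "hom C D \<equiv> lhom (md C) (md D)"

lemma hom_mono: "f \<in> hom L K \<Longrightarrow> K \<subseteq> C \<Longrightarrow> f \<in> hom L C"
  by (auto simp: lhom_def)

lemma hom_codom: "f \<in> hom L C \<Longrightarrow> f ` L \<subseteq> K \<Longrightarrow> f \<in> hom L K"
  by (auto simp: lhom_def)

text \<open>Spanned by matrix units: \<open>u b w\<close> sends the basis vector \<open>b\<close> to
  \<open>w\<close> and the other basis vectors to 0. They need not be homomorphisms, since any
  finite spanning set of a larger space will do.\<close>

lemma fdim_hom:
  assumes C: "sub C" and D: "sub D" shows "H.fdim (hom C D)"
proof -
  obtain B where B: "finite B" "B \<subseteq> C" "V.independent B" "C \<subseteq> V.span B"
    using V.fdim_basis[OF fdim_sub[OF C]] by metis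
  obtain E where E: "finite E" "E \<subseteq> D" "V.independent E" "D \<subseteq> V.span E"
    using V.fdim_basis[OF fdim_sub[OF D]] by metis
  have sB: "C = V.span B" using B V.span_minimal[OF B(2) subspace_sub[OF C]] by blast
  define u where "u b w = restrict0 C (\<lambda>x. vsc (V.representation B x b) w)" for b w
  define T where "T = case_prod u ` (B \<times> E)"
  have "f \<in> H.span T" if f: "f \<in> hom C D" for f
  proof -
    have "f = (\<Sum>b\<in>B. \<Sum>w\<in>E. hsc (V.representation E (f b) w) (u b w))"
    proof
      fix x
      show "f x = (\<Sum>b\<in>B. \<Sum>w\<in>E. hsc (V.representation E (f b) w) (u b w)) x"
      proof (cases "x \<in> C")
        case False
        then show ?thesis using lhom_off[OF f, of x] by (simp add: sum_fun_apply hsc_def u_def restrict0_def)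
      next
        case True
        have fb: "f b = (\<Sum>w\<in>E. vsc (V.representation E (f b) w) w)" if "b \<in> B" for b
        proof -
          have "f b \<in> V.span E" using lhom_closed[OF f, of b] B(2) E(4) that by auto
          from V.sum_representation_eq[OF E(3) this E(1) order_refl] show ?thesis by simp
        qed
        have "x = (\<Sum>b\<in>B. vsc (V.representation B x b) b)"
          using V.sum_representation_eq[OF B(3) _ B(1) order_refl, of x] True sB by simp
        then have "f x = f (\<Sum>b\<in>B. vsc (V.representation B x b) b)" by simp
        also have "\<dots> = (\<Sum>b\<in>B. f (vsc (V.representation B x b) b))"
          using B(2) C by (intro lhom_sum[OF f lmodule_sub[OF C]]) (auto simp: vsc_fmul sub_fmul)
        also have "\<dots> = (\<Sum>b\<in>B. vsc (V.representation B x b) (f b))"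
          using B(2) C D by (intro sum.cong refl lhom_vsc[OF f] natural_sub) auto
        also have "\<dots> = (\<Sum>b\<in>B. \<Sum>w\<in>E. vsc (V.representation E (f b) w) (vsc (V.representation B x b) w))"
        proof (rule sum.cong[OF refl])
          fix b assume "b \<in> B"
          then show "vsc (V.representation B x b) (f b) =
              (\<Sum>w\<in>E. vsc (V.representation E (f b) w) (vsc (V.representation B x b) w))"
            by (subst fb) (auto simp: V.scale_sum_right mult.commute)
        qed
        finally show ?thesis using True by (simp add: sum_fun_apply hsc_def u_def)
      qed
    qed
    also have "\<dots> \<in> H.span T"
      by (intro H.span_sum H.span_scale H.span_base) (auto simp: T_def)
    finally show ?thesis .
  qed
  then show ?thesis unfolding H.fdim_def using B(1) E(1) by (intro exI[of _ T]) (auto simp: T_def)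
qed

text \<open>Real-valued, since these dimensions are subtracted freely and later enter linear
  relations with real coefficients.\<close>

definition h :: "(nat \<Rightarrow> 'a) set \<Rightarrow> (nat \<Rightarrow> 'a) set \<Rightarrow> real" where
  "h C D = real (H.dim (hom C D))"

lemma rank_nullity_hom:
  assumes "sub C" "sub D" and U: "U \<subseteq> hom C D" "H.subspace U" and F: "HH.linear_on U F"
  shows "real (H.dim U) = real (H.dim {x \<in> U. F x = 0}) + real (H.dim (F ` U))"
  using HH.rank_nullity_on[OF U(2) H.fdim_subset[OF fdim_hom[OF assms(1,2)] U(1)] F] by simp

lemma rank_nullity_hom_inj:
  assumes "sub C" "sub D" and U: "U \<subseteq> hom C D" "H.subspace U" and F: "HH.linear_on U F"
    and inj: "\<And>f. f \<in> U \<Longrightarrow> F f = 0 \<Longrightarrow> f = 0"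
  shows "H.dim U = H.dim (F ` U)"
proof -
  have "{x \<in> U. F x = 0} \<subseteq> {0}" using inj by auto
  then have "H.dim {x \<in> U. F x = 0} = 0"
    using H.dim_le_card[of "{x \<in> U. F x = 0}" "{}"] by (auto simp: H.span_empty)
  then show ?thesis using rank_nullity_hom[OF assms(1-5)] by simp
qed

lemma h_zero: "sub C \<Longrightarrow> h C {0} = 0"
proof -
  have "hom C {0} \<subseteq> H.span {}"
  proof
    fix f assume f: "f \<in> hom C {0}"
    have "f x = 0" for x using lhom_closed[OF f, of x] lhom_off[OF f, of x] by (cases "x \<in> C") auto
    then have "f = 0" by (simp add: fun_eq_iff)
    then show "f \<in> H.span {}" by simp
  qed
  then show ?thesis using H.dim_le_card[of "hom C {0}" "{}"] by (simp add: h_def)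
qed

lemma linear_on_precomp: "HH.linear_on U (\<lambda>f. restrict0 Q (\<lambda>x. f (q x)))"
  by (auto simp: HH.linear_on_def restrict0_def hsc_def fun_eq_iff)

lemma linear_on_restrict: "HH.linear_on U (restrict0 Q)"
  using linear_on_precomp[of U Q "\<lambda>x. x"] by (simp add: eta_contract_eq)

lemma linear_on_postcomp:
  assumes r: "r \<in> lhom W Z" "natural W" "natural Z" and U: "U \<subseteq> lhom L W"
  shows "HH.linear_on U (\<lambda>f x. r (f x))"
proof -
  have W: "lmodule W" using r by (simp add: natural_def)
  have c: "f x \<in> carr W" if "f \<in> U" for f x
    using that U lhom_closed[of f L W x] lhom_off[of f L W x] lmodule.zero_closed[OF W] by (metis subsetD)
  have "r ((f + g) x) = ((\<lambda>x. r (f x)) + (\<lambda>x. r (g x))) x" if "f \<in> U" "g \<in> U" for f g x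
    using lhom_add[OF r(1) c[OF that(1)] c[OF that(2)]] by simp
  moreover have "r (hsc a f x) = hsc a (\<lambda>x. r (f x)) x" if "f \<in> U" for f a x
    using lhom_vsc[OF r c[OF that]] by (simp add: hsc_def)
  ultimately show ?thesis by (simp add: HH.linear_on_def fun_eq_iff)
qed

text \<open>Exactness of Hom(L, -) on 0 -> K -> C -> W -> 0: composition with \<open>r\<close> has
  kernel Hom(L, K), and it is onto because \<open>L\<close> is projective.\<close>

lemma h_exact:
  assumes L: "psub L" and C: "sub C" and W: "natural W" and r: "r \<in> lhom (md C) W" "r ` C = carr W"
    and K: "K = {x \<in> C. r x = 0}"
  shows "h L C = h L K + real (H.dim (lhom (md L) W))"
proof -
  have lW: "lmodule W" using W by (simp add: natural_def)
  have lin: "HH.linear_on (hom L C) (\<lambda>f x. r (f x))"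
    by (rule linear_on_postcomp[OF r(1) natural_sub[OF C] W order_refl])
  have "(\<lambda>f x. r (f x)) ` hom L C = lhom (md L) W"
  proof (intro equalityI subsetI)
    fix g assume "g \<in> (\<lambda>f x. r (f x)) ` hom L C"
    then show "g \<in> lhom (md L) W" using lhom_comp[OF _ r(1) lmodule_sub[OF C]] by auto
  next
    fix g assume g: "g \<in> lhom (md L) W"
    have im: "g ` carr (md L) \<subseteq> r ` carr (md C)" using lhom_closed[OF g] r(2) by auto
    obtain f where f: "f \<in> hom L C" "\<And>x. x \<in> carr (md L) \<Longrightarrow> r (f x) = g x"
      using rfree_lift[OF psub_rfree[OF L] r(1) lmodule_sub[OF C] lW g im] by metis
    have "(\<lambda>x. r (f x)) = g"
      by (rule lhom_ext[OF lhom_comp[OF f(1) r(1) lmodule_sub[OF C]] g f(2)])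
    then show "g \<in> (\<lambda>f x. r (f x)) ` hom L C" using f(1) by blast
  qed
  moreover have "{f \<in> hom L C. (\<lambda>x. r (f x)) = 0} = hom L K"
  proof (intro equalityI subsetI)
    fix f assume f: "f \<in> {f \<in> hom L C. (\<lambda>x. r (f x)) = 0}"
    then have "f x \<in> K" if "x \<in> L" for x
      using lhom_closed[of f "md L" "md C" x] that K by (auto simp: fun_eq_iff)
    then show "f \<in> hom L K" using f hom_codom[of f L C K] by auto
  next
    fix f assume f: "f \<in> hom L K"
    then have "f \<in> hom L C" using hom_mono[of f L K C] K by auto
    moreover have "r (f x) = 0" for x
      using lhom_closed[OF f, of x] lhom_off[OF f, of x] K lhom_zero[OF r(1)] sub_0[OF C]
      by (cases "x \<in> L") auto
    ultimately show "f \<in> {f \<in> hom L C. (\<lambda>x. r (f x)) = 0}" by (auto simp: fun_eq_iff)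
  qed
  ultimately show ?thesis
    using rank_nullity_hom[OF psub_sub[OF L] C order_refl subspace_lhom[OF natural_sub[OF C]] lin]
    by (simp add: h_def)
qed

text \<open>Left exactness of Hom(-, Z): the maps on \<open>P\<close> that vanish on
  \<open>K\<close> are those that factor through \<open>C\<close>. The other term, the image of
  restriction to \<open>K\<close>, is all of Hom(K, Z) precisely when every map on \<open>K\<close>
  extends to \<open>P\<close>.\<close>

lemma h_restrict:
  assumes P: "sub P" and C: "sub C" and Z: "sub Z" and p: "p \<in> hom P C" "p ` P = C" 
    and K: "K = {x \<in> P. p x = 0}"
  shows "h P Z = h C Z + real (H.dim (restrict0 K ` hom P Z))"
proof -
  let ?F = "\<lambda>g. restrict0 P (\<lambda>x. g (p x))"
  have k: "{f \<in> hom P Z. restrict0 K f = 0} = ?F ` hom C Z"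
  proof (intro equalityI subsetI)
    fix f assume "f \<in> {f \<in> hom P Z. restrict0 K f = 0}"
    then have f: "f \<in> hom P Z" "restrict0 K f = 0" by auto
    have f0: "f x = 0" if "x \<in> carr (md P)" "p x = 0" for x
      using fun_cong[OF f(2), of x] that K by simp
    have pc: "p ` carr (md P) = carr (md C)" using p(2) by simp
    obtain g where g: "g \<in> hom C Z" "\<And>x. x \<in> carr (md P) \<Longrightarrow> g (p x) = f x"
      using lhom_factor[OF p(1) pc f(1) lmodule_sub[OF P] f0] by metis
    have "f = ?F g" using g(2) lhom_off[OF f(1)] by (auto simp: fun_eq_iff restrict0_def)
    then show "f \<in> ?F ` hom C Z" using g(1) by blast
  next
    fix f assume "f \<in> ?F ` hom C Z"
    then obtain g where g: "g \<in> hom C Z" "f = ?F g" by blast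
    have "f = (\<lambda>x. g (p x))"
    proof
      fix x show "f x = g (p x)"
        using g(2) lhom_off[OF p(1), of x] lhom_zero[OF g(1)] sub_0[OF C]
        by (cases "x \<in> P") (simp_all add: restrict0_out)
    qed
    then have "f \<in> hom P Z" using lhom_comp[OF p(1) g(1) lmodule_sub[OF C]] by simp
    moreover have "restrict0 K f x = 0" for x
      using g(2) K lhom_zero[OF g(1)] sub_0[OF C] by (simp add: restrict0_def)
    then have "restrict0 K f = 0" by (simp add: fun_eq_iff)
    ultimately show "f \<in> {f \<in> hom P Z. restrict0 K f = 0}" by simp
  qed
  have "H.dim (hom C Z) = H.dim (?F ` hom C Z)"
  proof (rule rank_nullity_hom_inj[OF C Z order_refl subspace_lhom[OF natural_sub[OF Z]] linear_on_precomp])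
    fix f assume f: "f \<in> hom C Z" "?F f = 0"
    have "f y = 0" for y
    proof (cases "y \<in> C")
      case True
      then obtain x where "x \<in> P" "y = p x" using p(2) by auto
      then show ?thesis using fun_cong[OF f(2), of x] by simp
    qed (use lhom_off[OF f(1)] in auto)
    then show "f = 0" by (simp add: fun_eq_iff)
  qed
  then show ?thesis
    using rank_nullity_hom[OF P Z order_refl subspace_lhom[OF natural_sub[OF Z]] linear_on_restrict, of K] k
    by (simp add: h_def)
qed

text \<open>C/D is carried by a linear complement of \<open>D\<close> in \<open>C\<close>, so that
  it lives over the same type again: \<open>p\<close> is the linear projection along
  \<open>D\<close>, and the new action is multiplication followed by \<open>p\<close>.\<close>

lemma quotient_exists:
  assumes C: "sub C" and D: "sub D" "D \<subseteq> C"
  obtains W r where "natural W" "r \<in> lhom (md C) W" "r ` C = carr W" "{x \<in> C. r x = 0} = D"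
proof -
  obtain B0 B where B: "finite B" "B0 \<subseteq> B" "B0 \<subseteq> D" "B \<subseteq> C" "V.independent B" "D \<subseteq> V.span B0" "C \<subseteq> V.span B"
    using V.fdim_extend_basis[OF fdim_sub[OF C] D(2)] by metis
  obtain p where p: "Vector_Spaces.linear vsc vsc p" "\<forall>b\<in>B. p b = (if b \<in> B0 then 0 else b)"
    using VV.linear_independent_extend[OF B(5), of "\<lambda>b. if b \<in> B0 then 0 else b"] by blast
  interpret p: Vector_Spaces.linear vsc vsc p by fact
  have C': "C = V.span B" using B V.span_minimal[OF B(4) subspace_sub[OF C]] by blast
  have pD: "p x = 0" if "x \<in> D" for x
  proof -
    have "V.span B0 \<subseteq> {x. p x = 0}" using p B by (intro V.span_minimal p.subspace_kernel) auto
    then show ?thesis using that B(6) by auto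
  qed
  have diff: "x - p x \<in> D" if "x \<in> C" for x
  proof -
    have "V.subspace {x. x - p x \<in> D}"
      using subspace_sub[OF D(1)] unfolding V.subspace_def
      by (auto simp: p.add p.scale V.scale_right_diff_distrib[symmetric] add_diff_add)
    then have "V.span B \<subseteq> {x. x - p x \<in> D}"
      using p(2) B(3) sub_0[OF D(1)] by (intro V.span_minimal) auto
    then show ?thesis using that C' by auto
  qed
  have pC: "p x \<in> C" if "x \<in> C" for x
    using sub_diff[OF C that, of "x - p x"] diff[OF that] D(2) by auto
  \<comment> \<open>As \<open>D\<close> is a submodule, replacing \<open>x\<close> by its
    representative \<open>p x\<close> does not change the class of a multiple. All module laws of
    \<open>W\<close> rest on this.\<close>
  have key: "p (fmul a (p x)) = p (fmul a x)" if "x \<in> C" for a x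
  proof -
    have "fmul a (x - p x) \<in> D" using diff[OF that] sub_fmul[OF D(1)] by auto
    then have "p (fmul a x - fmul a (p x)) = 0" using pD by (simp add: fmul_simps)
    then show ?thesis by (simp add: p.diff)
  qed
  have pp: "p (p x) = p x" if "x \<in> C" for x using key[OF that, of 1] by (simp add: fmul_simps)
  define W where "W = \<lparr>carr = p ` C, act = (\<lambda>a y. p (fmul a y))\<rparr>"
  have "lmodule W"
  proof (rule lmodule.intro)
    show "0 \<in> carr W" using sub_0[OF C] p.zero by (auto simp: W_def intro!: image_eqI[of _ _ 0])
    fix y assume "y \<in> carr W"
    then obtain x where x: "x \<in> C" "y = p x" by (auto simp: W_def)
    show "- y \<in> carr W" using x sub_uminus[OF C x(1)] by (auto simp: W_def p.neg[symmetric])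
    show "act W a y \<in> carr W" for a using x by (auto simp: W_def key sub_fmul[OF C])
    show "act W (a + b) y = act W a y + act W b y" for a b by (simp add: W_def fmul_simps p.add)
    show "act W (a * b) y = act W a (act W b y)" for a b
      using key[of "fmul b y" a] pC[OF x(1)] x(2) by (simp add: W_def fmul_simps sub_fmul[OF C])
    show "act W 1 y = y" using x by (simp add: W_def fmul_simps pp)
    fix z assume z: "z \<in> carr W"
    show "act W a (y + z) = act W a y + act W a z" for a by (simp add: W_def fmul_simps p.add)
    from z obtain x' where "x' \<in> C" "z = p x'" by (auto simp: W_def)
    then show "y + z \<in> carr W" using x sub_add[OF C x(1)] by (auto simp: W_def p.add[symmetric])
  qed
  then have nat: "natural W"
    by (auto simp: natural_def) (auto simp: W_def vsc_fmul[symmetric] p.scale pp)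
  have "restrict0 C p \<in> lhom (md C) W"
    by (rule lhomI) (auto simp: W_def sub_add[OF C] sub_fmul[OF C] p.add key restrict0_out)
  moreover have "restrict0 C p ` C = carr W" by (auto simp: W_def)
  moreover have "{x \<in> C. restrict0 C p x = 0} = D" using pD diff D(2) by force
  ultimately show ?thesis by (rule that[OF nat])
qed

end

section \<open>The radical and projective covers\<close>

lemma left_ideal_iff: "left_ideal L \<longleftrightarrow> 0 \<in> L \<and> (\<forall>x\<in>L. \<forall>y\<in>L. x + y \<in> L) \<and> (\<forall>x\<in>L. - x \<in> L) \<and>
    (\<forall>a. \<forall>x\<in>L. a * x \<in> L)"
  by (auto simp: left_ideal_def submodule_def regular_module_def)

text \<open>The submodule J C, as the least set that contains 0 and is closed under adding products
  from J and \<open>C\<close>. This form yields the induction rule \<open>jrad_subsetI\<close> and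
  avoids finite sums.\<close>

definition jrad :: "(nat \<Rightarrow> 'a::{ring,monoid_mult}) set \<Rightarrow> (nat \<Rightarrow> 'a) set" where
  "jrad C = \<Inter> {D. 0 \<in> D \<and> (\<forall>a\<in>jacobson_radical. \<forall>x\<in>C. \<forall>y\<in>D. fmul a x + y \<in> D)}"

lemma jrad_0: "0 \<in> jrad C"
  and jrad_step: "a \<in> jacobson_radical \<Longrightarrow> x \<in> C \<Longrightarrow> y \<in> jrad C \<Longrightarrow> fmul a x + y \<in> jrad C"
  by (auto simp: jrad_def)

lemma jrad_subsetI:
  assumes "0 \<in> D" "\<And>a x y. a \<in> jacobson_radical \<Longrightarrow> x \<in> C \<Longrightarrow> y \<in> D \<Longrightarrow> fmul a x + y \<in> D"
  shows "jrad C \<subseteq> D"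
  unfolding jrad_def by (rule Inter_lower) (use assms in auto)

lemma jacobson_mult: "a \<in> jacobson_radical \<Longrightarrow> b * a \<in> jacobson_radical"
  by (auto simp: jacobson_radical_def maximal_left_ideal_def left_ideal_iff)

lemma jacobson_uminus: "a \<in> jacobson_radical \<Longrightarrow> - a \<in> jacobson_radical"
  by (auto simp: jacobson_radical_def maximal_left_ideal_def left_ideal_iff)

lemma jrad_fmul: "a \<in> jacobson_radical \<Longrightarrow> x \<in> C \<Longrightarrow> fmul a x \<in> jrad C"
  using jrad_step[OF _ _ jrad_0] by simp

lemma jrad_add:
  assumes "x \<in> jrad C" "y \<in> jrad C" shows "x + y \<in> jrad C"
proof -
  have "jrad C \<subseteq> {x. x + y \<in> jrad C}"
    by (rule jrad_subsetI) (use assms(2) in \<open>auto simp: add.assoc intro: jrad_step\<close>)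
  then show ?thesis using assms(1) by blast
qed

lemma jrad_subset: "sub C \<Longrightarrow> jrad C \<subseteq> C"
  by (rule jrad_subsetI) (auto simp: sub_0 intro: sub_add sub_fmul)

lemma sub_jrad: assumes C: "sub C" shows "sub (jrad C)"
proof -
  have m: "- (fmul a x + y) = fmul (- a) x + - y" for a :: 'a and x y
    by (simp add: fmul_def fun_eq_iff)
  have fm: "fmul b (fmul a x + y) = fmul (b * a) x + fmul b y" for a b :: 'a and x y
    by (simp add: fmul_simps)
  have "jrad C \<subseteq> {x. - x \<in> jrad C}"
    by (rule jrad_subsetI) (auto simp only: m mem_Collect_eq minus_zero intro: jrad_0 jrad_step jacobson_uminus)
  moreover have "jrad C \<subseteq> {x. fmul b x \<in> jrad C}" for b
    by (rule jrad_subsetI) (auto simp only: fm fmul_simps(5) mem_Collect_eq intro: jrad_0 jrad_step jacobson_mult)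
  ultimately have "submodule (md C) (jrad C)"
    using jrad_subset[OF C] by (auto simp: submodule_def intro: jrad_0 jrad_add)
  then show ?thesis using C subI by blast
qed

lemma jrad_mono: "C \<subseteq> D \<Longrightarrow> jrad C \<subseteq> jrad D"
  by (rule jrad_subsetI) (auto intro: jrad_0 jrad_step)

lemma jrad_hom:
  fixes C :: "(nat \<Rightarrow> 'a::{ring,monoid_mult}) set"
  assumes f: "f \<in> lhom (md C) (md D)" and C: "sub C" and x: "x \<in> jrad E" and E: "E \<subseteq> C"
  shows "f x \<in> jrad (f ` E)"
proof -
  have "jrad E \<subseteq> {x \<in> C. f x \<in> jrad (f ` E)}"
  proof (rule jrad_subsetI)
    show "0 \<in> {x \<in> C. f x \<in> jrad (f ` E)}"
      using lhom_zero[OF f] sub_0[OF C] jrad_0[of "f ` E"] by simp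
    fix a :: 'a and x y assume step: "a \<in> jacobson_radical" "x \<in> E" "y \<in> {x \<in> C. f x \<in> jrad (f ` E)}"
    then have c: "fmul a x \<in> C" "y \<in> C" "x \<in> C" using E sub_fmul[OF C] by auto
    then have "f (fmul a x + y) = fmul a (f x) + f y"
      using lhom_add[OF f, of "fmul a x" y] lhom_act[OF f, of x a] by simp
    then show "fmul a x + y \<in> {x \<in> C. f x \<in> jrad (f ` E)}"
      using step jrad_step[of a "f x" "f ` E" "f y"] sub_add[OF C c(1,2)] by simp
  qed
  then show ?thesis using x by auto
qed

lemma jrad_image:
  fixes C :: "(nat \<Rightarrow> 'a::{ring,monoid_mult}) set"
  assumes f: "f \<in> lhom (md C) (md D)" and C: "sub C" and E: "E \<subseteq> C"
  shows "f ` jrad E = jrad (f ` E)"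
proof
  show "f ` jrad E \<subseteq> jrad (f ` E)" using jrad_hom[OF f C _ E] by auto
  show "jrad (f ` E) \<subseteq> f ` jrad E"
  proof (rule jrad_subsetI)
    show "0 \<in> f ` jrad E"
      using lhom_zero[OF f] sub_0[OF C] jrad_0[of E] by (metis image_eqI md_simps(1))
    fix a :: 'a and x y assume step: "a \<in> jacobson_radical" "x \<in> f ` E" "y \<in> f ` jrad E"
    then obtain u w where u: "u \<in> E" "x = f u" "w \<in> jrad E" "y = f w" by auto
    have "w \<in> C" using u jrad_mono[OF E] jrad_subset[OF C] by auto
    then have "f (fmul a u + w) = fmul a x + y"
      using lhom_add[OF f, of "fmul a u" w] lhom_act[OF f, of u a] u E sub_fmul[OF C, of u] by auto
    then show "fmul a x + y \<in> f ` jrad E" using jrad_step[OF step(1) u(1,3)] by (metis image_eqI)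
  qed
qed

definition jkill :: "('a::{ring,monoid_mult}, 'm::ab_group_add) lmod \<Rightarrow> bool" where
  "jkill W \<longleftrightarrow> (\<forall>a\<in>jacobson_radical. \<forall>x\<in>carr W. act W a x = 0)"

lemma jkill_jrad:
  fixes C :: "(nat \<Rightarrow> 'a::{ring,monoid_mult}) set"
  assumes W: "jkill W" and C: "sub C" and f: "f \<in> lhom (md C) W" and x: "x \<in> jrad C"
  shows "f x = 0"
proof -
  have "jrad C \<subseteq> {x \<in> C. f x = 0}"
  proof (rule jrad_subsetI)
    show "0 \<in> {x \<in> C. f x = 0}" using lhom_zero[OF f] sub_0[OF C] by simp
    fix a :: 'a and x y assume step: "a \<in> jacobson_radical" "x \<in> C" "y \<in> {x \<in> C. f x = 0}"
    then have "fmul a x \<in> C" "y \<in> C" using sub_fmul[OF C] by auto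
    then show "fmul a x + y \<in> {x \<in> C. f x = 0}"
      using lhom_add[OF f, of "fmul a x" y] lhom_act[OF f, of x a] lhom_closed[OF f, of x] step W sub_add[OF C]
      by (simp add: jkill_def)
  qed
  then show ?thesis using x by auto
qed

lemma jkill_md: "sub C \<Longrightarrow> jrad C = {0} \<Longrightarrow> jkill (md C)"
  using jrad_fmul by (fastforce simp: jkill_def)

text \<open>The annihilator of a nonzero \<open>x\<close> is a maximal left ideal: for a left ideal
  L above it, L x is 0 or all of \<open>S\<close>, which makes L the annihilator or the whole ring.
  The radical is contained in it.\<close>

lemma simple_jkill:
  fixes S :: "('a::{ring,monoid_mult}, 'm::ab_group_add) lmod"
  assumes S: "simple_module S" shows "jkill S"
  unfolding jkill_def
proof (intro ballI)
  interpret lmodule S using S by (simp add: simple_module_def)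
  fix a :: 'a and x assume a: "a \<in> jacobson_radical" and x: "x \<in> carr S"
  show "act S a x = 0"
  proof (cases "x = 0")
    case False
    define m where "m = {b. act S b x = 0}"
    have "maximal_left_ideal m"
      unfolding maximal_left_ideal_def
    proof (intro conjI allI impI)
      show "left_ideal m"
        using x by (auto simp: left_ideal_iff m_def act_zero_left act_add_left act_uminus_left act_mult act_zero)
      have "1 \<notin> m" using act_one[OF x] False by (simp add: m_def)
      then show "m \<noteq> UNIV" by blast
      fix L assume L: "left_ideal L \<and> m \<subseteq> L"
      let ?N = "(\<lambda>b. act S b x) ` L"
      have "submodule S ?N"
        unfolding submodule_def
      proof (intro conjI ballI allI)
        show "0 \<in> ?N" using L x by (auto simp: left_ideal_iff act_zero_left intro!: image_eqI[of _ _ 0])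
        fix u assume "u \<in> ?N"
        then obtain b where b: "b \<in> L" "u = act S b x" by auto
        show "- u \<in> ?N" using b L x by (auto simp: left_ideal_iff act_uminus_left[symmetric])
        show "act S c u \<in> ?N" for c using b L x by (auto simp: left_ideal_iff act_mult[symmetric])
        fix w assume "w \<in> ?N"
        then obtain b' where b': "b' \<in> L" "w = act S b' x" by auto
        show "u + w \<in> ?N" using b b' L x by (auto simp: left_ideal_iff act_add_left[symmetric])
      qed (use x in \<open>auto simp: act_closed\<close>)
      then consider "?N = {0}" | "?N = carr S" using S by (auto simp: simple_module_def)
      then show "L = m \<or> L = UNIV"
      proof cases
        case 1 then show ?thesis using L by (auto simp: m_def)
      next
        case 2
        then obtain b where b: "b \<in> L" "x = act S b x" using x by blast
        have "act S (1 + - b) x = 0"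
          using act_add_left[OF x, of 1 "- b"] act_uminus_left[OF x, of b] act_one[OF x] b(2) by simp
        then have "1 + - b \<in> L" using L unfolding m_def by blast
        then have "(1 + - b) + b \<in> L" using L b(1) unfolding left_ideal_iff by blast
        then have "1 \<in> L" by simp
        then have "c \<in> L" for c using L mult_1_right[of c] unfolding left_ideal_iff by metis
        then show ?thesis by blast
      qed
    qed
    then show ?thesis using a by (auto simp: jacobson_radical_def m_def)
  qed (simp add: act_zero)
qed

section \<open>Maximal submodules, Schur's lemma and isomorphism classes of simple modules\<close>

definition splus :: "(nat \<Rightarrow> 'a::ab_group_add) set \<Rightarrow> (nat \<Rightarrow> 'a) set \<Rightarrow> (nat \<Rightarrow> 'a) set" where
  "splus N K = {x + y | x y. x \<in> N \<and> y \<in> K}"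

lemma sub_splus:
  assumes C: "sub C" and N: "sub N" "N \<subseteq> C" and K: "sub K" "K \<subseteq> C"
  shows "sub (splus N K)" "splus N K \<subseteq> C" "N \<subseteq> splus N K" "K \<subseteq> splus N K"
proof -
  have "submodule (md C) (splus N K)"
    unfolding splus_def using C N K by (intro submodule_plus lmodule_sub submodule_md)
  then show "sub (splus N K)" "splus N K \<subseteq> C" using submodule_mdD C by blast+
  show "N \<subseteq> splus N K" "K \<subseteq> splus N K"
    using sub_0[OF N(1)] sub_0[OF K(1)] by (auto simp: splus_def) (metis add.right_neutral, metis add.left_neutral)
qed

definition maxsub :: "(nat \<Rightarrow> 'a::{ring,monoid_mult}) set \<Rightarrow> (nat \<Rightarrow> 'a) set \<Rightarrow> bool" where
  "maxsub P N \<longleftrightarrow> sub N \<and> N \<subseteq> P \<and> N \<noteq> P \<and> (\<forall>N'. sub N' \<and> N \<subseteq> N' \<and> N' \<subseteq> P \<longrightarrow> N' = N \<or> N' = P)"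

lemma lhom_simple_surj:
  assumes S: "simple_module S" and M: "lmodule M" and f: "f \<in> lhom M S" and x: "x \<in> carr M" "f x \<noteq> 0"
  shows "f ` carr M = carr S"
proof -
  have "submodule S (f ` carr M)" using submodule_image[OF f M submodule_self[OF M]] .
  then have "f ` carr M = {0} \<or> f ` carr M = carr S" using S unfolding simple_module_def by blast
  then show ?thesis using x by auto
qed

lemma schur:
  assumes S: "simple_module S" and T: "simple_module T" and f: "f \<in> lhom S T" and x: "x \<in> carr S" "f x \<noteq> 0"
  shows "isomorphic S T"
proof -
  have l: "lmodule S" "lmodule T" using S T by (auto simp: simple_module_def)
  have "submodule S {x \<in> carr S. f x = 0}" using submodule_ker[OF f l] .
  then have "{x \<in> carr S. f x = 0} = {0} \<or> {x \<in> carr S. f x = 0} = carr S"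
    using S unfolding simple_module_def by blast
  then have k: "{x \<in> carr S. f x = 0} = {0}" using x by blast
  have "inj_on f (carr S)"
  proof (rule inj_onI)
    fix u v assume u: "u \<in> carr S" "v \<in> carr S" "f u = f v"
    then have "u - v \<in> {x \<in> carr S. f x = 0}"
      using lhom_diff[OF f l(1)] lmodule.diff_closed[OF l(1)] by simp
    then show "u = v" using k by simp
  qed
  then show ?thesis unfolding isomorphic_def bij_betw_def using lhom_simple_surj[OF T l(1) f x] f by blast
qed

lemma isomorphic_sym: "isomorphic S T \<Longrightarrow> lmodule S \<Longrightarrow> lmodule T \<Longrightarrow> isomorphic T S"
proof -
  assume "isomorphic S T" and l: "lmodule S" "lmodule T"
  then obtain f where f: "f \<in> lhom S T" "bij_betw f (carr S) (carr T)" by (auto simp: isomorphic_def)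
  obtain g where g: "g \<in> lhom T S" "\<And>x. x \<in> carr S \<Longrightarrow> g (f x) = x" "\<And>y. y \<in> carr T \<Longrightarrow> f (g y) = y"
    using lhom_inverse[OF f l(1)] by metis
  have "bij_betw g (carr T) (carr S)"
    using g lhom_closed[OF g(1)] lhom_closed[OF f(1)] by (intro bij_betw_byWitness[of _ f]) auto
  then show ?thesis using g(1) by (auto simp: isomorphic_def)
qed

lemma isomorphic_trans: "isomorphic S T \<Longrightarrow> isomorphic T U \<Longrightarrow> lmodule T \<Longrightarrow> isomorphic S U"
proof -
  assume "isomorphic S T" "isomorphic T U" and l: "lmodule T"
  then obtain f g where f: "f \<in> lhom S T" "bij_betw f (carr S) (carr T)"
    and g: "g \<in> lhom T U" "bij_betw g (carr T) (carr U)" by (auto simp: isomorphic_def)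
  have "bij_betw (\<lambda>x. g (f x)) (carr S) (carr U)" using bij_betw_trans[OF f(2) g(2)] by (simp add: comp_def)
  then show ?thesis using lhom_comp[OF f(1) g(1) l] by (auto simp: isomorphic_def)
qed

lemma isomorphic_refl: "lmodule S \<Longrightarrow> isomorphic S S"
proof -
  assume l: "lmodule S"
  have "bij_betw (restrict0 (carr S) (\<lambda>x. x)) (carr S) (carr S)"
    by (auto simp: bij_betw_def inj_on_def)
  then show ?thesis using lhom_id[OF l] by (auto simp: isomorphic_def)
qed

lemma equiv_simple_rel: "equiv {S. simple_module S} simple_rel"
proof (rule equivI)
  show "simple_rel \<subseteq> {S. simple_module S} \<times> {S. simple_module S}" by (auto simp: simple_rel_def)
  show "refl_on {S. simple_module S} simple_rel"
    by (auto simp: refl_on_def simple_rel_def simple_module_def isomorphic_refl)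
  show "sym simple_rel" by (auto simp: sym_def simple_rel_def simple_module_def isomorphic_sym)
  show "trans simple_rel"
    by (auto simp: trans_def simple_rel_def simple_module_def intro: isomorphic_trans)
qed

lemma simple_fg: assumes S: "simple_module S" shows "fg_module S"
proof -
  obtain x where x: "x \<in> carr S" "x \<noteq> 0"
    using S lmodule.zero_closed[of S] unfolding simple_module_def by blast
  show ?thesis unfolding fg_module_def
  proof (intro conjI exI[of _ "{x}"] allI impI)
    show "lmodule S" using S by (simp add: simple_module_def)
    fix N assume "submodule S N \<and> {x} \<subseteq> N"
    then show "N = carr S" using x S by (auto simp: simple_module_def)
  qed (use x in auto)
qed

section \<open>Projective covers\<close>

definition cover :: "(nat \<Rightarrow> 'a::{ring,monoid_mult}) set \<Rightarrow> ((nat \<Rightarrow> 'a) \<Rightarrow> 'm) \<Rightarrow>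
    ('a, 'm::ab_group_add) lmod \<Rightarrow> bool" where
  "cover P p Y \<longleftrightarrow> psub P \<and> p \<in> lhom (md P) Y \<and> p ` P = carr Y \<and> (\<forall>x\<in>P. p x = 0 \<longrightarrow> x \<in> jrad P)"

text \<open>The maximal submodules of a projective \<open>P\<close> intersect inside J P. If all
  coordinates of \<open>q\<close> were in J, then \<open>q\<close> would lie in J A^n and
  \<open>q = r q\<close> in J P. So some coordinate avoids a maximal left ideal \<open>m\<close>,
  and the members of \<open>P\<close> with that coordinate in \<open>m\<close> form the submodule
  sought.\<close>

lemma psub_avoid:
  assumes P: "psub P" and q: "q \<in> P" "q \<notin> jrad P"
  obtains N where "maxsub P N" "q \<notin> N"
proof -
  obtain n r where n: "P \<subseteq> free n" "r \<in> lhom (md (free n)) (md P)" "\<forall>x\<in>P. r x = x" and sP: "sub P"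
    using P by (auto simp: psub_def)
  have "\<exists>i<n. q i \<notin> jacobson_radical"
  proof (rule ccontr)
    assume "\<not> ?thesis"
    then have "fmul (q i) (unitv i) \<in> carr (md (jrad (free n)))" if "i < n" for i
      using that by (auto intro: jrad_fmul unitv_free)
    then have "(\<Sum>i<n. fmul (q i) (unitv i)) \<in> carr (md (jrad (free n)))"
      by (intro lmodule.sum_closed lmodule_sub sub_jrad sub_free) auto
    then have "q \<in> jrad (free n)" using free_expand[of q n] q(1) n(1) by auto
    then have "r q \<in> jrad (r ` free n)" using jrad_hom[OF n(2) sub_free _ order_refl] by auto
    moreover have "r ` free n \<subseteq> P" using lhom_closed[OF n(2)] by auto
    ultimately show False using q n(3) jrad_mono by (metis subsetD)
  qed
  then obtain i m where m: "maximal_left_ideal m" "q i \<notin> m" by (auto simp: jacobson_radical_def)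
  then have L: "left_ideal m" by (simp add: maximal_left_ideal_def)
  define N where "N = {x \<in> P. x i \<in> m}"
  have "submodule (md P) N"
    using L sP by (auto simp: N_def submodule_def left_ideal_iff sub_0 sub_add sub_uminus sub_fmul)
      (auto simp: fmul_def)
  then have N: "sub N" "N \<subseteq> P" using submodule_mdD sP by blast+
  have "maxsub P N"
    unfolding maxsub_def
  proof (intro conjI allI impI N)
    show "N \<noteq> P" using q(1) m by (auto simp: N_def)
    fix N' assume N': "sub N' \<and> N \<subseteq> N' \<and> N' \<subseteq> P"
    show "N' = N \<or> N' = P"
    proof (rule disjCI)
      assume "N' \<noteq> P"
      \<comment> \<open>The left ideal generated by \<open>m\<close> and the \<open>i\<close>-th
        coordinates of \<open>N'\<close>. If it contained 1, every element of \<open>P\<close> could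
        be corrected by a multiple of an element of \<open>N'\<close> to lie in \<open>N\<close>,
        forcing \<open>N' = P\<close>.\<close>
      define L' where "L' = {b + c | b c. b \<in> m \<and> (\<exists>x\<in>N'. c = x i)}"
      have z: "0 \<in> m" "0 \<in> N'" using L sub_0 N' by (auto simp: left_ideal_iff)
      have L'I: "b + x i \<in> L'" if "b \<in> m" "x \<in> N'" for b x using that unfolding L'_def by blast
      have l': "left_ideal L'"
        unfolding left_ideal_iff
      proof (intro conjI ballI allI)
        show "0 \<in> L'" using L'I[OF z] by simp
        fix u assume "u \<in> L'"
        then obtain b x where u: "u = b + x i" "b \<in> m" "x \<in> N'" by (auto simp: L'_def)
        have "- u = - b + (- x) i" "- b \<in> m" "- x \<in> N'"
          using u L N' sub_uminus by (auto simp: left_ideal_iff)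
        then show "- u \<in> L'" using L'I by metis
        show "a * u \<in> L'" for a
        proof -
          have "a * u = a * b + (fmul a x) i" "a * b \<in> m" "fmul a x \<in> N'"
            using u L N' sub_fmul by (auto simp: left_ideal_iff fmul_def distrib_left)
          then show ?thesis using L'I by metis
        qed
        fix w assume "w \<in> L'"
        then obtain b' x' where w: "w = b' + x' i" "b' \<in> m" "x' \<in> N'" by (auto simp: L'_def)
        have "u + w = (b + b') + (x + x') i" "b + b' \<in> m" "x + x' \<in> N'"
          using u w L N' sub_add by (auto simp: left_ideal_iff algebra_simps)
        then show "u + w \<in> L'" using L'I by metis
      qed
      have mL': "m \<subseteq> L'" using L'I[OF _ z(2)] by auto
      have "L' \<noteq> UNIV"
      proof
        assume "L' = UNIV"
        then have "1 \<in> L'" by simp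
        then obtain b x where bx: "1 = b + x i" "b \<in> m" "x \<in> N'" by (auto simp: L'_def)
        have "z \<in> N'" if z: "z \<in> P" for z
        proof -
          have "z i = z i * b + z i * x i" using bx(1) by (metis distrib_left mult_1_right)
          then have "(z - fmul (z i) x) i = z i * b" by (simp add: fmul_def) (metis add_diff_cancel_right')
          moreover have "z - fmul (z i) x \<in> P"
            using z bx(3) N' sub_diff[OF sP] sub_fmul[OF sP] by auto
          ultimately have "z - fmul (z i) x \<in> N'"
            using L bx(2) N' unfolding left_ideal_iff N_def by auto
          then have "(z - fmul (z i) x) + fmul (z i) x \<in> N'" using N' bx(3) sub_fmul sub_add by blast
          then show ?thesis by simp
        qed
        then show False using \<open>N' \<noteq> P\<close> N' by auto
      qed
      then have "L' = m" using l' mL' m(1) unfolding maximal_left_ideal_def by blast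
      moreover have "x i \<in> L'" if "x \<in> N'" for x
        using L'I[OF z(1) that] by simp
      ultimately have "N' \<subseteq> N" using N' by (auto simp: N_def)
      then show "N' = N" using N' by auto
    qed
  qed
  then show ?thesis using that m(2) by (auto simp: N_def)
qed

locale rad_cube_zero = split_fd_algebra scale
  for scale :: "'k::field \<Rightarrow> 'a::{ring,monoid_mult} \<Rightarrow> 'a" +
  assumes cube_zero: "ideal_product (ideal_product jacobson_radical jacobson_radical) jacobson_radical = {0::'a}"
begin

lemma jjj: "a \<in> jacobson_radical \<Longrightarrow> b \<in> jacobson_radical \<Longrightarrow> c \<in> jacobson_radical \<Longrightarrow> a * b * c = (0::'a)"
proof -
  have p: "a * b \<in> ideal_product I J" if "a \<in> I" "b \<in> J" for a b :: 'a and I J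
    unfolding ideal_product_def using that
    by (intro CollectI exI[of _ "1::nat"] exI[of _ "\<lambda>_. a"] exI[of _ "\<lambda>_. b"]) simp
  assume "a \<in> jacobson_radical" "b \<in> jacobson_radical" "c \<in> jacobson_radical"
  then have "a * b * c \<in> ideal_product (ideal_product jacobson_radical jacobson_radical) jacobson_radical"
    by (intro p)
  then show ?thesis using cube_zero by simp
qed

lemma jrad_cube: "jrad (jrad (jrad C)) = {0}" for C :: "(nat \<Rightarrow> 'a) set"
proof -
  have "jrad C \<subseteq> {x. fmul a (fmul b x) = 0}" if "a \<in> jacobson_radical" "b \<in> jacobson_radical" for a b :: 'a
  proof (rule jrad_subsetI)
    fix c :: 'a and x y assume c: "c \<in> jacobson_radical" and y: "y \<in> {x. fmul a (fmul b x) = 0}"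
    have "fmul a (fmul b (fmul c x)) = fmul (a * b * c) x" by (simp add: fmul_def mult.assoc)
    also have "\<dots> = 0" using jjj[OF that c] by (simp add: fmul_simps)
    finally show "fmul c x + y \<in> {x. fmul a (fmul b x) = 0}" using y by (simp add: fmul_simps)
  qed (simp add: fmul_simps)
  then have "jrad (jrad C) \<subseteq> {x. fmul a x = 0}" if "a \<in> jacobson_radical" for a
    using that by (intro jrad_subsetI) (auto simp: fmul_simps)
  then have "jrad (jrad (jrad C)) \<subseteq> {0}"
    by (intro jrad_subsetI) auto
  then show ?thesis using jrad_0[of "jrad (jrad C)"] by blast
qed

lemma jrad_splus:
  fixes N :: "(nat \<Rightarrow> 'a) set"
  assumes N: "sub N" and P: "P \<subseteq> splus N C" shows "jrad P \<subseteq> splus N (jrad C)"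
proof (rule jrad_subsetI)
  show "0 \<in> splus N (jrad C)"
    using sub_0[OF N] jrad_0[of C] unfolding splus_def by (intro CollectI exI[of _ 0]) simp
  fix a :: 'a and x y assume step: "a \<in> jacobson_radical" "x \<in> P" "y \<in> splus N (jrad C)"
  obtain u v where x: "x = u + v" "u \<in> N" "v \<in> C" using step(2) P by (force simp: splus_def)
  obtain u' v' where y: "y = u' + v'" "u' \<in> N" "v' \<in> jrad C" using step by (force simp: splus_def)
  have "fmul a x + y = (fmul a u + u') + (fmul a v + v')" using x y by (simp add: fmul_simps algebra_simps)
  moreover have "fmul a u + u' \<in> N" using x y N sub_add sub_fmul by blast
  moreover have "fmul a v + v' \<in> jrad C" using jrad_step[OF step(1) x(3) y(3)] .
  ultimately show "fmul a x + y \<in> splus N (jrad C)" unfolding splus_def by blast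
qed

text \<open>P = N + J P is improved to P = N + J^2 P; applying J once more gives J P inside N + J^3
  P = N.\<close>

lemma nakayama:
  fixes N :: "(nat \<Rightarrow> 'a) set"
  assumes N: "sub N" "N \<subseteq> P" and P: "P \<subseteq> splus N (jrad P)"
  shows "N = P"
proof -
  have "jrad P \<subseteq> splus N (jrad (jrad P))" using jrad_splus[OF N(1) P] .
  have "P \<subseteq> splus N (jrad (jrad P))"
  proof
    fix x assume "x \<in> P"
    then obtain u v where x: "x = u + v" "u \<in> N" "v \<in> jrad P" using P by (force simp: splus_def)
    then obtain u' v' where v: "v = u' + v'" "u' \<in> N" "v' \<in> jrad (jrad P)"
      using \<open>jrad P \<subseteq> splus N (jrad (jrad P))\<close> by (force simp: splus_def)
    have "x = (u + u') + v'" "u + u' \<in> N" using x v sub_add[OF N(1)] by (auto simp: add.assoc)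
    then show "x \<in> splus N (jrad (jrad P))" using v(3) unfolding splus_def by blast
  qed
  from jrad_splus[OF N(1) this] have "jrad P \<subseteq> splus N {0}" by (simp add: jrad_cube)
  then have "jrad P \<subseteq> N" by (auto simp: splus_def)
  then have "P \<subseteq> N" using P sub_add[OF N(1)] unfolding splus_def by blast
  then show ?thesis using N by auto
qed

lemma jrad_neq: "sub P \<Longrightarrow> P \<noteq> {0} \<Longrightarrow> jrad P \<noteq> P" for P :: "(nat \<Rightarrow> 'a) set"
  using jrad_cube[of P] by force

lemma maxsub_jrad:
  fixes P :: "(nat \<Rightarrow> 'a) set"
  assumes P: "sub P" and N: "maxsub P N" shows "jrad P \<subseteq> N"
proof -
  have n: "sub N" "N \<subseteq> P" using N by (auto simp: maxsub_def)
  note s = sub_splus[OF P n sub_jrad[OF P] jrad_subset[OF P]]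
  have "splus N (jrad P) = N \<or> splus N (jrad P) = P" using N s unfolding maxsub_def by blast
  moreover have "splus N (jrad P) \<noteq> P" using nakayama[OF n] N by (auto simp: maxsub_def)
  ultimately show ?thesis using s(4) by auto
qed

text \<open>Given p: A^n -> Y, choose an endomorphism g with p g = p whose image \<open>P\<close>
  has least dimension. Minimality makes g bijective on \<open>P\<close>, which yields a retraction
  of A^n onto \<open>P\<close>. If the kernel of p on \<open>P\<close> contained an element outside
  J P, a maximal submodule \<open>N\<close> avoiding it would still map onto \<open>Y\<close>, and
  lifting p through \<open>N\<close> would give a smaller image.\<close>

theorem cover_exists:
  fixes Y :: "('a, 'm::ab_group_add) lmod"
  assumes Y: "fg_module Y"
  obtains P p where "cover P p Y"
proof -
  have lY: "lmodule Y" using Y by (simp add: fg_module_def)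
  obtain n p where p: "p \<in> lhom (md (free n)) Y" "p ` free n = carr Y" by (rule fg_surj_free[OF Y])
  define Q :: "(nat \<Rightarrow> 'a) set" where "Q = free n"
  have sQ: "sub Q" and lQ: "lmodule (md Q)" using sub_free lmodule_free by (auto simp: Q_def)
  have rQ: "rfree (md Q)" unfolding Q_def by (rule rfree_free)
  note p = p[folded Q_def]
  define E where "E g \<longleftrightarrow> g \<in> hom Q Q \<and> (\<forall>x\<in>Q. p (g x) = p x)" for g
  have "E (restrict0 Q (\<lambda>x. x))" using lhom_id[OF lQ] by (simp add: E_def)
  then obtain g where g: "E g" "\<And>g'. E g' \<Longrightarrow> V.dim (g ` Q) \<le> V.dim (g' ` Q)"
    using arg_min_nat_lemma[of E _ "\<lambda>g. V.dim (g ` Q)"] by blast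
  define P where "P = g ` Q"
  have gh: "g \<in> hom Q Q" and gp: "\<And>x. x \<in> Q \<Longrightarrow> p (g x) = p x" using g(1) by (auto simp: E_def)
  have img: "submodule (md Q) (f ` D)" if "f \<in> hom Q Q" "sub D" "D \<subseteq> Q" for f D
    using submodule_image[OF that(1) lQ submodule_md[OF sQ that(2,3)]] .
  have P: "sub P" "P \<subseteq> Q" using submodule_mdD[OF img[OF gh sQ order_refl] sQ] by (auto simp: P_def)
  have "E (\<lambda>x. g (g x))" using gh gp lhom_comp[OF gh gh lQ] lhom_closed[OF gh] by (auto simp: E_def)
  from g(2)[OF this] have dle: "V.dim P \<le> V.dim (g ` P)" by (simp add: P_def image_image)
  have gP: "g ` P \<subseteq> P" using P(2) by (auto simp: P_def)
  have gPP: "g ` P = P"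
    using V.dim_psubset_fd[OF fdim_sub[OF P(1)] gP] dle
      subspace_sub submodule_mdD[OF img[OF gh P] sQ] by fastforce
  let ?gP = "restrict0 P g"
  have gPh: "?gP \<in> hom P P"
    using hom_codom[of ?gP P Q P] lhom_restrict0[OF gh submodule_md[OF sQ P]] gP by auto
  have linP: "VV.linear_on P ?gP"
    unfolding VV.linear_on_def using lhom_add[OF gPh] lhom_vsc[OF gPh] natural_sub[OF P(1)] by auto
  have inj: "x = 0" if x: "x \<in> P" "g x = 0" for x
  proof (rule ccontr)
    assume "x \<noteq> 0"
    let ?K = "{x \<in> P. ?gP x = 0}"
    have "submodule (md P) ?K" using submodule_ker[OF gPh lmodule_sub[OF P(1)] lmodule_sub[OF P(1)]] by simp
    then have K: "sub ?K" "?K \<subseteq> P" using submodule_mdD P(1) by blast+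
    have "V.dim {0} < V.dim ?K"
    proof (rule V.dim_psubset_fd[OF fdim_sub[OF K(1)]])
      show "{0} \<subseteq> ?K" using sub_0[OF K(1)] by simp
      have "x \<in> ?K" using x by simp
      then show "{0} \<noteq> ?K" using \<open>x \<noteq> 0\<close> by blast
    qed simp
    moreover have "V.dim P = V.dim ?K + V.dim (?gP ` P)"
      using VV.rank_nullity_on[OF subspace_sub[OF P(1)] fdim_sub[OF P(1)] linP] .
    moreover have "?gP ` P = P" using gPP by force
    ultimately show False by simp
  qed
  have "bij_betw ?gP (carr (md P)) (carr (md P))"
    unfolding bij_betw_def
  proof
    show "inj_on ?gP (carr (md P))"
    proof (rule inj_onI)
      fix x y assume xy: "x \<in> carr (md P)" "y \<in> carr (md P)" "?gP x = ?gP y"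
      then have "g (x - y) = 0" using lhom_diff[OF gh lQ, of x y] P(2) by auto
      then show "x = y" using inj[of "x - y"] xy sub_diff[OF P(1)] by auto
    qed
  qed (use gPP in force)
  then obtain u where u: "u \<in> hom P P" "\<And>x. x \<in> carr (md P) \<Longrightarrow> u (?gP x) = x"
    using lhom_inverse[OF gPh _ lmodule_sub[OF P(1)]] by metis
  have ghP: "g \<in> hom Q P" using hom_codom[OF gh, of P] by (simp add: P_def)
  have pP: "psub P"
    unfolding psub_def
  proof (intro conjI P exI[of _ n] bexI ballI)
    show "P \<subseteq> free n" using P(2) by (simp add: Q_def)
    show "(\<lambda>x. u (g x)) \<in> lhom (md (free n)) (md P)"
      using lhom_comp[OF ghP u(1) lmodule_sub[OF P(1)]] by (simp add: Q_def)
    show "u (g x) = x" if "x \<in> P" for x using u(2)[of x] that by simp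
  qed
  let ?p = "restrict0 P p"
  have ph: "?p \<in> lhom (md P) Y" using lhom_restrict0[OF p(1) submodule_md[OF sQ P]] by simp
  have sur: "?p ` P = carr Y"
  proof -
    have "?p ` P = p ` P" by simp
    also have "\<dots> = p ` Q" using gp by (simp add: P_def image_image)
    finally show ?thesis using p(2) by simp
  qed
  have "x \<in> jrad P" if x: "x \<in> P" "?p x = 0" for x
  proof (rule ccontr)
    assume "x \<notin> jrad P"
    then obtain N where N: "maxsub P N" "x \<notin> N" using psub_avoid[OF pP x(1)] by blast
    then have n: "sub N" "N \<subseteq> P" "N \<noteq> P" by (auto simp: maxsub_def)
    let ?K = "{x \<in> P. ?p x = 0}"
    have "submodule (md P) ?K" using submodule_ker[OF ph lmodule_sub[OF P(1)] lY] by simp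
    then have K: "sub ?K" "?K \<subseteq> P" using submodule_mdD P(1) by blast+
    note s = sub_splus[OF P(1) n(1,2) K]
    have "splus N ?K \<noteq> N" using s(4) x N(2) by auto
    then have sp: "splus N ?K = P" using N(1) s unfolding maxsub_def by blast
    have pN: "carr Y \<subseteq> p ` N"
    proof
      fix y assume "y \<in> carr Y"
      then have "y \<in> ?p ` P" using sur by simp
      then obtain z where z: "y = ?p z" "z \<in> P" by (rule imageE)
      then have "z \<in> splus N ?K" using sp by simp
      then obtain a b where ab: "z = a + b" "a \<in> N" "b \<in> ?K" unfolding splus_def by blast
      then have "?p z = ?p a + ?p b" using lhom_add[OF ph, of a b] n(2) by auto
      then have "y = p a" using z ab n(2) by auto
      then show "y \<in> p ` N" using ab(2) by simp
    qed
    have NQ: "N \<subseteq> Q" using n(2) P(2) by auto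
    have pNh: "restrict0 N p \<in> lhom (md N) Y"
      using lhom_restrict0[OF p(1) submodule_md[OF sQ n(1) NQ]] by simp
    have "p ` carr (md Q) \<subseteq> restrict0 N p ` carr (md N)" using pN p(2) by simp
    then obtain f where f: "f \<in> hom Q N" "\<And>x. x \<in> carr (md Q) \<Longrightarrow> restrict0 N p (f x) = p x"
      using rfree_lift[OF rQ pNh lmodule_sub[OF n(1)] lY p(1)] by metis
    have fN: "f ` Q \<subseteq> N" using lhom_closed[OF f(1)] by auto
    have "E f" using hom_mono[OF f(1) NQ] f(2) fN by (auto simp: E_def image_subset_iff)
    from g(2)[OF this] have "V.dim P \<le> V.dim (f ` Q)" by (simp add: P_def)
    also have "\<dots> \<le> V.dim N" using V.dim_mono_fd[OF fdim_sub[OF n(1)] fN] .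
    also have "\<dots> < V.dim P" using V.dim_psubset_fd[OF fdim_sub[OF P(1)] n(2) subspace_sub[OF n(1)] n(3)] .
    finally show False by simp
  qed
  then have "cover P ?p Y" using pP ph sur by (auto simp: cover_def)
  then show ?thesis by (rule that)
qed

end

section \<open>Indecomposable projective modules\<close>

text \<open>A surjection onto a projective module has a section s, and 1 - s f is a retraction onto
  the kernel.\<close>

lemma split_off:
  fixes P L :: "(nat \<Rightarrow> 'a::{ring,monoid_mult}) set"
  assumes P: "psub P" and L: "psub L" and f: "f \<in> lhom (md P) (md L)" "f ` P = L"
    and K: "K = {x \<in> P. f x = 0}"
  obtains e where "psub K" "e \<in> lhom (md P) (md K)" "\<forall>x\<in>K. e x = x"
proof -
  have sP: "sub P" and sL: "sub L" using P L psub_sub by blast+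
  have lP: "lmodule (md P)" and lL: "lmodule (md L)" using lmodule_sub sP sL by blast+
  have im: "restrict0 (carr (md L)) (\<lambda>x. x) ` carr (md L) \<subseteq> f ` carr (md P)" using f(2) by simp
  obtain s where s: "s \<in> lhom (md L) (md P)" "\<And>x. x \<in> carr (md L) \<Longrightarrow> f (s x) = restrict0 (carr (md L)) (\<lambda>x. x) x"
    using rfree_lift[OF psub_rfree[OF L] f(1) lP lL lhom_id[OF lL] im] by metis
  have fs: "f (s y) = y" if "y \<in> L" for y using s(2)[of y] that by simp
  define e where "e x = restrict0 P (\<lambda>x. x) x - s (f x)" for x
  have sf: "(\<lambda>x. s (f x)) \<in> lhom (md P) (md P)" using lhom_comp[OF f(1) s(1) lL] .
  have "restrict0 P (\<lambda>x. x) \<in> lhom (md P) (md P)" using lhom_id[OF lP] by simp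
  then have e: "e \<in> lhom (md P) (md P)" unfolding e_def using lhom_minus[OF _ sf lP] by blast
  have "submodule (md P) K" using submodule_ker[OF f(1) lP lL] K by simp
  then have sK: "sub K" "K \<subseteq> P" using submodule_mdD sP by blast+
  have "e x \<in> K" if "x \<in> P" for x
  proof -
    have "f (e x) = f x - f (s (f x))"
      using lhom_diff[OF f(1) lP, of x "s (f x)"] that lhom_closed[OF sf, of x] by (simp add: e_def)
    also have "\<dots> = 0" using fs[of "f x"] f(2) that by auto
    finally show ?thesis using K lhom_closed[OF e, of x] that by simp
  qed
  then have eK: "e \<in> lhom (md P) (md K)" using lhom_codom[OF e, of K] by auto
  have "s 0 = 0" using lhom_zero[OF s(1)] sub_0[OF sL] by simp
  then have id: "\<forall>x\<in>K. e x = x" using K by (simp add: e_def)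
  then show ?thesis using that[OF psub_retract[OF P sK eK] eK] by blast
qed

context rad_cube_zero begin

lemma psub_simple_quotient:
  fixes P :: "(nat \<Rightarrow> 'a) set"
  assumes P: "psub P" "P \<noteq> {0}"
  obtains S g where "simple_module (S :: 'a std_mod)" "g \<in> lhom (md P) S" "g ` P = carr S"
proof -
  have sP: "sub P" using P psub_sub by blast
  obtain q where q: "q \<in> P" "q \<notin> jrad P" using jrad_neq[OF sP P(2)] jrad_subset[OF sP] by blast
  obtain N where N: "maxsub P N" using psub_avoid[OF P(1) q] by blast
  then have n: "sub N" "N \<subseteq> P" "N \<noteq> P" by (auto simp: maxsub_def)
  obtain W r where W: "natural W" "r \<in> lhom (md P) W" "r ` P = carr W" "{x \<in> P. r x = 0} = N"
    by (rule quotient_exists[OF sP n(1,2)])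
  have lW: "lmodule W" using W by (simp add: natural_def)
  have "simple_module W"
    unfolding simple_module_def
  proof (intro conjI lW allI impI)
    obtain z where "z \<in> P" "z \<notin> N" using n by blast
    then have "r z \<noteq> 0" "r z \<in> carr W" using W(3,4) by auto
    then show "carr W \<noteq> {0}" by auto
    fix D assume D: "submodule W D"
    define N' where "N' = {x \<in> P. r x \<in> D}"
    have "submodule (md P) N'" using submodule_vimage[OF W(2) lmodule_sub[OF sP] D] by (simp add: N'_def)
    then have n': "sub N'" "N' \<subseteq> P" using submodule_mdD sP by blast+
    have "0 \<in> D" using D by (simp add: submodule_def)
    then have "N \<subseteq> N'" using W(4) n(2) by (auto simp: N'_def)
    then have "N' = N \<or> N' = P" using N n' by (simp add: maxsub_def)
    moreover have "D = r ` N'"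
    proof -
      have "D \<subseteq> r ` P" using D W(3) by (simp add: submodule_def)
      then show ?thesis by (auto simp: N'_def)
    qed
    moreover have "r ` N = {0}" using W(4) sub_0[OF n(1)] by force
    ultimately show "D = {0} \<or> D = carr W" using W(3) by auto
  qed
  then show ?thesis using that W by blast
qed

lemma cover_simple_ker:
  fixes L :: "(nat \<Rightarrow> 'a) set"
  assumes L: "cover L p S" and S: "simple_module S"
  shows "{x \<in> L. p x = 0} = jrad L"
proof -
  have s: "sub L" and p: "p \<in> lhom (md L) S" using L psub_sub by (auto simp: cover_def)
  have "p x = 0" if "x \<in> jrad L" for x using jkill_jrad[OF simple_jkill[OF S] s p that] .
  then show ?thesis using L jrad_subset[OF s] by (auto simp: cover_def)
qed

text \<open>A map that leaves J L is nonzero, hence onto, in the simple top L/J L; Nakayama's lemma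
  lifts this to \<open>L\<close>.\<close>

lemma cover_simple_surj:
  fixes L C :: "(nat \<Rightarrow> 'a) set"
  assumes L: "cover L p S" and S: "simple_module S" and C: "sub C" and f: "f \<in> hom C L"
    and n: "x \<in> C" "f x \<notin> jrad L"
  shows "f ` C = L"
proof -
  have s: "sub L" and p: "p \<in> lhom (md L) S" using L psub_sub by (auto simp: cover_def)
  have pf: "(\<lambda>x. p (f x)) \<in> lhom (md C) S" using lhom_comp[OF f p lmodule_sub[OF s]] .
  have "f x \<in> L" using lhom_closed[OF f, of x] n(1) by simp
  then have "p (f x) \<noteq> 0" using n(2) cover_simple_ker[OF L S] by auto
  then have sur: "(\<lambda>x. p (f x)) ` C = carr S" using lhom_simple_surj[OF S lmodule_sub[OF C] pf, of x] n(1) by simp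
  have "submodule (md L) (f ` C)" using submodule_image[OF f lmodule_sub[OF C] submodule_self[OF lmodule_sub[OF C]]]
    by simp
  then have fC: "sub (f ` C)" "f ` C \<subseteq> L" using submodule_mdD s by blast+
  have "L \<subseteq> splus (f ` C) (jrad L)"
  proof
    fix z assume z: "z \<in> L"
    have "p z \<in> (\<lambda>x. p (f x)) ` C" using sur lhom_closed[OF p, of z] z by simp
    then obtain c where c: "p z = p (f c)" "c \<in> C" by (rule imageE)
    have fc: "f c \<in> L" using fC c(2) by auto
    have "p (z - f c) = 0" using lhom_diff[OF p lmodule_sub[OF s], of z "f c"] z fc c(1) by simp
    then have "z - f c \<in> jrad L" using cover_simple_ker[OF L S] sub_diff[OF s z fc] by blast
    moreover have "z = f c + (z - f c)" by simp
    ultimately show "z \<in> splus (f ` C) (jrad L)" using c(2) unfolding splus_def by blast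
  qed
  then show ?thesis using nakayama[OF fC] by simp
qed

lemma cover_split:
  fixes P L :: "(nat \<Rightarrow> 'a) set"
  assumes P: "psub P" and L: "cover L p S" and S: "simple_module S" and g: "g \<in> lhom (md P) S" "g ` P = carr S"
  obtains f where "f \<in> hom P L" "f ` P = L" "\<forall>x\<in>P. p (f x) = g x"
proof -
  have s: "psub L" "sub L" and p: "p \<in> lhom (md L) S" "p ` L = carr S" using L psub_sub by (auto simp: cover_def)
  have lS: "lmodule S" using S by (simp add: simple_module_def)
  have im: "g ` carr (md P) \<subseteq> p ` carr (md L)" using g(2) p(2) by simp
  obtain f where f: "f \<in> hom P L" "\<And>x. x \<in> carr (md P) \<Longrightarrow> p (f x) = g x"
    using rfree_lift[OF psub_rfree[OF P] p(1) lmodule_sub[OF s(2)] lS g(1) im] by metis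
  obtain y where y: "y \<in> carr S" "y \<noteq> 0" using S lmodule.zero_closed[OF lS] unfolding simple_module_def by blast
  then obtain x where x: "x \<in> P" "g x \<noteq> 0" using g(2) by (metis imageE)
  have "f x \<notin> jrad L" using f(2)[of x] x unfolding cover_simple_ker[OF L S, symmetric] by simp
  then have "f ` P = L" using cover_simple_surj[OF L S psub_sub[OF P] f(1) x(1)] by blast
  then show ?thesis using that f by auto
qed

lemma simple_nonzero_cover:
  assumes L: "cover L p S" and S: "simple_module S" shows "L \<noteq> {0}"
proof
  assume "L = {0}"
  then have "p ` {0} = carr S" "p \<in> lhom (md {0}) S" using L by (auto simp: cover_def)
  moreover from this have "p 0 = 0" using lhom_zero[of p "md {0}"] by simp
  ultimately show False using S by (simp add: simple_module_def)
qed

lemma dim_split_less: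
  fixes P L :: "(nat \<Rightarrow> 'a) set"
  assumes P: "psub P" and f: "f \<in> hom P L" "f ` P = L" and L: "L \<noteq> {0}" "sub L"
    and K: "K = {x \<in> P. f x = 0}" "psub K"
  shows "V.dim K < V.dim P"
proof (rule V.dim_psubset_fd[OF fdim_sub[OF psub_sub[OF P]] _ subspace_sub[OF psub_sub[OF K(2)]]])
  show "K \<subseteq> P" using K by auto
  obtain y where "y \<in> L" "y \<noteq> 0" using L sub_0 by blast
  then obtain x where "x \<in> P" "f x \<noteq> 0" using f(2) by blast
  then show "K \<noteq> P" using K by auto
qed

text \<open>Summands with simple top are split off \<open>P\<close>, by induction on the dimension.
  A nonzero map from \<open>P\<close> to a simple module is nonzero on the complement
  \<open>K\<close>, or it factors through \<open>L\<close> and then through its top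
  \<open>T\<close>, which is the target up to isomorphism.\<close>

lemma finite_tops:
  fixes P :: "(nat \<Rightarrow> 'a) set"
  assumes "psub P"
  shows "\<exists>F. finite F \<and> (\<forall>S :: 'a std_mod. \<forall>g\<in>lhom (md P) S. simple_module S \<and> (\<exists>x\<in>P. g x \<noteq> 0) \<longrightarrow>
    (\<exists>T\<in>F. simple_module (T :: 'a std_mod) \<and> isomorphic T S))"
  using assms
proof (induction "V.dim P" arbitrary: P rule: less_induct)
  case less
  show ?case
  proof (cases "P = {0}")
    case True
    have "g x = 0" if "g \<in> lhom (md P) S" "x \<in> P" for g and S :: "'a std_mod" and x
      using lhom_zero[OF that(1)] that(2) True by simp
    then show ?thesis by (intro exI[of _ "{}"]) auto
  next
    case False
    obtain T g where T: "simple_module (T :: 'a std_mod)" "g \<in> lhom (md P) T" "g ` P = carr T"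
      by (rule psub_simple_quotient[OF less(2) False])
    obtain L p where L: "cover L p T" by (rule cover_exists[OF simple_fg[OF T(1)]])
    have pL: "psub L" and p: "p \<in> lhom (md L) T" "p ` L = carr T" using L by (auto simp: cover_def)
    obtain f where f: "f \<in> hom P L" "f ` P = L" by (rule cover_split[OF less(2) L T])
    define K where "K = {x \<in> P. f x = 0}"
    obtain e where K: "psub K" "e \<in> hom P K" "\<forall>x\<in>K. e x = x" by (rule split_off[OF less(2) pL f K_def])
    have "V.dim K < V.dim P"
      using dim_split_less[OF less(2) f simple_nonzero_cover[OF L T(1)] psub_sub[OF pL] K_def K(1)] .
    from less(1)[OF this K(1)] obtain F where F: "finite F" "\<forall>S :: 'a std_mod. \<forall>g\<in>lhom (md K) S.
      simple_module S \<and> (\<exists>x\<in>K. g x \<noteq> 0) \<longrightarrow> (\<exists>T\<in>F. simple_module (T :: 'a std_mod) \<and> isomorphic T S)"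
      by blast
    have "\<exists>T'\<in>insert T F. simple_module T' \<and> isomorphic T' S"
      if u: "u \<in> lhom (md P) S" "simple_module S" "x \<in> P" "u x \<noteq> 0" for S :: "'a std_mod" and u x
    proof (cases "\<exists>y\<in>K. u y \<noteq> 0")
      case True
      have "submodule (md P) K" using submodule_md[OF psub_sub[OF less(2)] psub_sub[OF K(1)]] by (simp add: K_def)
      from lhom_restrict0[OF u(1) this] have r: "restrict0 K u \<in> lhom (md K) S" by simp
      have "\<exists>y\<in>K. restrict0 K u y \<noteq> 0" using True by simp
      then show ?thesis using F(2) r u(2) by blast
    next
      case False
      have fk: "u y = 0" if "y \<in> carr (md P)" "f y = 0" for y using False that by (auto simp: K_def)
      have fs: "f ` carr (md P) = carr (md L)" using f(2) by simp
      obtain v where v: "v \<in> lhom (md L) S" "\<And>y. y \<in> carr (md P) \<Longrightarrow> v (f y) = u y"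
        using lhom_factor[OF f(1) fs u(1) lmodule_sub[OF psub_sub[OF less(2)]] fk] by metis
      have vk: "v y = 0" if "y \<in> carr (md L)" "p y = 0" for y
        using jkill_jrad[OF simple_jkill[OF u(2)] psub_sub[OF pL] v(1)] cover_simple_ker[OF L T(1)] that by auto
      have ps: "p ` carr (md L) = carr T" using p(2) by simp
      obtain w where w: "w \<in> lhom T S" "\<And>y. y \<in> carr (md L) \<Longrightarrow> w (p y) = v y"
        using lhom_factor[OF p(1) ps v(1) lmodule_sub[OF psub_sub[OF pL]] vk] by metis
      have "f x \<in> carr (md L)" using f(2) u(3) by auto
      then have "w (p (f x)) \<noteq> 0" "p (f x) \<in> carr T" using w(2) v(2)[of x] u(3,4) p(2) by auto
      then show ?thesis using schur[OF T(1) u(2) w(1)] T(1) by blast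
    qed
    then show ?thesis using F(1) by (intro exI[of _ "insert T F"]) blast
  qed
qed

lemma psub_free: "psub (free n)"
  unfolding psub_def using sub_free lhom_id[OF lmodule_free]
  by (intro conjI exI[of _ n] bexI[of _ "restrict0 (free n) (\<lambda>x. x)"]) auto

text \<open>Every simple module is a quotient of the algebra itself, which is
  \<open>free 1\<close>.\<close>

lemma finite_simples: "finite ({S :: 'a std_mod. simple_module S} // simple_rel)"
proof -
  obtain F where F: "finite F" "\<forall>S :: 'a std_mod. \<forall>g\<in>lhom (md (free 1)) S.
      simple_module S \<and> (\<exists>x\<in>free 1. g x \<noteq> 0) \<longrightarrow> (\<exists>T\<in>F. simple_module (T :: 'a std_mod) \<and> isomorphic T S)"
    using finite_tops[OF psub_free[of 1]] by blast
  have "{S :: 'a std_mod. simple_module S} // simple_rel \<subseteq> (\<lambda>T. simple_rel `` {T}) ` F"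
  proof
    fix c assume "c \<in> {S :: 'a std_mod. simple_module S} // simple_rel"
    then obtain S :: "'a std_mod" where S: "simple_module S" "c = simple_rel `` {S}" by (auto simp: quotient_def)
    have lS: "lmodule S" using S by (simp add: simple_module_def)
    obtain x where x: "x \<in> carr S" "x \<noteq> 0"
      using S lmodule.zero_closed[OF lS] unfolding simple_module_def by blast
    obtain g where g: "g \<in> lhom (md (free 1)) S" "\<And>i. i < 1 \<Longrightarrow> g (unitv i) = x"
      using lhom_from_free[OF lS, of 1 "\<lambda>_. x"] x(1) by metis
    have "g (unitv 0) \<noteq> 0" "unitv 0 \<in> free 1" using g(2)[of 0] x by (auto intro: unitv_free)
    then obtain T where T: "T \<in> F" "simple_module T" "isomorphic T S" using F(2) g(1) S(1) by blast
    have "(T, S) \<in> simple_rel" using T S by (auto simp: simple_rel_def)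
    then have "simple_rel `` {T} = c" using S(2) equiv_class_eq[OF equiv_simple_rel] by metis
    then show "c \<in> (\<lambda>T. simple_rel `` {T}) ` F" using T(1) by blast
  qed
  then show ?thesis using F(1) finite_surj by blast
qed

text \<open>Here splitness enters: an endomorphism of \<open>L\<close> induces one of the top
  \<open>S\<close>, which is a scalar c, and subtracting c times the identity leaves a map into J
  L.\<close>

lemma cover_end:
  fixes L :: "(nat \<Rightarrow> 'a) set" and S :: "'a std_mod"
  assumes L: "cover L p S" and S: "simple_module S"
  shows "h L L = h L (jrad L) + 1"
proof -
  have pL: "psub L" and s: "sub L" and p: "p \<in> lhom (md L) S" "p ` L = carr S" using L psub_sub by (auto simp: cover_def)
  have lS: "lmodule S" using S by (simp add: simple_module_def)
  have "H.dim (hom L L) = Suc (H.dim (hom L (jrad L)))"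
  proof (rule H.dim_insert_compl)
    show "H.subspace (hom L (jrad L))" "H.subspace (hom L L)"
      using subspace_lhom natural_sub sub_jrad s by blast+
    show "hom L (jrad L) \<subseteq> hom L L" using hom_mono jrad_subset[OF s] by blast
    show "H.fdim (hom L L)" using fdim_hom s by blast
    let ?id = "restrict0 L (\<lambda>x. x)"
    show id: "?id \<in> hom L L" using lhom_id[OF lmodule_sub[OF s]] by simp
    obtain x where x: "x \<in> L" "x \<notin> jrad L" using jrad_neq[OF s simple_nonzero_cover[OF L S]] jrad_subset[OF s] by blast
    then show "?id \<notin> hom L (jrad L)" using lhom_closed[of ?id "md L" "md (jrad L)" x] by auto
    fix f assume f: "f \<in> hom L L"
    have pf: "(\<lambda>x. p (f x)) \<in> lhom (md L) S" using lhom_comp[OF f p(1) lmodule_sub[OF s]] .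
    have k: "p (f x) = 0" if "x \<in> carr (md L)" "p x = 0" for x
      using jkill_jrad[OF simple_jkill[OF S] s pf] cover_simple_ker[OF L S] that by auto
    have ps: "p ` carr (md L) = carr S" using p(2) by simp
    obtain g where g: "g \<in> lhom S S" "\<And>x. x \<in> carr (md L) \<Longrightarrow> g (p x) = p (f x)"
      using lhom_factor[OF p(1) ps pf lmodule_sub[OF s] k] by metis
    obtain c where c: "\<forall>x\<in>carr S. g x = act S (scale c 1) x" using split[OF S g(1)] by blast
    let ?d = "f - hsc c ?id"
    have d: "?d \<in> hom L L" using H.subspace_diff[OF subspace_lhom[OF natural_sub[OF s]] f]
        H.subspace_scale[OF subspace_lhom[OF natural_sub[OF s]] id] by blast
    have "?d x \<in> jrad L" if x: "x \<in> L" for x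
    proof -
      have e: "?d x = f x - fmul (scale c 1) x" using x by (simp add: hsc_def vsc_fmul)
      have "p (f x - fmul (scale c 1) x) = p (f x) - act S (scale c 1) (p x)"
        using lhom_diff[OF p(1) lmodule_sub[OF s], of "f x" "fmul (scale c 1) x"] lhom_act[OF p(1), of x]
          lhom_closed[OF f, of x] sub_fmul[OF s] x by simp
      also have "\<dots> = 0" using g(2)[of x] c lhom_closed[OF p(1), of x] x by simp
      finally show ?thesis using e cover_simple_ker[OF L S] lhom_closed[OF d, of x] x by auto
    qed
    then have "?d \<in> hom L (jrad L)" using hom_codom[OF d] by blast
    then show "\<exists>c. f - hsc c ?id \<in> hom L (jrad L)" by blast
  qed
  then show ?thesis by (simp add: h_def)
qed

text \<open>A map that does not land in J L' would induce a nonzero map between the simple tops,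
  contradicting Schur's lemma.\<close>

lemma cover_hom_noniso:
  fixes L L' :: "(nat \<Rightarrow> 'a) set" and S S' :: "'a std_mod"
  assumes L: "cover L p S" "simple_module S" and L': "cover L' p' S'" "simple_module S'"
    and n: "\<not> isomorphic S S'"
  shows "h L L' = h L (jrad L')"
proof -
  have s: "sub L" "sub L'" and p: "p \<in> lhom (md L) S" "p ` L = carr S" and p': "p' \<in> lhom (md L') S'"
    using L L' psub_sub by (auto simp: cover_def)
  have "f x \<in> jrad L'" if f: "f \<in> hom L L'" "x \<in> L" for f x
  proof (rule ccontr)
    assume c: "f x \<notin> jrad L'"
    have pf: "(\<lambda>x. p' (f x)) \<in> lhom (md L) S'" using lhom_comp[OF f(1) p' lmodule_sub[OF s(2)]] .
    have k: "p' (f x) = 0" if "x \<in> carr (md L)" "p x = 0" for x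
      using jkill_jrad[OF simple_jkill[OF L'(2)] s(1) pf] cover_simple_ker[OF L] that by auto
    have ps: "p ` carr (md L) = carr S" using p(2) by simp
    obtain g where g: "g \<in> lhom S S'" "\<And>x. x \<in> carr (md L) \<Longrightarrow> g (p x) = p' (f x)"
      using lhom_factor[OF p(1) ps pf lmodule_sub[OF s(1)] k] by metis
    have "p' (f x) \<noteq> 0" using c cover_simple_ker[OF L'] lhom_closed[OF f(1), of x] f(2) by auto
    then show False using schur[OF L(2) L'(2) g(1), of "p x"] n g(2)[of x] f(2) p(2) by auto
  qed
  then have "hom L L' = hom L (jrad L')"
    using hom_codom[of _ L L' "jrad L'"] hom_mono[OF _ jrad_subset[OF s(2)]] by blast
  then show ?thesis by (simp add: h_def)
qed

text \<open>One projective cover for each isomorphism class of simple modules.\<close>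

definition proj_index :: "(nat \<Rightarrow> 'a) set set \<Rightarrow> bool" where
  "proj_index I \<longleftrightarrow> finite I \<and> card I \<le> num_simples TYPE('a) \<and>
    (\<forall>L\<in>I. \<exists>p. \<exists>S :: 'a std_mod. cover L p S \<and> simple_module S) \<and>
    (\<forall>P. psub P \<and> P \<noteq> {0} \<longrightarrow> (\<exists>L\<in>I. \<exists>f\<in>hom P L. f ` P = L)) \<and>
    (\<forall>L\<in>I. \<forall>L'\<in>I. h L L' - h L (jrad L') = (if L = L' then 1 else 0))"

lemma proj_index_exists: "\<exists>I. proj_index I"
proof -
  let ?Q = "{S :: 'a std_mod. simple_module S} // simple_rel"
  define rep where "rep c = (SOME S. S \<in> c)" for c :: "'a std_mod set"
  have rep: "rep c \<in> c" "simple_module (rep c)" if c: "c \<in> ?Q" for c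
  proof -
    have "\<exists>S. S \<in> c" using in_quotient_imp_non_empty[OF equiv_simple_rel c] by blast
    then show "rep c \<in> c" unfolding rep_def by (rule someI_ex)
    then show "simple_module (rep c)" using in_quotient_imp_subset[OF equiv_simple_rel c] by blast
  qed
  have "\<exists>L. \<exists>p. cover L p (rep c)" if "c \<in> ?Q" for c
    using cover_exists[OF simple_fg[OF rep(2)[OF that]]] by metis
  then obtain L where L: "\<And>c. c \<in> ?Q \<Longrightarrow> \<exists>p. cover (L c) p (rep c)" by metis
  have "proj_index (L ` ?Q)"
    unfolding proj_index_def
  proof (intro conjI ballI allI impI)
    show "finite (L ` ?Q)" using finite_simples by blast
    show "card (L ` ?Q) \<le> num_simples TYPE('a)"
      unfolding num_simples_def using card_image_le[OF finite_simples] .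
  next
    fix l assume "l \<in> L ` ?Q"
    then show "\<exists>p. \<exists>S :: 'a std_mod. cover l p S \<and> simple_module S" using L rep(2) by blast
  next
    fix P :: "(nat \<Rightarrow> 'a) set" assume P: "psub P \<and> P \<noteq> {0}"
    obtain S g where S: "simple_module (S :: 'a std_mod)" "g \<in> lhom (md P) S" "g ` P = carr S"
      using psub_simple_quotient P by metis
    define c where "c = simple_rel `` {S}"
    have c: "c \<in> ?Q" using S(1) by (auto simp: c_def quotientI)
    have "(S, rep c) \<in> simple_rel" using rep(1)[OF c] by (auto simp: c_def)
    then obtain i where i: "i \<in> lhom S (rep c)" "bij_betw i (carr S) (carr (rep c))"
      by (auto simp: simple_rel_def isomorphic_def)
    have lS: "lmodule S" using S by (simp add: simple_module_def)
    have "(\<lambda>x. i (g x)) \<in> lhom (md P) (rep c)" using lhom_comp[OF S(2) i(1) lS] .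
    moreover have "(\<lambda>x. i (g x)) ` P = carr (rep c)" using i(2) S(3) by (simp add: bij_betw_def image_image[symmetric])
    moreover obtain p where "cover (L c) p (rep c)" using L[OF c] by blast
    ultimately obtain f where "f \<in> hom P (L c)" "f ` P = L c"
      using cover_split[of P "L c" p "rep c"] P rep(2)[OF c] by metis
    then show "\<exists>l\<in>L ` ?Q. \<exists>f\<in>hom P l. f ` P = l" using c by blast
  next
    fix l l' assume "l \<in> L ` ?Q" "l' \<in> L ` ?Q"
    then obtain c c' where c: "c \<in> ?Q" "l = L c" "c' \<in> ?Q" "l' = L c'" by blast
    obtain p p' where p: "cover l p (rep c)" "cover l' p' (rep c')" using L c by blast
    show "h l l' - h l (jrad l') = (if l = l' then 1 else 0)"
    proof (cases "l = l'")
      case True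
      then show ?thesis using cover_end[OF p(1) rep(2)[OF c(1)]] by simp
    next
      case False
      have "\<not> isomorphic (rep c) (rep c')"
      proof
        assume "isomorphic (rep c) (rep c')"
        then have "(rep c, rep c') \<in> simple_rel" using rep(2) c by (auto simp: simple_rel_def)
        then have "c = c'" using quotient_eq_iff[OF equiv_simple_rel c(1,3) rep(1)[OF c(1)] rep(1)[OF c(3)]] by blast
        then show False using False c by simp
      qed
      then show ?thesis using cover_hom_noniso[OF p(1) rep(2)[OF c(1)] p(2) rep(2)[OF c(3)]] False by simp
    qed
  qed
  then show ?thesis by blast
qed

end

section \<open>Multiplicities of indecomposable projectives\<close>

locale rad_cube_zero_index = rad_cube_zero scale
  for scale :: "'k::field \<Rightarrow> 'a::{ring,monoid_mult} \<Rightarrow> 'a" +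
  fixes I :: "(nat \<Rightarrow> 'a) set set"
  assumes I: "proj_index I"
begin

lemma finite_I: "finite I" and card_I: "card I \<le> num_simples TYPE('a)"
  using I by (auto simp: proj_index_def)

lemma I_cover: assumes "L \<in> I" obtains p S where "cover L p (S :: 'a std_mod)" "simple_module S"
  using I assms unfolding proj_index_def by blast

lemma I_psub: "L \<in> I \<Longrightarrow> psub L" and I_sub: "L \<in> I \<Longrightarrow> sub L"
  using I_cover psub_sub by (metis cover_def)+

lemma I_delta: "L \<in> I \<Longrightarrow> L' \<in> I \<Longrightarrow> h L L' - h L (jrad L') = (if L = L' then 1 else 0)"
  using I by (auto simp: proj_index_def)

lemma I_surj: "psub P \<Longrightarrow> P \<noteq> {0} \<Longrightarrow> \<exists>L\<in>I. \<exists>f\<in>hom P L. f ` P = L"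
  using I by (auto simp: proj_index_def)

text \<open>For \<open>L\<close> in \<open>I\<close> with top S, this is the multiplicity of S in
  C/J C, since Hom(L, -) is exact and End S = k.\<close>

definition top_mult :: "(nat \<Rightarrow> 'a) set \<Rightarrow> (nat \<Rightarrow> 'a) set \<Rightarrow> real" where
  "top_mult C L = h L C - h L (jrad C)"

text \<open>Here \<open>m L\<close> is the number of copies of \<open>L\<close> in a decomposition
  of \<open>P\<close>. The decomposition itself is not kept, only its effect on dimensions of Hom in
  either argument.\<close>

definition mults :: "(nat \<Rightarrow> 'a) set \<Rightarrow> ((nat \<Rightarrow> 'a) set \<Rightarrow> real) \<Rightarrow> bool" where
  "mults P m \<longleftrightarrow> (\<forall>Z. sub Z \<longrightarrow> h P Z = (\<Sum>L\<in>I. m L * h L Z)) \<and>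
    (\<forall>x. psub x \<longrightarrow> h x P = (\<Sum>L\<in>I. m L * h x L) \<and> h x (jrad P) = (\<Sum>L\<in>I. m L * h x (jrad L)) \<and>
      h x (jrad (jrad P)) = (\<Sum>L\<in>I. m L * h x (jrad (jrad L))))"

lemma psub_decompose:
  assumes "psub P"
  shows "\<exists>m. mults P m"
  using assms
proof (induction "V.dim P" arbitrary: P rule: less_induct)
  case less
  have sP: "sub P" using less psub_sub by blast
  show ?case
  proof (cases "P = {0}")
    case True
    have j: "jrad P = {0}" "jrad (jrad P) = {0}" using True jrad_subset[OF sP] jrad_0 jrad_subset[OF sub_jrad[OF sP]] by auto
    have "hom P Z \<subseteq> H.span {}" for Z
    proof
      fix f assume f: "f \<in> hom P Z"
      have "f x = 0" for x using lhom_zero[OF f] lhom_off[OF f, of x] True by (cases "x = 0") auto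
      then have "f = 0" by (simp add: fun_eq_iff)
      then show "f \<in> H.span {}" by simp
    qed
    then have "h P Z = 0" for Z using H.dim_le_card[of "hom P Z" "{}"] by (simp add: h_def)
    moreover have "h x {0} = 0" if "psub x" for x using h_zero psub_sub that by blast
    ultimately show ?thesis using True j by (intro exI[of _ "\<lambda>_. 0"]) (simp add: mults_def)
  next
    case False
    obtain l f where l: "l \<in> I" and f: "f \<in> hom P l" "f ` P = l" using I_surj[OF less(2) False] by blast
    have pl: "psub l" and sl: "sub l" using I_psub I_sub l by blast+
    define K where "K = {x \<in> P. f x = 0}"
    obtain e where K: "psub K" "e \<in> hom P K" "\<forall>x\<in>K. e x = x" by (rule split_off[OF less(2) pl f K_def])
    have sK: "sub K" "K \<subseteq> P" using K psub_sub by (auto simp: K_def)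
    have lne: "l \<noteq> {0}" using I_cover[OF l] simple_nonzero_cover by metis
    have "V.dim K < V.dim P" using dim_split_less[OF less(2) f lne sl K_def K(1)] .
    from less(1)[OF this K(1)] obtain m where m: "mults K m" by blast
    let ?m = "m(l := m l + 1)"
    have add: "(\<Sum>L\<in>I. ?m L * u L) = (\<Sum>L\<in>I. m L * u L) + u l" for u
    proof -
      have "(\<Sum>L\<in>I. ?m L * u L) = (\<Sum>L\<in>I. m L * u L + (if L = l then u L else 0))"
        by (intro sum.cong) (auto simp: algebra_simps)
      then show ?thesis using l finite_I by (simp add: sum.distrib)
    qed
    have 1: "h P Z = h K Z + h l Z" if Z: "sub Z" for Z
    proof -
      have "restrict0 K ` hom P Z = hom K Z"
      proof (intro equalityI subsetI)
        fix g assume "g \<in> restrict0 K ` hom P Z"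
        then obtain g' where g': "g' \<in> hom P Z" "g = restrict0 K g'" by blast
        then show "g \<in> hom K Z" using lhom_restrict0[OF g'(1) submodule_md[OF sP sK]] by simp
      next
        fix g assume g: "g \<in> hom K Z"
        have ge: "(\<lambda>x. g (e x)) \<in> hom P Z" using lhom_comp[OF K(2) g lmodule_sub[OF sK(1)]] .
        have "g = restrict0 K (\<lambda>x. g (e x))"
        proof
          fix x show "g x = restrict0 K (\<lambda>x. g (e x)) x"
            using K(3) lhom_off[OF g, of x] by (cases "x \<in> K") (auto simp: restrict0_out)
        qed
        then show "g \<in> restrict0 K ` hom P Z" using ge by blast
      qed
      then show ?thesis using h_restrict[OF sP sl Z f K_def] by (simp add: h_def)
    qed
    \<comment> \<open>One computation serves P, J P and J^2 P: \<open>f\<close> and the retraction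
      \<open>e\<close> split each of them into its part in \<open>K\<close> and its image in
      \<open>l\<close>.\<close>
    have 2: "h x C = h x C' + h x C0" if x: "psub x" and C: "sub C" "C \<subseteq> P" and C': "C' \<subseteq> C" "C' \<subseteq> K" "e ` C \<subseteq> C'"
      and C0: "sub C0" "f ` C = C0" for x C C' C0
    proof -
      have r: "restrict0 C f \<in> lhom (md C) (md C0)"
      proof -
        have "restrict0 C f \<in> hom C l" using lhom_restrict0[OF f(1) submodule_md[OF sP C]] by simp
        then show ?thesis using hom_codom[of "restrict0 C f" C l C0] C0(2) by simp
      qed
      have "C' = {y \<in> C. restrict0 C f y = 0}"
      proof (intro equalityI subsetI)
        fix y assume "y \<in> C'"
        then show "y \<in> {y \<in> C. restrict0 C f y = 0}" using C' by (auto simp: K_def subset_iff)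
      next
        fix y assume "y \<in> {y \<in> C. restrict0 C f y = 0}"
        then have "y \<in> C" "y \<in> K" using C by (auto simp: K_def)
        then show "y \<in> C'" using C'(3) K(3) by force
      qed
      moreover have "restrict0 C f ` C = carr (md C0)" using C0(2) by simp
      ultimately show ?thesis using h_exact[OF x C(1) natural_sub[OF C0(1)] r] by (simp add: h_def)
    qed
    have eP: "e ` P \<subseteq> K" using lhom_closed[OF K(2)] by auto
    have fj: "f ` jrad P = jrad l" using jrad_image[OF f(1) sP order_refl] f(2) by simp
    have fjj: "f ` jrad (jrad P) = jrad (jrad l)" using jrad_image[OF f(1) sP jrad_subset[OF sP]] fj by simp
    have ej: "e ` jrad P \<subseteq> jrad K" using jrad_image[OF K(2) sP order_refl] jrad_mono[OF eP] by simp
    have ejj: "e ` jrad (jrad P) \<subseteq> jrad (jrad K)"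
      using jrad_image[OF K(2) sP jrad_subset[OF sP]] jrad_mono[OF ej] by simp
    have jK: "jrad K \<subseteq> jrad P" "jrad (jrad K) \<subseteq> jrad (jrad P)" by (simp_all add: jrad_mono sK(2))
    have jP: "jrad P \<subseteq> P" "jrad (jrad P) \<subseteq> P" and jKK: "jrad K \<subseteq> K" "jrad (jrad K) \<subseteq> K"
      using jrad_subset[OF sP] jrad_subset[OF sub_jrad[OF sP]] jrad_subset[OF sK(1)]
        jrad_subset[OF sub_jrad[OF sK(1)]] by auto
    have "h x P = h x K + h x l" "h x (jrad P) = h x (jrad K) + h x (jrad l)"
      "h x (jrad (jrad P)) = h x (jrad (jrad K)) + h x (jrad (jrad l))" if "psub x" for x
      using 2[OF that sP order_refl sK(2) order_refl eP sl f(2)]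
        2[OF that sub_jrad[OF sP] jP(1) jK(1) jKK(1) ej sub_jrad[OF sl] fj]
        2[OF that sub_jrad[OF sub_jrad[OF sP]] jP(2) jK(2) jKK(2) ejj sub_jrad[OF sub_jrad[OF sl]] fjj] by blast+
    then have "mults P ?m" using 1 m unfolding mults_def add by simp
    then show ?thesis by blast
  qed
qed

text \<open>The abstract multiplicities are identified by comparing Hom(L, P) with Hom(L, J P),
  where \<open>I_delta\<close> isolates a single summand.\<close>

lemma psub_multiplicities:
  assumes P: "psub P"
  shows "sub Z \<Longrightarrow> h P Z = (\<Sum>L\<in>I. top_mult P L * h L Z)"
    and "psub x \<Longrightarrow> h x P = (\<Sum>L\<in>I. top_mult P L * h x L)"
    and "psub x \<Longrightarrow> h x (jrad P) = (\<Sum>L\<in>I. top_mult P L * h x (jrad L))"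
    and "psub x \<Longrightarrow> h x (jrad (jrad P)) = (\<Sum>L\<in>I. top_mult P L * h x (jrad (jrad L)))"
proof -
  obtain m where "mults P m" using psub_decompose[OF P] by blast
  then have m: "\<And>Z. sub Z \<Longrightarrow> h P Z = (\<Sum>L\<in>I. m L * h L Z)"
    "\<And>x. psub x \<Longrightarrow> h x P = (\<Sum>L\<in>I. m L * h x L)"
    "\<And>x. psub x \<Longrightarrow> h x (jrad P) = (\<Sum>L\<in>I. m L * h x (jrad L))"
    "\<And>x. psub x \<Longrightarrow> h x (jrad (jrad P)) = (\<Sum>L\<in>I. m L * h x (jrad (jrad L)))"
    by (simp_all add: mults_def)
  have "m L = top_mult P L" if L: "L \<in> I" for L
  proof -
    have "top_mult P L = (\<Sum>L'\<in>I. m L' * (h L L' - h L (jrad L')))"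
      using m(2,3)[OF I_psub[OF L]] by (simp add: top_mult_def right_diff_distrib sum_subtractf)
    also have "\<dots> = (\<Sum>L'\<in>I. if L' = L then m L' else 0)"
      using I_delta[OF L] by (intro sum.cong) auto
    finally show ?thesis using L finite_I by simp
  qed
  then have e: "(\<Sum>L\<in>I. m L * u L) = (\<Sum>L\<in>I. top_mult P L * u L)" for u by simp
  show "sub Z \<Longrightarrow> h P Z = (\<Sum>L\<in>I. top_mult P L * h L Z)"
    "psub x \<Longrightarrow> h x P = (\<Sum>L\<in>I. top_mult P L * h x L)"
    "psub x \<Longrightarrow> h x (jrad P) = (\<Sum>L\<in>I. top_mult P L * h x (jrad L))"
    "psub x \<Longrightarrow> h x (jrad (jrad P)) = (\<Sum>L\<in>I. top_mult P L * h x (jrad (jrad L)))"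
    using m by (simp_all only: e)
qed

text \<open>The maps counted are those on the semisimple module W = C/D. With a cover
  \<open>Q\<close> of W they correspond to the maps Q -> Z, because the kernel of the cover is J Q
  and J Z = 0. The multiplicities of \<open>Q\<close> are dim Hom(L, W) =
  \<open>h L C - h L D\<close>.\<close>

lemma hom_semisimple:
  assumes C: "sub C" and D: "sub D" "D \<subseteq> C" "jrad C \<subseteq> D" and Z: "sub Z" "jrad Z = {0}"
  shows "real (H.dim {f \<in> hom C Z. \<forall>x\<in>D. f x = 0}) = (\<Sum>L\<in>I. (h L C - h L D) * h L Z)"
proof -
  obtain W r where W: "natural W" "r \<in> lhom (md C) W" "r ` C = carr W" "{x \<in> C. r x = 0} = D"
    by (rule quotient_exists[OF C D(1,2)])
  have lW: "lmodule W" and lC: "lmodule (md C)" using W C by (auto simp: natural_def lmodule_sub)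
  have jW: "jkill W"
    unfolding jkill_def
  proof (intro ballI)
    fix a :: 'a and y assume a: "a \<in> jacobson_radical" and y: "y \<in> carr W"
    have "y \<in> r ` C" using y W(3) by simp
    then obtain x where x: "y = r x" "x \<in> C" by (rule imageE)
    have "fmul a x \<in> D" using jrad_fmul[OF a x(2)] D(3) by blast
    then show "act W a y = 0" using W(4) lhom_act[OF W(2), of x a] x by auto
  qed
  have fgW: "fg_module W"
    unfolding fg_module_def
  proof (intro conjI lW)
    obtain G where G: "finite G" "G \<subseteq> C" "\<And>N. submodule (md C) N \<Longrightarrow> G \<subseteq> N \<Longrightarrow> N = C"
      using fg_sub[OF C] by (auto simp: fg_module_def)
    show "\<exists>G. finite G \<and> G \<subseteq> carr W \<and> (\<forall>N. submodule W N \<and> G \<subseteq> N \<longrightarrow> N = carr W)"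
    proof (intro exI[of _ "r ` G"] conjI allI impI)
      fix N assume N: "submodule W N \<and> r ` G \<subseteq> N"
      have "{x \<in> C. r x \<in> N} = C"
        using G(2) N submodule_vimage[OF W(2) lC, of N] by (intro G(3)) auto
      then have "r ` C \<subseteq> N" by blast
      then have "carr W \<subseteq> N" using W(3) by simp
      then show "N = carr W" using N by (auto simp: submodule_def)
    qed (use G W in auto)
  qed
  obtain Q q where "cover Q q W" by (rule cover_exists[OF fgW])
  then have Q: "psub Q" "sub Q" "q \<in> lhom (md Q) W" "q ` Q = carr W" "\<And>x. x \<in> Q \<Longrightarrow> q x = 0 \<Longrightarrow> x \<in> jrad Q"
    using psub_sub by (auto simp: cover_def)
  have kq: "jrad Q = {x \<in> Q. q x = 0}"
    using jkill_jrad[OF jW Q(2,3)] Q(5) jrad_subset[OF Q(2)] by blast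
  have im: "q ` carr (md Q) \<subseteq> r ` carr (md C)" using Q(4) W(3) by simp
  obtain u where u: "u \<in> hom Q C" "\<And>x. x \<in> carr (md Q) \<Longrightarrow> r (u x) = q x"
    using rfree_lift[OF psub_rfree[OF Q(1)] W(2) lC lW Q(3) im] by metis
  let ?U = "{f \<in> hom C Z. \<forall>x\<in>D. f x = 0}"
  let ?F = "\<lambda>f. restrict0 Q (\<lambda>x. f (u x))"
  have sU: "H.subspace ?U"
    using subspace_lhom[OF natural_sub[OF Z(1)], of "md C"]
    by (auto simp: H.subspace_def hsc_def)
  have W_sur: "\<exists>x\<in>Q. y - u x \<in> D" if y: "y \<in> C" for y
  proof -
    have "r y \<in> q ` Q" using W(3) Q(4) y by blast
    then obtain x where x: "r y = q x" "x \<in> Q" by (rule imageE)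
    have "u x \<in> C" using lhom_closed[OF u(1), of x] x by simp
    then have "r (y - u x) = 0" "y - u x \<in> C"
      using lhom_diff[OF W(2) lC, of y "u x"] y u(2)[of x] x sub_diff[OF C] by auto
    then show ?thesis using x(2) W(4) by blast
  qed
  have "?F ` ?U = hom Q Z"
  proof (intro equalityI subsetI)
    fix g assume "g \<in> ?F ` ?U"
    then obtain f where f: "f \<in> hom C Z" "g = ?F f" by blast
    have "g = (\<lambda>x. f (u x))"
    proof
      fix x show "g x = f (u x)"
        using f(2) lhom_off[OF u(1), of x] lhom_zero[OF f(1)] sub_0[OF C]
        by (cases "x \<in> Q") (simp_all add: restrict0_out)
    qed
    then show "g \<in> hom Q Z" using lhom_comp[OF u(1) f(1) lC] by simp
  next
    fix g assume g: "g \<in> hom Q Z"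
    have gk: "g x = 0" if "x \<in> carr (md Q)" "q x = 0" for x
      using jkill_jrad[OF jkill_md[OF Z] Q(2) g] that kq by auto
    have qs: "q ` carr (md Q) = carr W" using Q(4) by simp
    obtain v where v: "v \<in> lhom W (md Z)" "\<And>x. x \<in> carr (md Q) \<Longrightarrow> v (q x) = g x"
      using lhom_factor[OF Q(3) qs g lmodule_sub[OF Q(2)] gk] by metis
    have vr: "(\<lambda>x. v (r x)) \<in> hom C Z" using lhom_comp[OF W(2) v(1) lW] .
    have "v 0 = 0" using lhom_zero[OF v(1) lmodule.zero_closed[OF lW]] .
    then have "(\<lambda>x. v (r x)) \<in> ?U" using vr W(4) by auto
    moreover have "g = ?F (\<lambda>x. v (r x))"
    proof
      fix x show "g x = ?F (\<lambda>x. v (r x)) x"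
        using v(2)[of x] u(2)[of x] lhom_off[OF g, of x] by (cases "x \<in> Q") (simp_all add: restrict0_out)
    qed
    ultimately show "g \<in> ?F ` ?U" by (intro image_eqI[of _ _ "\<lambda>x. v (r x)"])
  qed
  moreover have "H.dim ?U = H.dim (?F ` ?U)"
  proof (rule rank_nullity_hom_inj[OF C Z(1) _ sU linear_on_precomp])
    fix f assume f: "f \<in> ?U" "?F f = 0"
    then have fh: "f \<in> hom C Z" by simp
    have "f y = 0" for y
    proof (cases "y \<in> C")
      case True
      obtain x where x: "x \<in> Q" "y - u x \<in> D" using W_sur[OF \<open>y \<in> C\<close>] by blast
      have "f (u x) = 0" using fun_cong[OF f(2), of x] x(1) by simp
      moreover have "f (y - u x) = f y - f (u x)"
        using lhom_diff[OF fh lC, of y "u x"] True lhom_closed[OF u(1), of x] x(1) by simp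
      ultimately show ?thesis using f(1) x(2) by simp
    qed (use lhom_off[OF fh, of y] in simp)
    then show "f = 0" by (simp add: fun_eq_iff)
  qed auto
  ultimately have "real (H.dim ?U) = h Q Z" by (simp add: h_def)
  also have "\<dots> = (\<Sum>L\<in>I. top_mult Q L * h L Z)" using psub_multiplicities(1)[OF Q(1) Z(1)] .
  also have "\<dots> = (\<Sum>L\<in>I. (h L C - h L D) * h L Z)"
  proof (rule sum.cong[OF refl])
    fix L assume L: "L \<in> I"
    have "h L C = h L D + real (H.dim (lhom (md L) W))"
      using h_exact[OF I_psub[OF L] C W(1-3)] W(4) by simp
    moreover have "h L Q = h L (jrad Q) + real (H.dim (lhom (md L) W))"
      using h_exact[OF I_psub[OF L] Q(2) W(1) Q(3,4)] kq by simp
    ultimately show "top_mult Q L * h L Z = (h L C - h L D) * h L Z" by (simp add: top_mult_def)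
  qed
  finally show ?thesis .
qed

lemma hom_semisimple_top:
  assumes C: "sub C" and Z: "sub Z" "jrad Z = {0}"
  shows "h C Z = (\<Sum>L\<in>I. top_mult C L * h L Z)"
proof -
  have "{f \<in> hom C Z. \<forall>x\<in>jrad C. f x = 0} = hom C Z"
    using jkill_jrad[OF jkill_md[OF Z] C] by blast
  then show ?thesis
    using hom_semisimple[OF C sub_jrad[OF C] jrad_subset[OF C] order_refl Z] by (simp add: h_def top_mult_def)
qed

end

section \<open>Vanishing of Ext and syzygies\<close>

definition pres :: "'a::{ring,monoid_mult} std_mod \<Rightarrow> ((nat \<Rightarrow> 'a) \<Rightarrow> 'm) \<Rightarrow> ('a, 'm::ab_group_add) lmod \<Rightarrow> bool" where
  "pres P p Y \<longleftrightarrow> rfree P \<and> p \<in> lhom P Y \<and> p ` carr P = carr Y"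

definition ker :: "('a, 'p) lmod \<Rightarrow> ('p \<Rightarrow> 'm::zero) \<Rightarrow> ('a, 'p) lmod" where
  "ker P p = on P {x \<in> carr P. p x = 0}"

text \<open>This is Ext^1(Y, N) = 0, where Y is the module that \<open>p\<close> presents as a
  quotient of the projective \<open>P\<close>.\<close>

definition ext_ok :: "('a, 'p::ab_group_add) lmod \<Rightarrow> ('p \<Rightarrow> 'm::zero) \<Rightarrow> ('a, 'n::ab_group_add) lmod \<Rightarrow> bool" where
  "ext_ok P p N \<longleftrightarrow> (\<forall>f\<in>lhom (ker P p) N. \<exists>F\<in>lhom P N. \<forall>x\<in>carr P. p x = 0 \<longrightarrow> F x = f x)"

lemma ext_okD:
  assumes "ext_ok P p N" "f \<in> lhom (ker P p) N"
  obtains F where "F \<in> lhom P N" "\<forall>x\<in>carr P. p x = 0 \<longrightarrow> F x = f x"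
  using bspec[OF assms(1)[unfolded ext_ok_def] assms(2)] by blast

lemma projectiveD:
  fixes X Y :: "'a::{ring,monoid_mult} std_mod"
  assumes "projective M" "g \<in> lhom X Y" "f \<in> lhom M Y" "fg_module X" "fg_module Y" "g ` carr X = carr Y"
  obtains u where "u \<in> lhom M X" "\<forall>x\<in>carr M. g (u x) = f x"
proof -
  have "\<exists>u\<in>lhom M X. \<forall>x\<in>carr M. g (u x) = f x"
    using assms(1)[unfolded projective_def, rule_format, OF assms(2,3)] assms(4-6) by simp
  then show ?thesis using that by blast
qed

lemma carr_ker: "carr (ker P p) = {x \<in> carr P. p x = 0}"
  by (simp add: ker_def)

lemma ker_md: "ker (md P) p = md {x \<in> P. p x = 0}"
  by (simp add: ker_def)

lemma pres_lmodule: "pres P p Y \<Longrightarrow> lmodule P"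
  by (simp add: pres_def rfree_def)

lemma submodule_ker': "pres P p Y \<Longrightarrow> lmodule Y \<Longrightarrow> submodule P {x \<in> carr P. p x = 0}"
  using submodule_ker[of p P Y] pres_lmodule[of P p Y] by (simp add: pres_def)

lemma lmodule_ker: "pres P p Y \<Longrightarrow> lmodule Y \<Longrightarrow> lmodule (ker P p)"
  unfolding ker_def using lmodule_on[OF pres_lmodule submodule_ker'] by blast

lemma lhom_ker_incl: "pres P p Y \<Longrightarrow> lmodule Y \<Longrightarrow> restrict0 (carr (ker P p)) (\<lambda>x. x) \<in> lhom (ker P p) P"
  using lhom_incl[OF submodule_ker'] by (simp add: ker_def)

lemma lhom_ker_restrict:
  "pres P p Y \<Longrightarrow> lmodule Y \<Longrightarrow> f \<in> lhom P N \<Longrightarrow> restrict0 (carr (ker P p)) f \<in> lhom (ker P p) N"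
  using lhom_restrict0[OF _ submodule_ker'] by (simp add: ker_def)

lemma lhom_to_ker: "f \<in> lhom M P \<Longrightarrow> (\<And>x. x \<in> carr M \<Longrightarrow> p (f x) = 0) \<Longrightarrow> f \<in> lhom M (ker P p)"
  unfolding ker_def by (intro lhom_codom) (auto simp: lhom_closed)

lemma lhom_from_ker: "f \<in> lhom M (ker P p) \<Longrightarrow> f \<in> lhom M P"
  unfolding ker_def by (rule lhom_codomD) auto

text \<open>\<open>Y'\<close> is a direct summand of \<open>Y\<close> in the stable module category.\<close>

definition stab_le :: "('a::{ring,monoid_mult}, 'm::ab_group_add) lmod \<Rightarrow> ('a, 'n::ab_group_add) lmod \<Rightarrow> bool" where
  "stab_le Y' Y \<longleftrightarrow> (\<exists>\<alpha>\<in>lhom Y' Y. \<exists>\<beta>\<in>lhom Y Y'. \<exists>Q :: 'a std_mod. rfree Q \<and>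
     (\<exists>\<delta>\<in>lhom Y' Q. \<exists>\<gamma>\<in>lhom Q Y'. \<forall>x\<in>carr Y'. x = \<beta> (\<alpha> x) + \<gamma> (\<delta> x)))"

text \<open>The maps \<alpha>, \<beta>, \<gamma> are lifted to the projectives as \<open>u\<close>,
  \<open>v\<close>, \<open>c\<close>. The remainder \<open>w\<close> has values in the kernel of
  \<open>p'\<close> although it is defined on all of \<open>P'\<close>; on that kernel it is the
  failure of v u to be the identity, and this failure thus factors through a projective.\<close>

lemma stab_le_syzygy:
  fixes Y' :: "('a::{ring,monoid_mult}, 'm::ab_group_add) lmod" and Y :: "('a, 'n::ab_group_add) lmod"
  assumes le: "stab_le Y' Y" and l: "lmodule Y'" "lmodule Y" and P': "pres P' p' Y'" and P: "pres P p Y"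
  shows "\<exists>u\<in>lhom P' P. \<exists>v\<in>lhom P P'. \<exists>w\<in>lhom P' (ker P' p'). (\<forall>x\<in>carr P'. p' x = 0 \<longrightarrow> p (u x) = 0) \<and>
    (\<forall>x\<in>carr P. p x = 0 \<longrightarrow> p' (v x) = 0) \<and> (\<forall>x\<in>carr P'. p' x = 0 \<longrightarrow> x = v (u x) + w x)"
proof -
  obtain \<alpha> \<beta> \<delta> \<gamma> and Q :: "'a std_mod" where a: "\<alpha> \<in> lhom Y' Y" and b: "\<beta> \<in> lhom Y Y'" and Q: "rfree Q"
    and d: "\<delta> \<in> lhom Y' Q" and g: "\<gamma> \<in> lhom Q Y'" and e: "\<forall>x\<in>carr Y'. x = \<beta> (\<alpha> x) + \<gamma> (\<delta> x)"
    using le unfolding stab_le_def by blast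
  have lP: "lmodule P" "lmodule P'" and lQ: "lmodule Q" using pres_lmodule P P' Q by (auto simp: rfree_def)
  have rP: "rfree P" "rfree P'" and p: "p \<in> lhom P Y" "p ` carr P = carr Y" and p': "p' \<in> lhom P' Y'" "p' ` carr P' = carr Y'"
    using P P' by (auto simp: pres_def)
  have ap: "(\<lambda>x. \<alpha> (p' x)) \<in> lhom P' Y" and bp: "(\<lambda>x. \<beta> (p x)) \<in> lhom P Y'"
    using lhom_comp[OF p'(1) a l(1)] lhom_comp[OF p(1) b l(2)] by blast+
  obtain u where u: "u \<in> lhom P' P" "\<And>x. x \<in> carr P' \<Longrightarrow> p (u x) = \<alpha> (p' x)"
    using rfree_lift[OF rP(2) p(1) lP(1) l(2) ap] lhom_closed[OF ap] p(2) by (metis image_subsetI)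
  obtain v where v: "v \<in> lhom P P'" "\<And>x. x \<in> carr P \<Longrightarrow> p' (v x) = \<beta> (p x)"
    using rfree_lift[OF rP(1) p'(1) lP(2) l(1) bp] lhom_closed[OF bp] p'(2) by (metis image_subsetI)
  obtain c where c: "c \<in> lhom Q P'" "\<And>x. x \<in> carr Q \<Longrightarrow> p' (c x) = \<gamma> x"
    using rfree_lift[OF Q p'(1) lP(2) l(1) g] lhom_closed[OF g] p'(2) by (metis image_subsetI)
  define w where "w x = restrict0 (carr P') (\<lambda>x. x) x - v (u x) - c (\<delta> (p' x))" for x
  have vu: "(\<lambda>x. v (u x)) \<in> lhom P' P'" using lhom_comp[OF u(1) v(1) lP(1)] .
  have dp: "(\<lambda>x. \<delta> (p' x)) \<in> lhom P' Q" using lhom_comp[OF p'(1) d l(1)] .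
  have cd: "(\<lambda>x. c (\<delta> (p' x))) \<in> lhom P' P'" using lhom_comp[OF dp c(1) lQ] .
  have w: "w \<in> lhom P' P'"
    unfolding w_def by (rule lhom_minus[OF lhom_minus[OF lhom_id[OF lP(2)] vu lP(2)] cd lP(2)])
  have "p' (w x) = 0" if x: "x \<in> carr P'" for x
  proof -
    have m: "v (u x) \<in> carr P'" "c (\<delta> (p' x)) \<in> carr P'" "x - v (u x) \<in> carr P'"
      using lhom_closed[OF vu x] lhom_closed[OF cd x] lmodule.diff_closed[OF lP(2) x] by auto
    have "p' (w x) = p' x - p' (v (u x)) - p' (c (\<delta> (p' x)))"
      using x m by (simp add: w_def lhom_diff[OF p'(1) lP(2)])
    also have "\<dots> = p' x - \<beta> (\<alpha> (p' x)) - \<gamma> (\<delta> (p' x))"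
      using v(2) u x lhom_closed[OF u(1) x] c(2) lhom_closed[OF dp x] by simp
    also have "\<dots> = 0"
    proof -
      have "p' x = \<beta> (\<alpha> (p' x)) + \<gamma> (\<delta> (p' x))" using e lhom_closed[OF p'(1) x] by blast
      then show ?thesis by (metis add_diff_cancel_left' diff_self)
    qed
    finally show ?thesis .
  qed
  then have wk: "w \<in> lhom P' (ker P' p')" using lhom_to_ker[OF w] by blast
  have z: "\<alpha> 0 = 0" "\<beta> 0 = 0" "\<delta> 0 = 0" "c 0 = 0"
    using lhom_zero a b d c(1) l lQ lmodule.zero_closed by blast+
  show ?thesis
  proof (rule bexI[OF _ u(1)], rule bexI[OF _ v(1)], rule bexI[OF _ wk], intro conjI ballI impI)
    show "p (u x) = 0" if "x \<in> carr P'" "p' x = 0" for x using u(2) that z by simp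
    show "p' (v x) = 0" if "x \<in> carr P" "p x = 0" for x using v(2) that z by simp
    show "x = v (u x) + w x" if "x \<in> carr P'" "p' x = 0" for x
      using that z by (simp add: w_def)
  qed
qed

text \<open>If \<open>F\<close> extends f v from the kernel of \<open>p\<close>, then F u + f w
  extends \<open>f\<close>, since v u + w is the identity on the kernel of
  \<open>p'\<close>.\<close>

lemma ext_ok_stab_le:
  fixes Y' :: "('a::{ring,monoid_mult}, 'm::ab_group_add) lmod" and Y :: "('a, 'n::ab_group_add) lmod"
  assumes le: "stab_le Y' Y" and l: "lmodule Y'" "lmodule Y" and P': "pres P' p' Y'" and P: "pres P p Y"
    and N: "lmodule N" and ok: "ext_ok P p N"
  shows "ext_ok P' p' N"
  unfolding ext_ok_def
proof
  obtain u v w where u: "u \<in> lhom P' P" "\<forall>x\<in>carr P'. p' x = 0 \<longrightarrow> p (u x) = 0"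
    and v: "v \<in> lhom P P'" "\<forall>x\<in>carr P. p x = 0 \<longrightarrow> p' (v x) = 0" and w: "w \<in> lhom P' (ker P' p')"
    and e: "\<forall>x\<in>carr P'. p' x = 0 \<longrightarrow> x = v (u x) + w x"
    using stab_le_syzygy[OF le l P' P] by blast
  have lk: "lmodule (ker P' p')" using lmodule_ker[OF P' l(1)] .
  fix f assume f: "f \<in> lhom (ker P' p') N"
  have vk: "restrict0 (carr (ker P p)) v \<in> lhom (ker P p) (ker P' p')"
    using lhom_to_ker[OF lhom_ker_restrict[OF P l(2) v(1)], of p'] v(2) by (simp add: carr_ker)
  have fv: "(\<lambda>x. f (restrict0 (carr (ker P p)) v x)) \<in> lhom (ker P p) N" using lhom_comp[OF vk f lk] .
  obtain F where F: "F \<in> lhom P N" "\<forall>x\<in>carr P. p x = 0 \<longrightarrow> F x = f (restrict0 (carr (ker P p)) v x)"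
    by (rule ext_okD[OF ok fv])
  have 1: "(\<lambda>x. F (u x)) \<in> lhom P' N" using lhom_comp[OF u(1) F(1) pres_lmodule[OF P]] .
  have 2: "(\<lambda>x. f (w x)) \<in> lhom P' N" using lhom_comp[OF w f lk] .
  show "\<exists>F\<in>lhom P' N. \<forall>x\<in>carr P'. p' x = 0 \<longrightarrow> F x = f x"
  proof (rule bexI[OF _ lhom_plus[OF 1 2 N]], intro ballI impI)
    fix x assume x: "x \<in> carr P'" "p' x = 0"
    have ux: "u x \<in> carr P" "p (u x) = 0" using u x lhom_closed[OF u(1)] by auto
    then have "F (u x) = f (v (u x))" using F(2) by (simp add: carr_ker)
    moreover have "v (u x) \<in> carr (ker P' p')" using v ux lhom_closed[OF v(1)] by (auto simp: carr_ker)
    moreover have "x = v (u x) + w x" using e x by blast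
    ultimately show "F (u x) + f (w x) = f x" using lhom_add[OF f _ lhom_closed[OF w x(1)]] by metis
  qed
qed

text \<open>Taking syzygies preserves stable summands: \<open>w\<close>, precomposed with the
  inclusion into \<open>P'\<close>, is the required map through a projective.\<close>

lemma stab_le_ker:
  fixes Y' :: "('a::{ring,monoid_mult}, 'm::ab_group_add) lmod" and Y :: "('a, 'n::ab_group_add) lmod"
  assumes le: "stab_le Y' Y" and l: "lmodule Y'" "lmodule Y" and P': "pres P' p' Y'" and P: "pres P p Y"
  shows "stab_le (ker P' p') (ker P p)"
proof -
  obtain u v w where u: "u \<in> lhom P' P" "\<forall>x\<in>carr P'. p' x = 0 \<longrightarrow> p (u x) = 0"
    and v: "v \<in> lhom P P'" "\<forall>x\<in>carr P. p x = 0 \<longrightarrow> p' (v x) = 0" and w: "w \<in> lhom P' (ker P' p')"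
    and e: "\<forall>x\<in>carr P'. p' x = 0 \<longrightarrow> x = v (u x) + w x"
    using stab_le_syzygy[OF le l P' P] by blast
  have uk: "restrict0 (carr (ker P' p')) u \<in> lhom (ker P' p') (ker P p)"
    using lhom_to_ker[OF lhom_ker_restrict[OF P' l(1) u(1)], of p] u(2) by (simp add: carr_ker)
  have vk: "restrict0 (carr (ker P p)) v \<in> lhom (ker P p) (ker P' p')"
    using lhom_to_ker[OF lhom_ker_restrict[OF P l(2) v(1)], of p'] v(2) by (simp add: carr_ker)
  have i: "restrict0 (carr (ker P' p')) (\<lambda>x. x) \<in> lhom (ker P' p') P'" using lhom_ker_incl[OF P' l(1)] .
  have rP': "rfree P'" using P' by (simp add: pres_def)
  show ?thesis
    unfolding stab_le_def
  proof (rule bexI[OF _ uk], rule bexI[OF _ vk], rule exI[of _ P'], rule conjI[OF rP'],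
      rule bexI[OF _ i], rule bexI[OF _ w], rule ballI)
    fix x assume x: "x \<in> carr (ker P' p')"
    then have "u x \<in> carr (ker P p)" using lhom_closed[OF uk x] by simp
    moreover have "x = v (u x) + w x" using e x by (simp add: carr_ker)
    ultimately show "x = restrict0 (carr (ker P p)) v (restrict0 (carr (ker P' p')) u x)
        + w (restrict0 (carr (ker P' p')) (\<lambda>x. x) x)"
      using x by simp
  qed
qed

text \<open>\<open>ev i Y N\<close> expresses \<open>Ext\<^sup>i\<^sup>+\<^sup>1(Y, N) = 0\<close>, independently of a chosen resolution.\<close>

primrec ev :: "nat \<Rightarrow> 'a::{ring,monoid_mult} std_mod \<Rightarrow> ('a, 'n::ab_group_add) lmod \<Rightarrow> bool" where
  "ev 0 Y N \<longleftrightarrow> (\<forall>P p. pres P p Y \<longrightarrow> ext_ok P p N)"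
| "ev (Suc i) Y N \<longleftrightarrow> (\<forall>P p. pres P p Y \<longrightarrow> ev i (ker P p) N)"

text \<open>Transfers vanishing from one given resolution to all presentations: the successive
  kernels of any presentations starting at \<open>Z\<close> remain stable summands of the given
  syzygies.\<close>

lemma ev_chain:
  assumes Y: "\<And>n. pres (P n) (p n) (Y n)" "\<And>n. Y (Suc n) = ker (P n) (p n)" and l: "\<And>n. lmodule (Y n)"
    and N: "lmodule N" and Z: "stab_le Z (Y n)" "lmodule Z" and ok: "ext_ok (P (n + i)) (p (n + i)) N"
  shows "ev i Z N"
  using Z ok
proof (induction i arbitrary: Z n)
  case 0
  then show ?case using ext_ok_stab_le[OF 0(1,2) l _ Y(1) N] by simp
next
  case (Suc i)
  have "ev i (ker Q q) N" if Q: "pres Q q Z" for Q q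
  proof (rule Suc.IH)
    show "stab_le (ker Q q) (Y (Suc n))" unfolding Y(2) using stab_le_ker[OF Suc(2,3) l Q Y(1)] .
    show "lmodule (ker Q q)" using lmodule_ker[OF Q Suc(3)] .
    show "ext_ok (P (Suc n + i)) (p (Suc n + i)) N" using Suc(4) by simp
  qed
  then show ?case by simp
qed

text \<open>The map is extended coordinate by coordinate into the algebra, and the result is
  retracted from A^n onto \<open>L\<close>.\<close>

lemma ext_ok_regular:
  fixes P :: "('a::{ring,monoid_mult}, 'p::ab_group_add) lmod"
  assumes lP: "lmodule P" and ok: "ext_ok P p (regular_module :: ('a, 'a) lmod)" and L: "psub L"
    and lk: "lmodule (ker P p)"
  shows "ext_ok P p (md L)"
  unfolding ext_ok_def
proof
  obtain n r where n: "L \<subseteq> free n" "r \<in> lhom (md (free n)) (md L)" "\<forall>x\<in>L. r x = x"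
    using L by (auto simp: psub_def)
  fix f assume f: "f \<in> lhom (ker P p) (md L)"
  have fj: "(\<lambda>x. f x j) \<in> lhom (ker P p) (regular_module :: ('a, 'a) lmod)" for j
    using f by (auto simp: lhom_def regular_module_def fmul_def)
  have "\<exists>F\<in>lhom P (regular_module :: ('a, 'a) lmod). \<forall>x\<in>carr P. p x = 0 \<longrightarrow> F x = f x j" for j
    by (rule ext_okD[OF ok fj]) (rule bexI)
  then obtain F where F: "\<And>j. F j \<in> lhom P (regular_module :: ('a, 'a) lmod)"
    "\<And>j x. x \<in> carr P \<Longrightarrow> p x = 0 \<Longrightarrow> F j x = f x j" by metis
  define G where "G x = (\<lambda>j. if j < n then F j x else 0)" for x
  have "G \<in> lhom P (md (free n))"
  proof (rule lhomI)
    show "G x \<in> carr (md (free n))" for x by (simp add: G_def free_def)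
    show "G (x + y) = G x + G y" if "x \<in> carr P" "y \<in> carr P" for x y
      using lhom_add[OF F(1) that] by (simp add: G_def fun_eq_iff)
    show "G (act P a x) = act (md (free n)) a (G x)" if "x \<in> carr P" for a x
      using lhom_act[OF F(1) that] by (simp add: G_def fun_eq_iff fmul_def regular_module_def)
    show "G x = 0" if "x \<notin> carr P" for x using lhom_off[OF F(1) that] by (simp add: G_def fun_eq_iff)
  qed
  then have rG: "(\<lambda>x. r (G x)) \<in> lhom P (md L)" using lhom_comp[OF _ n(2) lmodule_free] by blast
  show "\<exists>F\<in>lhom P (md L). \<forall>x\<in>carr P. p x = 0 \<longrightarrow> F x = f x"
  proof (rule bexI[OF _ rG], intro ballI impI)
    fix x assume x: "x \<in> carr P" "p x = 0"
    then have fL: "f x \<in> L" using lhom_closed[OF f, of x] by (simp add: carr_ker)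
    have "G x = f x"
    proof
      fix j show "G x j = f x j" using F(2)[OF x] fL n(1) by (auto simp: G_def free_def)
    qed
    then show "r (G x) = f x" using fL n(3) by simp
  qed
qed

lemma ev_regular:
  assumes "ev i Y (regular_module :: ('a::{ring,monoid_mult}, 'a) lmod)" "lmodule Y" "psub L"
  shows "ev i Y (md L)"
  using assms(1,2)
proof (induction i arbitrary: Y)
  case 0
  have "ext_ok P p (md L)" if P: "pres P p Y" for P p
    using ext_ok_regular[OF pres_lmodule[OF P] _ assms(3) lmodule_ker[OF P 0(2)]] 0(1) P by simp
  then show ?case by simp
next
  case (Suc i)
  have "ev i (ker P p) (md L)" if P: "pres P p Y" for P p
    using Suc(1)[OF _ lmodule_ker[OF P Suc(3)]] Suc(2) P by simp
  then show ?case by simp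
qed

text \<open>The connecting map of \<open>0 \<rightarrow> X \<rightarrow> P0 \<rightarrow> M \<rightarrow> 0\<close>.\<close>

lemma ext_ok_shift:
  fixes M :: "('a::{ring,monoid_mult}, 'm::ab_group_add) lmod" and Y :: "('a, 'y::ab_group_add) lmod"
  assumes P0: "pres P0 p0 M" and lM: "lmodule M" and lY: "lmodule Y"
    and P: "pres P p Y" and P': "pres P' p' (ker P p)"
    and ok: "ext_ok P p M" "ext_ok P' p' P0"
  shows "ext_ok P' p' (ker P0 p0)"
  unfolding ext_ok_def
proof
  have l: "lmodule P0" "lmodule P" "lmodule P'" "lmodule (ker P p)"
    using pres_lmodule P0 P P' lmodule_ker[OF P lY] by blast+
  have p0: "p0 \<in> lhom P0 M" "p0 ` carr P0 = carr M" "rfree P0" and p': "p' \<in> lhom P' (ker P p)" "p' ` carr P' = carr (ker P p)"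
    and rP: "rfree P"
    using P0 P' P by (auto simp: pres_def)
  fix f assume f: "f \<in> lhom (ker P' p') (ker P0 p0)"
  obtain F where F: "F \<in> lhom P' P0" "\<forall>x\<in>carr P'. p' x = 0 \<longrightarrow> F x = f x"
    by (rule ext_okD[OF ok(2) lhom_from_ker[OF f]])
  have p0F: "(\<lambda>x. p0 (F x)) \<in> lhom P' M" using lhom_comp[OF F(1) p0(1) l(1)] .
  have k: "p0 (F x) = 0" if "x \<in> carr P'" "p' x = 0" for x
    using F(2) that lhom_closed[OF f, of x] by (simp add: carr_ker)
  \<comment> \<open>p0 F kills the kernel of \<open>p'\<close>, so it descends to the syzygy of
    \<open>Y\<close>, extends to \<open>P\<close> by Ext^1(Y, M) = 0 and lifts to \<open>P0\<close>
    as \<open>G\<close>. Subtracting G p' moves \<open>F\<close> into the kernel of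
    \<open>p0\<close> without changing it on the kernel of \<open>p'\<close>.\<close>
  obtain g where g: "g \<in> lhom (ker P p) M" "\<And>x. x \<in> carr P' \<Longrightarrow> g (p' x) = p0 (F x)"
    using lhom_factor[OF p' p0F l(3) k] by metis
  obtain g' where g': "g' \<in> lhom P M" "\<forall>x\<in>carr P. p x = 0 \<longrightarrow> g' x = g x"
    by (rule ext_okD[OF ok(1) g(1)])
  have im: "g' ` carr P \<subseteq> p0 ` carr P0" using lhom_closed[OF g'(1)] p0(2) by auto
  obtain G where G: "G \<in> lhom P P0" "\<And>x. x \<in> carr P \<Longrightarrow> p0 (G x) = g' x"
    using rfree_lift[OF rP p0(1) l(1) lM g'(1) im] by metis
  have p'P: "p' \<in> lhom P' P" using lhom_from_ker[OF p'(1)] .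
  have Gp: "(\<lambda>x. G (p' x)) \<in> lhom P' P0" using lhom_comp[OF p'P G(1) l(2)] .
  have H: "(\<lambda>x. F x - G (p' x)) \<in> lhom P' P0" using lhom_minus[OF F(1) Gp l(1)] .
  have "p0 (F x - G (p' x)) = 0" if x: "x \<in> carr P'" for x
  proof -
    have "p' x \<in> carr P" "p (p' x) = 0" using lhom_closed[OF p'(1) x] by (auto simp: carr_ker)
    then have "p0 (G (p' x)) = p0 (F x)" using G(2) g'(2) g(2)[OF x] by simp
    then show ?thesis using lhom_diff[OF p0(1) l(1) lhom_closed[OF F(1) x] lhom_closed[OF Gp x]] by simp
  qed
  then have Hk: "(\<lambda>x. F x - G (p' x)) \<in> lhom P' (ker P0 p0)" using lhom_to_ker[OF H] by blast
  show "\<exists>F\<in>lhom P' (ker P0 p0). \<forall>x\<in>carr P'. p' x = 0 \<longrightarrow> F x = f x"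
  proof (rule bexI[OF _ Hk], intro ballI impI)
    fix x assume x: "x \<in> carr P'" "p' x = 0"
    have "G 0 = 0" using lhom_zero[OF G(1) lmodule.zero_closed[OF l(2)]] .
    then show "F x - G (p' x) = f x" using F(2) x by simp
  qed
qed

text \<open>With X the kernel of \<open>p0\<close>, this is exactness of Ext^(i+1)(Y, M) ->
  Ext^(i+2)(Y, X) -> Ext^(i+2)(Y, P0) in the middle.\<close>

lemma ev_shift:
  fixes M :: "('a::{ring,monoid_mult}, 'm::ab_group_add) lmod"
  assumes P0: "pres P0 p0 M" and lM: "lmodule M"
  shows "lmodule Y \<Longrightarrow> ev i Y M \<Longrightarrow> ev (Suc i) Y P0 \<Longrightarrow> ev (Suc i) Y (ker P0 p0)"
proof (induction i arbitrary: Y)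
  case 0
  then show ?case using ext_ok_shift[OF P0 lM 0(1)] by simp
next
  case (Suc i)
  have "ev (Suc i) (ker P p) (ker P0 p0)" if "pres P p Y" for P p
    using Suc(1)[OF lmodule_ker[OF that Suc(2)]] Suc(3,4) that by simp
  then show ?case by simp
qed

lemma stab_le_refl: assumes "lmodule Y" shows "stab_le Y Y"
  unfolding stab_le_def
proof (rule bexI[OF _ lhom_id[OF assms]], rule bexI[OF _ lhom_id[OF assms]], rule exI[of _ "md (free 0)"],
    rule conjI[OF rfree_free], rule bexI[OF _ lhom_0[OF lmodule_free]], rule bexI[OF _ lhom_0[OF assms]])
qed simp

lemma stab_le_zero: assumes "rfree Y" shows "stab_le Y (md (free 0))"
proof -
  obtain n i r where i: "i \<in> lhom Y (md (free n))" and r: "r \<in> lhom (md (free n)) Y"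
    and ri: "\<forall>x\<in>carr Y. r (i x) = x" and l: "lmodule Y" using assms by (auto simp: rfree_def)
  show ?thesis unfolding stab_le_def
    by (rule bexI[OF _ lhom_0[OF lmodule_free]], rule bexI[OF _ lhom_0[OF l]], rule exI[of _ "md (free n)"],
        rule conjI[OF rfree_free], rule bexI[OF _ i], rule bexI[OF _ r]) (use ri in simp)
qed

text \<open>A cocycle vanishes on the kernel of \<open>d n\<close>, hence is a map on the image of
  \<open>d n\<close>, which is the kernel of \<open>q\<close>; it is a coboundary if and only if
  this map extends to \<open>P n\<close>. The parameter \<open>q\<close> stands for the augmentation
  or a differential.\<close>

lemma Ext_zero_iff:
  fixes M :: "('a::{ring,monoid_mult}, 'm::ab_group_add) lmod" and N :: "('a, 'n::ab_group_add) lmod"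
  assumes res: "some_resolution M = (P, d)" and lP: "lmodule (P n)" "lmodule (P (Suc n))" and lN: "lmodule N"
    and d: "d n \<in> lhom (P (Suc n)) (P n)" "d (Suc n) \<in> lhom (P (Suc (Suc n))) (P (Suc n))"
    and ex: "d n ` carr (P (Suc n)) = {x \<in> carr (P n). q x = 0}"
      "d (Suc n) ` carr (P (Suc (Suc n))) = {x \<in> carr (P (Suc n)). d n x = 0}"
  shows "Ext_zero (Suc n) M N \<longleftrightarrow> ext_ok (P n) q N"
proof -
  define Z where "Z = cocycles P d N (Suc n)"
  define B where "B = coboundaries P d N (Suc n)"
  have d0: "d n 0 = 0" using lhom_zero[OF d(1) lmodule.zero_closed[OF lP(2)]] .
  have B0: "0 \<in> B" using lhom_0[OF lN, of "P n"] unfolding B_def by (force simp: comp_def fun_eq_iff zero_fun_def)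
  have Badd: "b + b' \<in> B" if "b \<in> B" "b' \<in> B" for b b'
  proof -
    obtain u u' where u: "b = u \<circ> d n" "u \<in> lhom (P n) N" "b' = u' \<circ> d n" "u' \<in> lhom (P n) N"
      using \<open>b \<in> B\<close> \<open>b' \<in> B\<close> by (auto simp: B_def)
    have "b + b' = (\<lambda>x. u x + u' x) \<circ> d n" using u by (auto simp: fun_eq_iff)
    then show ?thesis using lhom_plus[OF u(2,4) lN] by (auto simp: B_def)
  qed
  have Bminus: "- b \<in> B" if "b \<in> B" for b
  proof -
    obtain u where u: "b = u \<circ> d n" "u \<in> lhom (P n) N" using \<open>b \<in> B\<close> by (auto simp: B_def)
    have "- b = (\<lambda>x. - u x) \<circ> d n" using u by (auto simp: fun_eq_iff)
    then show ?thesis using lhom_neg[OF u(2) lN] by (auto simp: B_def)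
  qed
  have dd: "d n (d (Suc n) x) = 0" for x
  proof (cases "x \<in> carr (P (Suc (Suc n)))")
    case True then show ?thesis using ex(2) by blast
  next
    case False then show ?thesis using lhom_off[OF d(2) False] d0 by simp
  qed
  have Z0: "0 \<in> Z" unfolding Z_def cocycles_def using lhom_0[OF lN, of "P (Suc n)"] by (simp add: fun_eq_iff zero_fun_def)
  have E: "Ext (Suc n) M N = (\<lambda>f. (+) f ` B) ` Z"
    unfolding Ext_def res Z_def B_def by simp
  have "Ext_zero (Suc n) M N \<longleftrightarrow> Z \<subseteq> B"
  proof
    assume "Ext_zero (Suc n) M N"
    then obtain c where c: "(\<lambda>f. (+) f ` B) ` Z = {c}" unfolding Ext_zero_def is_singleton_def E by blast
    show "Z \<subseteq> B"
    proof
      fix f assume f: "f \<in> Z"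
      have "(+) f ` B \<in> (\<lambda>f. (+) f ` B) ` Z" "(+) 0 ` B \<in> (\<lambda>f. (+) f ` B) ` Z"
        by (rule image_eqI[OF refl f], rule image_eqI[OF refl Z0])
      then have "(+) f ` B = (+) 0 ` B" unfolding c by simp
      moreover have "f + 0 \<in> (+) f ` B" using B0 by (rule imageI)
      ultimately have "f + 0 \<in> (+) 0 ` B" by simp
      then show "f \<in> B" by auto
    qed
  next
    assume ZB: "Z \<subseteq> B"
    have "(+) f ` B = B" if "f \<in> Z" for f
    proof (intro equalityI subsetI)
      fix g assume "g \<in> (+) f ` B" then show "g \<in> B" using Badd ZB that by blast
    next
      fix g assume g: "g \<in> B"
      have "- f + g \<in> B" using Badd[OF Bminus g] ZB that by blast
      moreover have "g = f + (- f + g)" by simp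
      ultimately show "g \<in> (+) f ` B" by blast
    qed
    then have "(\<lambda>f. (+) f ` B) ` Z = {B}" using Z0 by auto
    then show "Ext_zero (Suc n) M N" unfolding Ext_zero_def is_singleton_def E by blast
  qed
  also have "\<dots> \<longleftrightarrow> ext_ok (P n) q N"
  proof
    assume ZB: "Z \<subseteq> B"
    show "ext_ok (P n) q N"
      unfolding ext_ok_def
    proof
      have dk: "d n \<in> lhom (P (Suc n)) (ker (P n) q)" using lhom_to_ker[OF d(1)] ex(1) by blast
      have "{x \<in> carr (P n). q x = 0} = d n ` carr (P (Suc n))" using ex(1) by simp
      moreover have "submodule (P n) (d n ` carr (P (Suc n)))"
        using submodule_image[OF d(1) lP(2) submodule_self[OF lP(2)]] .
      ultimately have lk: "lmodule (ker (P n) q)" unfolding ker_def using lmodule_on[OF lP(1)] by simp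
      fix f assume f: "f \<in> lhom (ker (P n) q) N"
      have "(\<lambda>x. f (d n x)) \<in> lhom (P (Suc n)) N" using lhom_comp[OF dk f lk] .
      moreover have "f 0 = 0" using lhom_zero[OF f lmodule.zero_closed[OF lk]] .
      then have "(\<lambda>x. f (d n x)) \<circ> d (Suc n) = 0" by (intro ext) (simp add: dd)
      ultimately have "(\<lambda>x. f (d n x)) \<in> B" using ZB by (auto simp: Z_def cocycles_def)
      then obtain F where F: "F \<in> lhom (P n) N" "(\<lambda>x. f (d n x)) = F \<circ> d n" by (auto simp: B_def)
      show "\<exists>F\<in>lhom (P n) N. \<forall>x\<in>carr (P n). q x = 0 \<longrightarrow> F x = f x"
      proof (rule bexI[OF _ F(1)], intro ballI impI)
        fix x assume "x \<in> carr (P n)" "q x = 0"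
        then have "x \<in> d n ` carr (P (Suc n))" unfolding ex(1) by simp
        then obtain y where "x = d n y" by (rule imageE)
        then show "F x = f x" using fun_cong[OF F(2), of y] by simp
      qed
    qed
  next
    assume ok: "ext_ok (P n) q N"
    show "Z \<subseteq> B"
    proof
      fix f assume "f \<in> Z"
      then have f: "f \<in> lhom (P (Suc n)) N" "f \<circ> d (Suc n) = 0" by (auto simp: Z_def cocycles_def)
      have dk: "d n \<in> lhom (P (Suc n)) (ker (P n) q)" using lhom_to_ker[OF d(1)] ex(1) by blast
      have ds: "d n ` carr (P (Suc n)) = carr (ker (P n) q)" using ex(1) by (simp add: carr_ker)
      have k: "f x = 0" if "x \<in> carr (P (Suc n))" "d n x = 0" for x
      proof -
        have "x \<in> d (Suc n) ` carr (P (Suc (Suc n)))" unfolding ex(2) using that by simp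
        then obtain y where "x = d (Suc n) y" by (rule imageE)
        then show ?thesis using fun_cong[OF f(2), of y] by simp
      qed
      obtain g where g: "g \<in> lhom (ker (P n) q) N" "\<And>x. x \<in> carr (P (Suc n)) \<Longrightarrow> g (d n x) = f x"
        using lhom_factor[OF dk ds f(1) lP(2) k] by metis
      obtain F where F: "F \<in> lhom (P n) N" "\<forall>x\<in>carr (P n). q x = 0 \<longrightarrow> F x = g x"
        by (rule ext_okD[OF ok g(1)])
      have "f = F \<circ> d n"
      proof
        fix x show "f x = (F \<circ> d n) x"
        proof (cases "x \<in> carr (P (Suc n))")
          case True
          then have "d n x \<in> carr (P n)" "q (d n x) = 0" using ex(1) by blast+
          then show ?thesis using F(2) g(2)[OF True] by simp
        next
          case False
          then show ?thesis
            using lhom_off[OF d(1) False] lhom_off[OF f(1) False] lhom_zero[OF F(1) lmodule.zero_closed[OF lP(1)]] by simp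
        qed
      qed
      then show "f \<in> B" using F(1) by (auto simp: B_def)
    qed
  qed
  finally show ?thesis .
qed

section \<open>Resolutions and the syzygy of M\<close>

context rad_cube_zero begin

lemma resolution_exists:
  fixes M :: "('a, 'm::ab_group_add) lmod"
  assumes M: "fg_module M"
  shows "\<exists>(P :: nat \<Rightarrow> 'a std_mod) d e. projective_resolution M P d e"
proof -
  obtain P0 e where "cover P0 e M" by (rule cover_exists[OF M])
  then have P0: "psub P0" "sub P0" "e \<in> lhom (md P0) M" "e ` P0 = carr M" using psub_sub by (auto simp: cover_def)
  have lM: "lmodule M" using M by (simp add: fg_module_def)
  have "\<exists>c. cover (fst c) (snd c) (md K)" if "sub K" for K :: "(nat \<Rightarrow> 'a) set"
    using cover_exists[OF fg_sub[OF that]] by (metis fst_conv snd_conv)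
  then have "\<forall>K :: (nat \<Rightarrow> 'a) set. \<exists>c. sub K \<longrightarrow> cover (fst c) (snd c) (md K)" by blast
  from choice[OF this] obtain c where c: "\<And>K :: (nat \<Rightarrow> 'a) set. sub K \<Longrightarrow> cover (fst (c K)) (snd (c K)) (md K)"
    by blast
  \<comment> \<open>All syzygies are carriers in one type, so iterating a fixed choice of covers is
    a plain recursion.\<close>
  define K where "K = rec_nat {x \<in> P0. e x = 0} (\<lambda>_ K. {x \<in> fst (c K). snd (c K) x = 0})"
  have K0: "K 0 = {x \<in> P0. e x = 0}" and KS: "K (Suc n) = {x \<in> fst (c (K n)). snd (c (K n)) x = 0}" for n
    by (simp_all add: K_def)
  have sK: "sub (K n)" for n
  proof (induction n)
    case 0
    have "submodule (md P0) (K 0)" using submodule_ker[OF P0(3) lmodule_sub[OF P0(2)] lM] K0 by simp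
    then show ?case using submodule_mdD P0(2) by blast
  next
    case (Suc n)
    have c': "sub (fst (c (K n)))" "snd (c (K n)) \<in> lhom (md (fst (c (K n)))) (md (K n))"
      using c[OF Suc] psub_sub by (auto simp: cover_def)
    have "submodule (md (fst (c (K n)))) (K (Suc n))"
      using submodule_ker[OF c'(2) lmodule_sub[OF c'(1)] lmodule_sub[OF Suc]] KS by simp
    then show ?case using submodule_mdD c'(1) by blast
  qed
  have c: "psub (fst (c (K n)))" "snd (c (K n)) \<in> lhom (md (fst (c (K n)))) (md (K n))"
    "snd (c (K n)) ` fst (c (K n)) = K n" for n
    using c[OF sK] by (auto simp: cover_def)
  define P where "P n = (case n of 0 \<Rightarrow> md P0 | Suc m \<Rightarrow> md (fst (c (K m))))" for n
  have PS: "P 0 = md P0" "P (Suc n) = md (fst (c (K n)))" for n by (simp_all add: P_def)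
  have sub: "K n \<subseteq> carr (P n)" for n
    by (cases n) (auto simp: K0 KS PS)
  have on: "md (K n) = on (P n) (K n)" for n by (cases n) (auto simp: PS)
  have "projective_resolution M P (\<lambda>n. snd (c (K n))) e"
    unfolding projective_resolution_def
  proof (intro conjI allI)
    fix n
    show "fg_module (P n)" "projective (P n)"
      using psub_projective P0(1) c(1) by (cases n; simp add: PS)+
    show "snd (c (K n)) \<in> lhom (P (Suc n)) (P n)"
      using c(2)[of n] sub unfolding PS(2) on by (rule lhom_codomD)
    show "snd (c (K (Suc n))) ` carr (P (Suc (Suc n))) = {x \<in> carr (P (Suc n)). snd (c (K n)) x = 0}"
      using c(3)[of "Suc n"] by (simp add: PS KS)
  next
    show "e \<in> lhom (P 0) M" "e ` carr (P 0) = carr M" using P0 by (simp_all add: PS)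
    show "snd (c (K 0)) ` carr (P 1) = {x \<in> carr (P 0). e x = 0}"
      using c(3)[of 0] by (simp add: PS K0)
  qed
  then show ?thesis by blast
qed

lemma some_resolution:
  fixes M :: "('a, 'm::ab_group_add) lmod"
  assumes M: "fg_module M"
  obtains P d e where "some_resolution M = (P, d)" "projective_resolution M P d e"
proof -
  obtain P :: "nat \<Rightarrow> 'a std_mod" and d e where "projective_resolution M P d e"
    using resolution_exists[OF M] by blast
  then have "\<exists>x. case x of (P :: nat \<Rightarrow> 'a std_mod, d) \<Rightarrow> \<exists>e. projective_resolution M P d e"
    by (intro exI[of _ "(P, d)"]) auto
  from someI_ex[OF this]
  have "case some_resolution M of (P :: nat \<Rightarrow> 'a std_mod, d) \<Rightarrow> \<exists>e. projective_resolution M P d e"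
    unfolding some_resolution_def .
  then show ?thesis using that by (cases "some_resolution M") auto
qed

text \<open>The syzygies \<open>Y n\<close> of a resolution, starting with the kernel of the augmentation.\<close>

lemma resolution_syzygies:
  fixes M :: "('a, 'm::ab_group_add) lmod" and P :: "nat \<Rightarrow> 'a std_mod"
  assumes M: "fg_module M" and some: "some_resolution M = (P, d)" and res: "projective_resolution M P d e"
  obtains Y where "pres (P 0) e M" "Y 0 = ker (P 0) e" "\<And>n. pres (P (Suc n)) (d n) (Y n)"
    "\<And>n. Y (Suc n) = ker (P (Suc n)) (d n)" "\<And>n. lmodule (Y n)"
    "\<And>N :: ('a, 'n::ab_group_add) lmod. lmodule N \<Longrightarrow> Ext_zero 1 M N \<longleftrightarrow> ext_ok (P 0) e N"
    "\<And>(N :: ('a, 'n) lmod) n. lmodule N \<Longrightarrow> Ext_zero (Suc (Suc n)) M N \<longleftrightarrow> ext_ok (P (Suc n)) (d n) N"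
proof -
  have lM: "lmodule M" using M by (simp add: fg_module_def)
  have r: "rfree (P n)" "d n \<in> lhom (P (Suc n)) (P n)" "e \<in> lhom (P 0) M" "e ` carr (P 0) = carr M"
    "d 0 ` carr (P (Suc 0)) = {x \<in> carr (P 0). e x = 0}"
    "d (Suc n) ` carr (P (Suc (Suc n))) = {x \<in> carr (P (Suc n)). d n x = 0}" for n
    using res rfree_if_projective by (auto simp: projective_resolution_def)
  have lP: "lmodule (P n)" for n using r(1) by (simp add: rfree_def)
  define Y where "Y n = on (P n) (d n ` carr (P (Suc n)))" for n
  have Y0: "Y 0 = ker (P 0) e" using r(5) by (simp add: Y_def ker_def)
  have YS: "Y (Suc n) = ker (P (Suc n)) (d n)" for n using r(6) by (simp add: Y_def ker_def)
  have p0: "pres (P 0) e M" using r by (simp add: pres_def)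
  have pS: "pres (P (Suc n)) (d n) (Y n)" for n
    unfolding pres_def using r(1) lhom_codom[OF r(2) order_refl, of n] by (simp add: Y_def)
  have lY: "lmodule (Y n)" for n
    unfolding Y_def using lmodule_on[OF lP submodule_image[OF r(2) lP submodule_self[OF lP]]] .
  show ?thesis
  proof (rule that[OF p0 Y0 pS YS lY])
    fix N :: "('a, 'n) lmod" assume N: "lmodule N"
    show "Ext_zero 1 M N \<longleftrightarrow> ext_ok (P 0) e N"
      using Ext_zero_iff[OF some lP lP N r(2) r(2) r(5) r(6)] by simp
    show "Ext_zero (Suc (Suc n)) M N \<longleftrightarrow> ext_ok (P (Suc n)) (d n) N" for n
      using Ext_zero_iff[OF some lP lP N r(2) r(2) r(6) r(6)] .
  qed
qed

text \<open>\<open>M\<close> and its syzygies are stable summands of the zero module.\<close>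

lemma rfree_Ext_zero:
  fixes M :: "('a, 'm::ab_group_add) lmod" and N :: "('a, 'n::ab_group_add) lmod"
  assumes M: "fg_module M" "rfree M" and N: "lmodule N"
  shows "Ext_zero (Suc n) M N"
proof -
  obtain P d e where P: "some_resolution M = (P, d)" "projective_resolution M P d e" by (rule some_resolution[OF M(1)])
  obtain Y where Y: "pres (P 0) e M" "Y 0 = ker (P 0) e" "\<And>n. pres (P (Suc n)) (d n) (Y n)"
    "\<And>n. Y (Suc n) = ker (P (Suc n)) (d n)" "\<And>n. lmodule (Y n)"
    "Ext_zero 1 M N \<longleftrightarrow> ext_ok (P 0) e N"
    "\<And>n. Ext_zero (Suc (Suc n)) M N \<longleftrightarrow> ext_ok (P (Suc n)) (d n) N"
    by (rule resolution_syzygies[OF M(1) P, where 'n='n]) (use N in blast)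
  let ?O = "md (free 0) :: 'a std_mod"
  have lM: "lmodule M" using M by (simp add: fg_module_def)
  have f0: "x = 0" if "x \<in> free 0" for x :: "nat \<Rightarrow> 'a" using that by (simp add: free_def fun_eq_iff)
  have pO: "pres ?O (\<lambda>x. 0) ?O"
    unfolding pres_def using rfree_free lhom_0[OF lmodule_free] f0 sub_0[OF sub_free] by auto
  have kO: "ker ?O (\<lambda>x. 0 :: nat \<Rightarrow> 'a) = ?O" by (simp add: ker_def)
  have okO: "ext_ok ?O (\<lambda>x. 0 :: nat \<Rightarrow> 'a) N"
    unfolding ext_ok_def kO by auto
  have le: "stab_le M ?O" using stab_le_zero[OF M(2)] .
  have leY: "stab_le (Y n) ?O" for n
  proof (induction n)
    case 0
    show ?case using stab_le_ker[OF le lM lmodule_free Y(1) pO] by (simp add: Y(2) kO)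
  next
    case (Suc n)
    show ?case using stab_le_ker[OF Suc Y(5) lmodule_free Y(3) pO] by (simp add: Y(4) kO)
  qed
  show ?thesis
  proof (cases n)
    case 0
    then show ?thesis using ext_ok_stab_le[OF le lM lmodule_free Y(1) pO N okO] Y(6) by simp
  next
    case (Suc m)
    then show ?thesis using ext_ok_stab_le[OF leY Y(5) lmodule_free Y(3) pO N okO] Y(7) by simp
  qed
qed

lemma retract_rfree:
  assumes P: "rfree P" and i: "i \<in> lhom M P" and p: "p \<in> lhom P M" and e: "\<forall>x\<in>carr M. p (i x) = x" and M: "lmodule M"
  shows "rfree M"
proof -
  obtain n j r where j: "j \<in> lhom P (md (free n))" and r: "r \<in> lhom (md (free n)) P"
    and rj: "\<forall>x\<in>carr P. r (j x) = x" and l: "lmodule P" using P by (auto simp: rfree_def)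
  have 1: "(\<lambda>x. j (i x)) \<in> lhom M (md (free n))" "(\<lambda>x. p (r x)) \<in> lhom (md (free n)) M"
    using lhom_comp[OF i j l] lhom_comp[OF r p l] by blast+
  have "\<forall>x\<in>carr M. p (r (j (i x))) = x" using rj e lhom_closed[OF i] by simp
  then show ?thesis unfolding rfree_def using 1 M by meson
qed

text \<open>The lifting property of \<open>M\<close> is only assumed for modules over the type \<open>nat \<Rightarrow> 'a\<close>; it is
  applied to a copy of \<open>M\<close> there.\<close>

lemma projective_imp_rfree:
  fixes M :: "('a, 'm::ab_group_add) lmod"
  assumes M: "fg_module M" and pr: "projective M"
  shows "rfree M"
proof -
  have lM: "lmodule M" using M by (simp add: fg_module_def)
  obtain P p where "cover P p M" by (rule cover_exists[OF M])
  then have P: "psub P" "sub P" "p \<in> lhom (md P) M" "p ` P = carr M" using psub_sub by (auto simp: cover_def)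
  define X where "X = {x \<in> P. p x = 0}"
  have "submodule (md P) X" using submodule_ker[OF P(3) lmodule_sub[OF P(2)] lM] by (simp add: X_def)
  then have X: "sub X" "X \<subseteq> P" using submodule_mdD P(2) by blast+
  obtain W r where W: "natural W" "r \<in> lhom (md P) W" "r ` P = carr W" "{x \<in> P. r x = 0} = X"
    by (rule quotient_exists[OF P(2) X])
  have lW: "lmodule W" using W by (simp add: natural_def)
  have fgW: "fg_module W"
    unfolding fg_module_def
  proof (intro conjI lW)
    obtain G where G: "finite G" "G \<subseteq> P" "\<And>N. submodule (md P) N \<Longrightarrow> G \<subseteq> N \<Longrightarrow> N = P"
      using fg_sub[OF P(2)] by (auto simp: fg_module_def)
    show "\<exists>G. finite G \<and> G \<subseteq> carr W \<and> (\<forall>N. submodule W N \<and> G \<subseteq> N \<longrightarrow> N = carr W)"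
    proof (intro exI[of _ "r ` G"] conjI allI impI)
      fix N assume N: "submodule W N \<and> r ` G \<subseteq> N"
      have "{x \<in> P. r x \<in> N} = P"
        using G(2) N submodule_vimage[OF W(2) lmodule_sub[OF P(2)], of N] by (intro G(3)) auto
      then have "r ` P \<subseteq> N" by blast
      then show "N = carr W" using N W(3) by (auto simp: submodule_def)
    qed (use G W in auto)
  qed
  have k: "r x = 0" if "x \<in> carr (md P)" "p x = 0" for x using that W(4) by (auto simp: X_def)
  have ps: "p ` carr (md P) = carr M" using P(4) by simp
  obtain f where f: "f \<in> lhom M W" "\<And>x. x \<in> carr (md P) \<Longrightarrow> f (p x) = r x"
    using lhom_factor[OF P(3) ps W(2) lmodule_sub[OF P(2)] k] by metis
  have rs: "r ` carr (md P) = carr W" using W(3) by simp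
  obtain u where u: "u \<in> lhom M (md P)" "\<forall>x\<in>carr M. r (u x) = f x"
    by (rule projectiveD[OF pr W(2) f(1) fg_sub[OF P(2)] fgW rs])
  have "\<forall>m\<in>carr M. p (u m) = m"
  proof
    fix m assume m: "m \<in> carr M"
    then obtain x where x: "x \<in> P" "m = p x" using P(4) by blast
    have um: "u m \<in> P" using lhom_closed[OF u(1) m] by simp
    have "r (u m - x) = 0"
      using lhom_diff[OF W(2) lmodule_sub[OF P(2)], of "u m" x] um x u(2) m f(2)[of x] by simp
    then have "u m - x \<in> X" using W(4) sub_diff[OF P(2) um x(1)] by blast
    then show "p (u m) = m"
      using lhom_diff[OF P(3) lmodule_sub[OF P(2)], of "u m" x] um x by (simp add: X_def)
  qed
  then show ?thesis using retract_rfree[OF psub_rfree[OF P(1)] u(1) P(3) _ lM] by blast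
qed

text \<open>Passes vanishing from syzygies to their simple summands. A cover of \<open>C\<close>
  supplies the presentation with which any presentation of \<open>Z\<close> is compared.\<close>

lemma ev_sub_stab_le:
  fixes N :: "('a, 'n::ab_group_add) lmod" and Z :: "'a std_mod"
  assumes N: "lmodule N"
  shows "sub C \<Longrightarrow> lmodule Z \<Longrightarrow> stab_le Z (md C) \<Longrightarrow> ev i (md C) N \<Longrightarrow> ev i Z N"
proof (induction i arbitrary: C Z)
  case (0 C Z)
  obtain P p where "cover P p (md C)" by (rule cover_exists[OF fg_sub[OF 0(1)]])
  then have P: "pres (md P) p (md C)" using psub_rfree by (auto simp: cover_def pres_def)
  then show ?case using ext_ok_stab_le[OF 0(3,2) lmodule_sub[OF 0(1)] _ P N] 0(4) by simp
next
  case (Suc i C Z)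
  obtain P p where c: "cover P p (md C)" by (rule cover_exists[OF fg_sub[OF Suc(2)]])
  then have P: "pres (md P) p (md C)" and sP: "sub P" using psub_rfree psub_sub by (auto simp: cover_def pres_def)
  have "submodule (md P) {x \<in> P. p x = 0}" using submodule_ker'[OF P lmodule_sub[OF Suc(2)]] by simp
  then have sK: "sub {x \<in> P. p x = 0}" using submodule_mdD sP by blast
  have e: "ev i (md {x \<in> P. p x = 0}) N" using Suc(5) P by (simp add: ker_md[symmetric])
  have "ev i (ker Q q) N" if Q: "pres Q q Z" for Q q
    using Suc(1)[OF sK lmodule_ker[OF Q Suc(3)] _ e] stab_le_ker[OF Suc(4,3) lmodule_sub[OF Suc(2)] Q P]
    by (simp add: ker_md)
  then show ?case by simp
qed

text \<open>Dimension shifting turns Ext^(i+2)(M, N) into Ext^(i+1)(X, N), and 0 -> X -> P0 -> M ->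
  0 shifts the second argument back by one degree because Ext(X, P0) = 0. Hence passing from M to X
  preserves the range of degrees.\<close>

lemma syzygy_ev:
  fixes M :: "('a, 'm::ab_group_add) lmod"
  assumes M: "fg_module M" and P0: "cover P0 p0 M" and X: "X = {x \<in> P0. p0 x = 0}"
    and A: "\<forall>i>0. Ext_zero i M (regular_module :: ('a, 'a) lmod)"
    and E: "\<forall>q\<in>{1..n}. Ext_zero q M M"
  shows "ev i (md X) (regular_module :: ('a, 'a) lmod)" and "i < n \<Longrightarrow> ev i (md X) (md X)"
    and "psub L \<Longrightarrow> ext_ok (md P0) p0 (md L)"
proof -
  have lM: "lmodule M" using M by (simp add: fg_module_def)
  have lA: "lmodule (regular_module :: ('a, 'a) lmod)"
    by unfold_locales (auto simp: regular_module_def algebra_simps)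
  obtain P d e where P: "some_resolution M = (P, d)" "projective_resolution M P d e" by (rule some_resolution[OF M])
  obtain Y where Y: "pres (P 0) e M" "Y 0 = ker (P 0) e" "\<And>n. pres (P (Suc n)) (d n) (Y n)"
    "\<And>n. Y (Suc n) = ker (P (Suc n)) (d n)" "\<And>n. lmodule (Y n)"
    "Ext_zero 1 M M \<longleftrightarrow> ext_ok (P 0) e M"
    "\<And>n. Ext_zero (Suc (Suc n)) M M \<longleftrightarrow> ext_ok (P (Suc n)) (d n) M"
    by (rule resolution_syzygies[OF M P, where 'n='m]) (use lM in blast)
  have A1: "Ext_zero (Suc n) M (regular_module :: ('a, 'a) lmod)" for n using A by simp
  \<comment> \<open>The coefficient type is fixed in each use of \<open>resolution_syzygies\<close>,
    so coefficients in \<open>M\<close> and in the algebra need separate instances.\<close>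
  have YA0: "ext_ok (P 0) e (regular_module :: ('a, 'a) lmod)"
    by (rule resolution_syzygies[OF M P, where 'n='a]) (use lA A1[of 0] in simp)
  have YA: "ext_ok (P (Suc n)) (d n) (regular_module :: ('a, 'a) lmod)" for n
    by (rule resolution_syzygies[OF M P, where 'n='a]) (use lA A1 in blast)
  have pP0: "pres (md P0) p0 M" and psP0: "psub P0" and sP0: "sub P0"
    using P0 psub_rfree psub_sub by (auto simp: cover_def pres_def)
  have kX: "ker (md P0) p0 = md X" by (simp add: ker_md X)
  have le: "stab_le (md X) (Y 0)"
    using stab_le_ker[OF stab_le_refl[OF lM] lM lM pP0 Y(1)] by (simp add: Y(2) kX)
  have lX: "lmodule (md X)" using lmodule_ker[OF pP0 lM] by (simp add: kX)
  have evA: "ev i (md X) (regular_module :: ('a, 'a) lmod)" for i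
    using ev_chain[where P = "\<lambda>n. P (Suc n)" and p = d and Y = Y and n = 0, OF Y(3,4,5) lA le lX] YA by simp
  then show "ev i (md X) (regular_module :: ('a, 'a) lmod)" .
  have "ext_ok (md P0) p0 (regular_module :: ('a, 'a) lmod)"
    by (rule ext_ok_stab_le[OF stab_le_refl[OF lM] lM lM pP0 Y(1) lA YA0])
  then show "psub L \<Longrightarrow> ext_ok (md P0) p0 (md L)"
    using ext_ok_regular[OF lmodule_sub[OF sP0] _ _ lmodule_ker[OF pP0 lM]] by blast
  have evM: "ev i (md X) M" if "i + 2 \<le> n" for i
    using ev_chain[where P = "\<lambda>n. P (Suc n)" and p = d and Y = Y and n = 0, OF Y(3,4,5) lM le lX] Y(7)[of i] E that
    by simp
  have evP0: "ev i (md X) (md P0)" for i using ev_regular[OF evA lX psP0] .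
  assume i: "i < n"
  show "ev i (md X) (md X)"
  proof (cases i)
    \<comment> \<open>In the lowest degree the shift starts from M itself: Ext^1(M, M) = 0 and
      Ext^2(M, P0) = 0 give Ext^2(M, X) = 0, that is, Ext^1(X, X) = 0.\<close>
    case 0
    have "ext_ok (P 0) e M" using Y(6) E i by simp
    then have "ext_ok (md P0) p0 M" using ext_ok_stab_le[OF stab_le_refl[OF lM] lM lM pP0 Y(1) lM] by blast
    then show ?thesis
      using ext_ok_shift[OF pP0 lM lM pP0] evP0[of 0] 0 by (simp add: kX)
  next
    case (Suc j)
    then have "ev (Suc j) (md X) (ker (md P0) p0)" using ev_shift[OF pP0 lM lX evM evP0, of j] i by simp
    then show ?thesis using Suc by (simp add: kX)
  qed
qed

end

section \<open>Dimension vectors of syzygies\<close>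

lemma retract_stab_le:
  fixes K S :: "(nat \<Rightarrow> 'a::{ring,monoid_mult}) set"
  assumes K: "sub K" and S: "sub S" "S \<subseteq> K" and e: "e \<in> lhom (md K) (md S)" "\<forall>x\<in>S. e x = x"
  shows "stab_le (md S) (md K)"
proof -
  have i: "restrict0 S (\<lambda>x. x) \<in> lhom (md S) (md K)" using lhom_incl[OF submodule_md[OF K S]] by simp
  show ?thesis
    unfolding stab_le_def
    by (rule bexI[OF _ i], rule bexI[OF _ e(1)], rule exI[of _ "md (free 0)"], rule conjI[OF rfree_free],
        rule bexI[OF _ lhom_0[OF lmodule_free]], rule bexI[OF _ lhom_0[OF lmodule_sub[OF S(1)]]])
      (use e(2) in simp)
qed

lemma lhom_incl_md:
  "sub C \<Longrightarrow> sub D \<Longrightarrow> D \<subseteq> C \<Longrightarrow> restrict0 D (\<lambda>x. x) \<in> lhom (md D) (md C)"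
  using lhom_incl[OF submodule_md] by simp

context rad_cube_zero begin

text \<open>Carried over from a projective cover \<open>P\<close> of \<open>C\<close>: a maximal
  submodule of \<open>P\<close> contains J P and so the kernel of the cover; hence its image is
  maximal in \<open>C\<close>.\<close>

lemma sub_avoid:
  fixes C :: "(nat \<Rightarrow> 'a) set"
  assumes C: "sub C" and y: "y \<in> C" "y \<notin> jrad C"
  obtains N where "maxsub C N" "y \<notin> N"
proof -
  obtain P p where c: "cover P p (md C)" by (rule cover_exists[OF fg_sub[OF C]])
  then have P: "psub P" "sub P" "p \<in> hom P C" "p ` P = C" "\<And>x. x \<in> P \<Longrightarrow> p x = 0 \<Longrightarrow> x \<in> jrad P"
    using psub_sub by (auto simp: cover_def)
  obtain q where q: "q \<in> P" "y = p q" using y(1) P(4) by blast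
  have "p ` jrad P = jrad C" using jrad_image[OF P(3,2) order_refl] P(4) by simp
  then have "q \<notin> jrad P" using y(2) q(2) by blast
  then obtain N where N: "maxsub P N" "q \<notin> N" using psub_avoid[OF P(1) q(1)] by blast
  then have n: "sub N" "N \<subseteq> P" "N \<noteq> P" by (auto simp: maxsub_def)
  have kN: "x \<in> N" if "x \<in> P" "p x = 0" for x using P(5)[OF that] maxsub_jrad[OF P(2) N(1)] by blast
  have pull: "x \<in> N" if x: "x \<in> P" "p x \<in> p ` N" for x
  proof -
    obtain z where z: "z \<in> N" "p x = p z" using x(2) by blast
    then have "p (x - z) = 0" using lhom_diff[OF P(3) lmodule_sub[OF P(2)], of x z] x(1) n(2) by auto
    then have "x - z \<in> N" using kN sub_diff[OF P(2) x(1)] z(1) n(2) by blast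
    then have "(x - z) + z \<in> N" using sub_add[OF n(1)] z(1) by blast
    then show ?thesis by simp
  qed
  have "submodule (md C) (p ` N)"
    using submodule_image[OF P(3) lmodule_sub[OF P(2)] submodule_md[OF P(2) n(1,2)]] .
  then have pN: "sub (p ` N)" "p ` N \<subseteq> C" using submodule_mdD C by blast+
  have "maxsub C (p ` N)"
    unfolding maxsub_def
  proof (intro conjI pN allI impI)
    show "p ` N \<noteq> C"
    proof
      assume "p ` N = C"
      then have "q \<in> N" using pull[OF q(1)] q(2) y(1) by simp
      then show False using N(2) by simp
    qed
    fix D assume D: "sub D \<and> p ` N \<subseteq> D \<and> D \<subseteq> C"
    define D' where "D' = {x \<in> P. p x \<in> D}"
    have "submodule (md P) D'"
      using submodule_vimage[OF P(3) lmodule_sub[OF P(2)] submodule_md[OF C, of D]] D by (simp add: D'_def)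
    then have D': "sub D'" "D' \<subseteq> P" using submodule_mdD P(2) by blast+
    have "N \<subseteq> D'" using D n(2) by (auto simp: D'_def)
    then have "D' = N \<or> D' = P" using N(1) D' by (simp add: maxsub_def)
    moreover have "D \<subseteq> p ` P" using D P(4) by simp
    then have "p ` D' = D" by (auto simp: D'_def)
    ultimately show "D = p ` N \<or> D = C" using P(4) by auto
  qed
  moreover have "y \<notin> p ` N" using pull[OF q(1)] q(2) N(2) by auto
  ultimately show ?thesis by (rule that)
qed

text \<open>A maximal submodule \<open>N\<close> that misses \<open>x\<close> meets \<open>S\<close>
  in 0, and N + S = K. So \<open>S\<close> maps isomorphically onto K/N, and the retraction is the
  quotient map followed by the inverse.\<close>

lemma simple_summand:
  fixes K S :: "(nat \<Rightarrow> 'a) set"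
  assumes K: "sub K" and S: "sub S" "S \<subseteq> K" and simple: "\<And>N. sub N \<Longrightarrow> N \<subseteq> S \<Longrightarrow> N = {0} \<or> N = S"
    and n: "x \<in> S" "x \<notin> jrad K"
  obtains e where "e \<in> hom K S" "\<forall>x\<in>S. e x = x"
proof -
  obtain N where N: "maxsub K N" "x \<notin> N" using sub_avoid[OF K _ n(2)] n(1) S(2) by blast
  then have n': "sub N" "N \<subseteq> K" by (auto simp: maxsub_def)
  have "submodule (md K) (N \<inter> S)" by (intro submodule_Int submodule_md K n' S)
  then have "sub (N \<inter> S)" using submodule_mdD K by blast
  then have "N \<inter> S = {0} \<or> N \<inter> S = S" using simple by blast
  then have NS: "N \<inter> S = {0}" using n(1) N(2) by blast
  note s = sub_splus[OF K n' S]
  have "splus N S \<noteq> N" using s(4) n(1) N(2) by blast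
  then have sp: "splus N S = K" using N(1) s unfolding maxsub_def by blast
  obtain W r where W: "natural W" "r \<in> lhom (md K) W" "r ` K = carr W" "{x \<in> K. r x = 0} = N"
    by (rule quotient_exists[OF K n'])
  have lW: "lmodule W" using W(1) by (simp add: natural_def)
  have rS: "restrict0 S r \<in> lhom (md S) W" using lhom_restrict0[OF W(2) submodule_md[OF K S]] by simp
  have "bij_betw (restrict0 S r) (carr (md S)) (carr W)"
    unfolding bij_betw_def
  proof
    show "inj_on (restrict0 S r) (carr (md S))"
    proof (rule inj_onI)
      fix u v assume u: "u \<in> carr (md S)" "v \<in> carr (md S)" "restrict0 S r u = restrict0 S r v"
      then have "r (u - v) = 0" using lhom_diff[OF W(2) lmodule_sub[OF K], of u v] S(2) by auto
      moreover have "u - v \<in> S" using u sub_diff[OF S(1)] by simp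
      ultimately have "u - v \<in> N \<inter> S" using W(4) S(2) by blast
      then show "u = v" using NS by simp
    qed
    have "carr W \<subseteq> r ` S"
    proof
      fix y assume "y \<in> carr W"
      then have "y \<in> r ` K" using W(3) by simp
      then obtain k where k: "y = r k" "k \<in> K" by (rule imageE)
      then have "k \<in> splus N S" using sp by simp
      then obtain a b where ab: "k = a + b" "a \<in> N" "b \<in> S" unfolding splus_def by blast
      have "r a = 0" using ab(2) W(4) by blast
      then have "y = r b" using lhom_add[OF W(2), of a b] ab n'(2) S(2) k(1) by auto
      then show "y \<in> r ` S" using ab(3) by blast
    qed
    moreover have "r ` S \<subseteq> carr W" using W(3) S(2) by blast
    ultimately show "restrict0 S r ` carr (md S) = carr W" by simp
  qed
  then obtain g where g: "g \<in> lhom W (md S)" "\<And>x. x \<in> carr (md S) \<Longrightarrow> g (restrict0 S r x) = x"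
    using lhom_inverse[OF rS _ lmodule_sub[OF S(1)]] by metis
  have "(\<lambda>x. g (r x)) \<in> hom K S" using lhom_comp[OF W(2) g(1) lW] .
  moreover have "\<forall>x\<in>S. g (r x) = x" using g(2) by simp
  ultimately show ?thesis by (rule that)
qed

abbreviation regA :: "('a, 'a) lmod" where "regA \<equiv> regular_module"

text \<open>The class on which the induction runs. It contains X and is closed under syzygies and
  under the simple summands of syzygies that cause errors. The last condition reflects that a syzygy
  sits in the radical of a projective and that its maps to projectives extend.\<close>

definition base :: "(nat \<Rightarrow> 'a) set \<Rightarrow> bool" where
  "base C \<longleftrightarrow> sub C \<and> jrad (jrad C) = {0} \<and> (\<forall>i. ev i (md C) regA) \<and>
    (\<forall>L. psub L \<longrightarrow> hom C L \<subseteq> hom C (jrad L))"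

text \<open>The number \<open>q\<close> is a budget of degrees, of which each syzygy spends one. A
  nonzero \<open>X\<close> is not in this class, since its identity does not land in J X; its syzygy
  is.\<close>

definition xgood :: "(nat \<Rightarrow> 'a) set \<Rightarrow> nat \<Rightarrow> (nat \<Rightarrow> 'a) set \<Rightarrow> bool" where
  "xgood X q C \<longleftrightarrow> (\<forall>i<q. ev i (md C) (md X)) \<and> hom C X \<subseteq> hom C (jrad X)"

lemma lmodule_regA: "lmodule regA"
  by unfold_locales (auto simp: regular_module_def algebra_simps)

lemma base_ev_psub: "base C \<Longrightarrow> psub L \<Longrightarrow> ev i (md C) (md L)"
  using ev_regular[OF _ lmodule_sub] unfolding base_def by blast

context
  fixes C P K :: "(nat \<Rightarrow> 'a) set" and p
  assumes C: "sub C" "jrad (jrad C) = {0}" and cov: "cover P p (md C)" and K: "K = {x \<in> P. p x = 0}"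
begin

text \<open>The heart is the sandwich of K between J^2 P and J P: the lower bound comes from J^2 C =
  0, the upper one from minimality of the cover. With J^3 = 0 it gives J^2 K = 0.\<close>

lemma cov_facts: "psub P" "sub P" "p \<in> hom P C" "p ` P = C" "pres (md P) p (md C)" "ker (md P) p = md K"
  "K \<subseteq> jrad P" "sub K" "K \<subseteq> P" "jrad (jrad P) \<subseteq> K" "jrad K \<subseteq> jrad (jrad P)" "jrad (jrad K) = {0}"
  "sub (jrad P)" "sub (jrad (jrad P))" "jrad P \<subseteq> P" "jrad (jrad P) \<subseteq> jrad P"
proof -
  show P: "psub P" "sub P" "p \<in> hom P C" "p ` P = C" "K \<subseteq> jrad P" "K \<subseteq> P"
    using cov psub_sub K by (auto simp: cover_def)
  show "pres (md P) p (md C)" using P psub_rfree by (simp add: pres_def)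
  show "ker (md P) p = md K" by (simp add: ker_md K)
  have "submodule (md P) K" using submodule_ker[OF P(3) lmodule_sub[OF P(2)] lmodule_sub[OF C(1)]] K by simp
  then show "sub K" using submodule_mdD P(2) by blast
  show sj: "sub (jrad P)" "sub (jrad (jrad P))" "jrad P \<subseteq> P" "jrad (jrad P) \<subseteq> jrad P"
    using sub_jrad[OF P(2)] sub_jrad[OF sub_jrad[OF P(2)]] jrad_subset[OF P(2)] jrad_subset[OF sub_jrad[OF P(2)]]
    by auto
  have "p ` jrad (jrad P) = jrad (p ` jrad P)" using jrad_image[OF P(3,2) sj(3)] .
  also have "\<dots> = {0}" using jrad_image[OF P(3,2) order_refl] P(4) C(2) by simp
  finally show "jrad (jrad P) \<subseteq> K" using sj K by auto
  show "jrad K \<subseteq> jrad (jrad P)" using jrad_mono[OF P(5)] .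
  have "jrad (jrad K) \<subseteq> jrad (jrad (jrad P))" by (intro jrad_mono P(5))
  then show "jrad (jrad K) = {0}" using jrad_cube jrad_0 by blast
qed

lemma extend_to_cover:
  assumes "ev 0 (md C) (md Z)" "f \<in> hom K Z"
  obtains F where "F \<in> hom P Z" "\<forall>x\<in>K. F x = f x"
proof -
  have ok: "ext_ok (md P) p (md Z)" using assms(1) cov_facts(5) by simp
  have "f \<in> lhom (ker (md P) p) (md Z)" using assms(2) by (simp add: cov_facts)
  from ext_okD[OF ok this] obtain F where "F \<in> hom P Z" "\<forall>x\<in>carr (md P). p x = 0 \<longrightarrow> F x = f x" by blast
  then show ?thesis using that K by simp
qed

text \<open>A map on \<open>K\<close> extends to \<open>P\<close>, the extension sends J P into J Z,
  and \<open>K\<close> lies in J P.\<close>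

lemma ker_hom_jrad:
  assumes "ev 0 (md C) (md Z)" shows "hom K Z \<subseteq> hom K (jrad Z)"
proof
  fix f assume f: "f \<in> hom K Z"
  obtain F where F: "F \<in> hom P Z" "\<forall>x\<in>K. F x = f x" by (rule extend_to_cover[OF assms f])
  have FP: "F ` P \<subseteq> Z" using lhom_closed[OF F(1)] by auto
  have "F x \<in> jrad Z" if "x \<in> jrad P" for x
    using jrad_hom[OF F(1) cov_facts(2) that order_refl] jrad_mono[OF FP] by auto
  then have "f x \<in> jrad Z" if "x \<in> K" for x using F(2) cov_facts(7) that by force
  then show "f \<in> hom K (jrad Z)" using hom_codom[OF f] by blast
qed

lemma ev_ker: "ev (Suc i) (md C) N \<Longrightarrow> ev i (md K) N"
  using cov_facts(5,6) by fastforce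

lemma base_ker: assumes "base C" shows "base K"
  unfolding base_def
proof (intro conjI allI impI)
  show "sub K" "jrad (jrad K) = {0}" using cov_facts by blast+
  have "ev (Suc i) (md C) regA" for i using assms unfolding base_def by blast
  from ev_ker[OF this] show "ev i (md K) regA" for i .
  show "hom K L \<subseteq> hom K (jrad L)" if "psub L" for L using ker_hom_jrad[OF base_ev_psub[OF assms that]] .
qed

lemma xgood_ker: assumes "\<forall>i<Suc q. ev i (md C) (md X)" shows "xgood X q K"
  unfolding xgood_def using ev_ker ker_hom_jrad[of X] assms by blast

lemma h_cover:
  assumes Z: "sub Z" and ext: "ev 0 (md C) (md Z)" shows "h P Z = h C Z + h K Z"
proof -
  have "restrict0 K ` hom P Z = hom K Z"
  proof (intro equalityI subsetI)
    fix g assume "g \<in> restrict0 K ` hom P Z"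
    then obtain g' where "g' \<in> hom P Z" "g = restrict0 K g'" by blast
    then show "g \<in> hom K Z"
      using lhom_restrict0[OF _ submodule_md[OF cov_facts(2,8,9)], of g' "md Z"] by simp
  next
    fix g assume g: "g \<in> hom K Z"
    obtain F where F: "F \<in> hom P Z" "\<forall>x\<in>K. F x = g x" by (rule extend_to_cover[OF ext g])
    have "g = restrict0 K F"
    proof
      fix x show "g x = restrict0 K F x" using F(2) lhom_off[OF g, of x] by (cases "x \<in> K") (auto simp: restrict0_out)
    qed
    then show "g \<in> restrict0 K ` hom P Z" using F(1) by blast
  qed
  then show ?thesis using h_restrict[OF cov_facts(2) C(1) Z cov_facts(3,4) K] by (simp add: h_def)
qed

text \<open>Hom(L, -) is applied to 0 -> K -> P -> C -> 0 and to 0 -> K -> J P -> J C -> 0; the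
  second sequence exists because \<open>K\<close> lies in J P.\<close>

lemma h_into_cover:
  assumes L: "psub L"
  shows "h L P = h L K + h L C" "h L (jrad P) = h L K + h L (jrad C)"
proof -
  have "p ` P = carr (md C)" using cov_facts(4) by simp
  then show "h L P = h L K + h L C"
    using h_exact[OF L cov_facts(2) natural_sub[OF C(1)] cov_facts(3) _ K] by (simp add: h_def)
  have r0: "restrict0 (jrad P) p \<in> hom (jrad P) C"
    using lhom_restrict0[OF cov_facts(3) submodule_md[OF cov_facts(2,13,15)]] by simp
  have im: "restrict0 (jrad P) p ` jrad P = jrad C"
    using jrad_image[OF cov_facts(3,2) order_refl] cov_facts(4) by simp
  have r: "restrict0 (jrad P) p \<in> hom (jrad P) (jrad C)" by (rule hom_codom[OF r0 equalityD1[OF im]])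
  have "K = {x \<in> jrad P. restrict0 (jrad P) p x = 0}"
    using cov_facts(7,15) K by auto
  then show "h L (jrad P) = h L K + h L (jrad C)"
    using h_exact[OF L cov_facts(13) natural_sub[OF sub_jrad[OF C(1)]] r] im by (simp add: h_def)
qed

end

end

section \<open>Dimension vectors and their change under a syzygy\<close>

context rad_cube_zero_index begin

text \<open>For \<open>l\<close> in \<open>I\<close>, the multiplicities of its top in the Loewy
  layers J L/J^2 L and J^2 L are \<open>a1 L l\<close> and \<open>a2 L l\<close>.\<close>

definition a1 :: "(nat \<Rightarrow> 'a) set \<Rightarrow> (nat \<Rightarrow> 'a) set \<Rightarrow> real" where
  "a1 L l = h l (jrad L) - h l (jrad (jrad L))"

definition a2 :: "(nat \<Rightarrow> 'a) set \<Rightarrow> (nat \<Rightarrow> 'a) set \<Rightarrow> real" where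
  "a2 L l = h l (jrad (jrad L))"

definition A1 :: "((nat \<Rightarrow> 'a) set \<Rightarrow> real) \<Rightarrow> (nat \<Rightarrow> 'a) set \<Rightarrow> real" where
  "A1 t = restrict0 I (\<lambda>l. \<Sum>L\<in>I. t L * a1 L l)"

definition A2 :: "((nat \<Rightarrow> 'a) set \<Rightarrow> real) \<Rightarrow> (nat \<Rightarrow> 'a) set \<Rightarrow> real" where
  "A2 t = restrict0 I (\<lambda>l. \<Sum>L\<in>I. t L * a2 L l)"

text \<open>Multiplicities in C/J C, with \<open>rv C\<close> those in J C. Both are cut to 0 off
  \<open>I\<close> so that vectors can be compared as functions.\<close>

definition tv :: "(nat \<Rightarrow> 'a) set \<Rightarrow> (nat \<Rightarrow> 'a) set \<Rightarrow> real" where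
  "tv C = restrict0 I (top_mult C)"

definition rv :: "(nat \<Rightarrow> 'a) set \<Rightarrow> (nat \<Rightarrow> 'a) set \<Rightarrow> real" where
  "rv C = restrict0 I (\<lambda>l. h l (jrad C))"

definition ip :: "((nat \<Rightarrow> 'a) set \<Rightarrow> real) \<Rightarrow> ((nat \<Rightarrow> 'a) set \<Rightarrow> real) \<Rightarrow> real" where
  "ip x y = (\<Sum>l\<in>I. x l * y l)"

definition unit_vec :: "(nat \<Rightarrow> 'a) set \<Rightarrow> (nat \<Rightarrow> 'a) set \<Rightarrow> real" where
  "unit_vec l = (\<lambda>l'. if l' = l then 1 else 0)"

text \<open>\<open>sg P K\<close> counts the simple direct summands of \<open>K\<close> that lie in \<open>J\<^sup>2 P\<close>.\<close>

definition sg :: "(nat \<Rightarrow> 'a) set \<Rightarrow> (nat \<Rightarrow> 'a) set \<Rightarrow> (nat \<Rightarrow> 'a) set \<Rightarrow> real" where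
  "sg P K = restrict0 I (\<lambda>l. h l (jrad (jrad P)) - h l (jrad K))"

lemma ip_tv: "ip (tv C) y = (\<Sum>l\<in>I. top_mult C l * y l)"
  by (simp add: ip_def tv_def)

lemma h_eqI: "hom C D = hom C D' \<Longrightarrow> h C D = h C D'"
  by (simp add: h_def)

context
  fixes C P K :: "(nat \<Rightarrow> 'a) set" and p
  assumes base: "base C" and cov: "cover P p (md C)" and K: "K = {x \<in> P. p x = 0}"
begin

lemma sC: "sub C" "jrad (jrad C) = {0}" using base by (auto simp: base_def)

lemmas cf = cov_facts[OF sC cov K]

lemma top_cover: "L \<in> I \<Longrightarrow> top_mult P L = top_mult C L"
  using h_into_cover[OF sC cov K I_psub] by (simp add: top_mult_def)

lemma tv_cover: "tv P = tv C"
  by (rule ext) (simp add: tv_def restrict0_def top_cover)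

lemma h_cover_ip: "sub Z \<Longrightarrow> h P Z = ip (tv C) (\<lambda>l. h l Z)"
  using psub_multiplicities(1)[OF cf(1)] by (simp add: tv_cover[symmetric] ip_tv)

lemma A2_cover: "l \<in> I \<Longrightarrow> A2 (tv C) l = h l (jrad (jrad P))"
  using psub_multiplicities(4)[OF cf(1) I_psub] by (simp add: A2_def a2_def tv_def top_cover)

lemma A1_cover: "l \<in> I \<Longrightarrow> A1 (tv C) l = h l (jrad P) - h l (jrad (jrad P))"
  using psub_multiplicities(3,4)[OF cf(1) I_psub]
  by (simp add: A1_def a1_def tv_def right_diff_distrib sum_subtractf top_cover)

text \<open>Both sides count the factors of K/J^2 P. This would be the top of \<open>K\<close> if J
  K were all of J^2 P; \<open>sg P K\<close> is the discrepancy.\<close>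

lemma linear_part: "l \<in> I \<Longrightarrow> A1 (tv C) l - rv C l = h l K - h l (jrad (jrad P))"
  using A1_cover h_into_cover(2)[OF sC cov K I_psub] by (simp add: rv_def)

lemma tv_ker: "tv K = (\<lambda>l. A1 (tv C) l - rv C l + sg P K l)"
proof
  fix l show "tv K l = A1 (tv C) l - rv C l + sg P K l"
  proof (cases "l \<in> I")
    case True
    then show ?thesis by (simp add: linear_part) (simp add: tv_def sg_def top_mult_def)
  qed (simp add: tv_def A1_def rv_def sg_def restrict0_out)
qed

lemma rv_ker: "rv K = (\<lambda>l. A2 (tv C) l - sg P K l)"
proof
  fix l show "rv K l = A2 (tv C) l - sg P K l"
  proof (cases "l \<in> I")
    case True
    then show ?thesis by (simp add: A2_cover rv_def sg_def)
  qed (simp add: rv_def A2_def sg_def restrict0_out)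
qed

text \<open>The maps K -> J L that extend to P -> J L are exactly the maps K -> J^2 L that kill J^2
  P, and these are counted by \<open>hom_semisimple\<close>. So dim Hom(C, J L) is linear in
  \<open>(tv C, rv C)\<close>, with no error term.\<close>

lemma h_jrad:
  assumes L: "L \<in> I"
  shows "h C (jrad L) = ip (tv C) (a1 L) + ip (tv C) (a2 L) - ip (\<lambda>l. A1 (tv C) l - rv C l) (a2 L)"
proof -
  have sL: "sub L" "sub (jrad L)" "sub (jrad (jrad L))" and pL: "psub L"
    using I_sub[OF L] I_psub[OF L] sub_jrad by blast+
  obtain pl and S :: "'a std_mod" where l: "cover L pl S" "simple_module S" by (rule I_cover[OF L])
  let ?R = "{f \<in> hom K (jrad (jrad L)). \<forall>x\<in>jrad (jrad P). f x = 0}"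
  have "restrict0 K ` hom P (jrad L) = ?R"
  proof (intro equalityI subsetI)
    fix g assume "g \<in> restrict0 K ` hom P (jrad L)"
    then obtain F where F: "F \<in> hom P (jrad L)" "g = restrict0 K F" by blast
    have FP: "F ` P \<subseteq> jrad L" using lhom_closed[OF F(1)] by auto
    have FJ: "F ` jrad P \<subseteq> jrad (jrad L)"
      using jrad_image[OF F(1) cf(2) order_refl] jrad_mono[OF FP] by simp
    have "F ` jrad (jrad P) \<subseteq> jrad (jrad (jrad L))"
      using jrad_image[OF F(1) cf(2,15)] jrad_mono[OF FJ] by simp
    then have F0: "F x = 0" if "x \<in> jrad (jrad P)" for x using that jrad_cube[of L] by blast
    have FK: "restrict0 K F \<in> hom K (jrad L)" using lhom_restrict0[OF F(1) submodule_md[OF cf(2,8,9)]] by simp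
    have "restrict0 K F ` K \<subseteq> jrad (jrad L)" using FJ cf(7) by auto
    from hom_codom[OF FK this] have "restrict0 K F \<in> hom K (jrad (jrad L))" .
    then show "g \<in> ?R" using F(2) F0 cf(10) by auto
  next
    fix g assume g: "g \<in> ?R"
    then have gh: "g \<in> hom K (jrad (jrad L))" by simp
    have gL: "g \<in> hom K L"
      using hom_mono[OF gh] jrad_subset[OF sL(1)] jrad_subset[OF sL(2)] by blast
    obtain F where F: "F \<in> hom P L" "\<forall>x\<in>K. F x = g x"
      by (rule extend_to_cover[OF sC cov K base_ev_psub[OF base pL] gL])
    \<comment> \<open>Ext^1(C, L) = 0 extends \<open>g\<close> to F: P -> L, whose image may leave J
      L. Then \<open>F\<close> is onto, so J^2 L = F(J^2 P) = 0; hence \<open>g\<close> is 0 on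
      \<open>K\<close> and the zero map extends it.\<close>
    have "\<exists>F\<in>hom P (jrad L). \<forall>x\<in>K. F x = g x"
    proof (cases "F ` P \<subseteq> jrad L")
      case True
      then show ?thesis using hom_codom[OF F(1) True] F(2) by blast
    next
      case False
      then obtain x where "x \<in> P" "F x \<notin> jrad L" by blast
      then have FP: "F ` P = L" using cover_simple_surj[OF l cf(2) F(1)] by blast
      have "F ` jrad (jrad P) = jrad (jrad L)"
        using jrad_image[OF F(1) cf(2,15)] jrad_image[OF F(1) cf(2) order_refl] FP by simp
      moreover have F0: "F x = 0" if x: "x \<in> jrad (jrad P)" for x
      proof -
        have "x \<in> K" using cf(10) x by blast
        then show ?thesis using F(2) g x by simp
      qed
      then have "F ` jrad (jrad P) \<subseteq> {0}" by (intro image_subsetI) simp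
      ultimately have "jrad (jrad L) \<subseteq> {0}" by simp
      then have "\<forall>x\<in>K. g x = 0" using lhom_closed[OF gh] by auto
      then show ?thesis using lhom_0[OF lmodule_sub[OF sL(2)], of "md P"] by force
    qed
    then obtain F' where F': "F' \<in> hom P (jrad L)" "\<forall>x\<in>K. F' x = g x" by blast
    have "g = restrict0 K F'"
    proof
      fix x show "g x = restrict0 K F' x"
        using F'(2) lhom_off[OF gh, of x] by (cases "x \<in> K") (auto simp: restrict0_out)
    qed
    then show "g \<in> restrict0 K ` hom P (jrad L)" using F'(1) by blast
  qed
  then have "h P (jrad L) = h C (jrad L) + real (H.dim ?R)"
    using h_restrict[OF cf(2) sC(1) sL(2) cf(3,4) K] by simp
  moreover have "real (H.dim ?R) = ip (\<lambda>l. A1 (tv C) l - rv C l) (a2 L)"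
    using hom_semisimple[OF cf(8,14,10,11) sL(3) jrad_cube] linear_part by (simp add: ip_def a2_def)
  moreover have "h P (jrad L) = ip (tv C) (a1 L) + ip (tv C) (a2 L)"
    using h_cover_ip[OF sL(2)] by (simp add: ip_def a1_def a2_def sum.distrib[symmetric] distrib_left[symmetric])
  ultimately show ?thesis by simp
qed

text \<open>Ext^1(C, L) = 0 gives \<open>h P L = h C L + h K L\<close>. On the right
  \<open>L\<close> may be replaced by J L, while on the left this costs the multiplicity of
  \<open>L\<close> in the top; \<open>h_jrad\<close> then eliminates the term for
  \<open>C\<close>.\<close>

lemma h_ker_jrad:
  assumes L: "L \<in> I"
  shows "h K (jrad L) = tv C L + ip (\<lambda>l. A1 (tv C) l - rv C l) (a2 L)"
proof -
  have sL: "sub L" "sub (jrad L)" and pL: "psub L" using I_sub[OF L] I_psub[OF L] sub_jrad by blast+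
  have eq: "h D L = h D (jrad L)" if "base D" for D
  proof (rule h_eqI)
    show "hom D L = hom D (jrad L)"
      using that pL hom_mono[OF _ jrad_subset[OF sL(1)], of _ D] by (auto simp: base_def)
  qed
  have bK: "base K" by (rule base_ker[OF sC cov K base])
  have "h P L = h C (jrad L) + h K (jrad L)"
    using h_cover[OF sC cov K sL(1) base_ev_psub[OF base pL]] eq[OF base] eq[OF bK] by simp
  moreover have "h P L = ip (tv C) (a1 L) + ip (tv C) (a2 L) + tv C L"
  proof -
    have "h P L = (\<Sum>l\<in>I. tv C l * h l L)" using h_cover_ip[OF sL(1)] by (simp add: ip_def)
    also have "\<dots> = (\<Sum>l\<in>I. tv C l * a1 L l + tv C l * a2 L l + (if l = L then tv C l else 0))"
    proof (rule sum.cong[OF refl])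
      fix l assume l: "l \<in> I"
      have "h l L = a1 L l + a2 L l + (if l = L then 1 else 0)" using I_delta[OF l L] by (simp add: a1_def a2_def)
      then show "tv C l * h l L = tv C l * a1 L l + tv C l * a2 L l + (if l = L then tv C l else 0)"
        by (simp add: algebra_simps)
    qed
    also have "\<dots> = ip (tv C) (a1 L) + ip (tv C) (a2 L) + tv C L"
      using L finite_I by (simp add: sum.distrib ip_def)
    finally show ?thesis .
  qed
  ultimately show ?thesis using h_jrad[OF L] by simp
qed

text \<open>If \<open>sg P K l\<close> is not 0, some map from \<open>l\<close> to J^2 P does not
  land in J K. Its image \<open>S\<close> is simple, as a quotient of \<open>l\<close> killed by J,
  and splits off \<open>K\<close> because it is not inside J K.\<close>

lemma simple_summand_exists:
  assumes l: "l \<in> I" "sg P K l \<noteq> 0"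
  obtains S e f where "f \<in> hom l S" "f ` l = S" "{x \<in> l. f x = 0} = jrad l" "sub S" "S \<subseteq> jrad (jrad P)" "e \<in> hom K S"
    "\<forall>x\<in>S. e x = x" "jrad S = {0}" "tv S = unit_vec l" "rv S = (\<lambda>_. 0)" "base S"
proof -
  have pl: "psub l" and sl: "sub l" using I_psub I_sub l(1) by blast+
  obtain pp and T :: "'a std_mod" where T: "cover l pp T" "simple_module T" by (rule I_cover[OF l(1)])
  let ?JJ = "jrad (jrad P)"
  have jjj: "jrad ?JJ = {0}" using jrad_cube .
  have "h l ?JJ \<noteq> h l (jrad K)" using l by (simp add: sg_def)
  then have "hom l ?JJ \<noteq> hom l (jrad K)" using h_eqI by blast
  moreover have "hom l (jrad K) \<subseteq> hom l ?JJ" using hom_mono[OF _ cf(11)] by (rule subsetI)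
  ultimately obtain f where f: "f \<in> hom l ?JJ" "f \<notin> hom l (jrad K)" by blast
  have "\<not> f ` l \<subseteq> jrad K" using hom_codom[OF f(1), of "jrad K"] f(2) by blast
  then obtain x where x: "x \<in> l" "f x \<notin> jrad K" by blast
  define S where "S = f ` l"
  have SJ: "S \<subseteq> ?JJ" using lhom_closed[OF f(1)] by (auto simp: S_def)
  have "submodule (md ?JJ) S"
    using submodule_image[OF f(1) lmodule_sub[OF sl] submodule_self[OF lmodule_sub[OF sl]]] by (simp add: S_def)
  then have sS: "sub S" using submodule_mdD cf(14) by blast
  have fS: "f \<in> hom l S" using hom_codom[OF f(1), of S] by (simp add: S_def)
  have SK: "S \<subseteq> K" using SJ cf(10) by blast
  have big: "D = l" if D: "sub D" "D \<subseteq> l" "y \<in> D" "y \<notin> jrad l" for D y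
  proof -
    have "restrict0 D (\<lambda>x. x) ` D = l"
      using cover_simple_surj[OF T D(1) lhom_incl_md[OF sl D(1,2)], of y] D(3,4) by simp
    then show ?thesis by simp
  qed
  have f0: "f y = 0" if "y \<in> jrad l" for y using jkill_jrad[OF jkill_md[OF cf(14) jjj] sl f(1) that] .
  have ker: "{y \<in> l. f y = 0} = jrad l"
  proof
    show "jrad l \<subseteq> {y \<in> l. f y = 0}" using f0 jrad_subset[OF sl] by blast
    show "{y \<in> l. f y = 0} \<subseteq> jrad l"
    proof (rule ccontr)
      assume "\<not> ?thesis"
      then obtain y where y: "y \<in> {y \<in> l. f y = 0}" "y \<notin> jrad l" by blast
      have "submodule (md l) {y \<in> l. f y = 0}"
        using submodule_ker[OF f(1) lmodule_sub[OF sl] lmodule_sub[OF cf(14)]] by simp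
      then have "sub {y \<in> l. f y = 0}" "{y \<in> l. f y = 0} \<subseteq> l" using submodule_mdD sl by blast+
      then have "{y \<in> l. f y = 0} = l" using big y by blast
      then have "f x = 0" using x(1) by blast
      then show False using x(2) jrad_0 by metis
    qed
  qed
  have simple: "N = {0} \<or> N = S" if N: "sub N" "N \<subseteq> S" for N
  proof -
    define D where "D = {y \<in> l. f y \<in> N}"
    have "submodule (md l) D"
      using submodule_vimage[OF fS lmodule_sub[OF sl] submodule_md[OF sS N]] by (simp add: D_def)
    then have D: "sub D" "D \<subseteq> l" using submodule_mdD sl by blast+
    have fD: "f ` D = N" using N(2) by (auto simp: D_def S_def)
    show ?thesis
    proof (cases "D \<subseteq> jrad l")
      case True
      then have "N \<subseteq> {0}" using fD f0 by blast
      then show ?thesis using sub_0[OF N(1)] by blast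
    next
      case False
      then have "D = l" using big[OF D] by blast
      then show ?thesis using fD by (simp add: S_def)
    qed
  qed
  have fx: "f x \<in> S" using x(1) by (simp add: S_def)
  obtain e where e: "e \<in> hom K S" "\<forall>x\<in>S. e x = x"
    by (rule simple_summand[OF cf(8) sS SK simple fx x(2)])
  have jS: "jrad S = {0}" using jrad_mono[OF SJ] jjj jrad_0 by blast
  have hS: "h L S = (if L = l then 1 else 0)" if L: "L \<in> I" for L
  proof -
    have "f ` l = carr (md S)" by (simp add: S_def)
    then have "h L l = h L (jrad l) + h L S"
      using h_exact[OF I_psub[OF L] sl natural_sub[OF sS] fS _ ker[symmetric]] by (simp add: h_def)
    then show ?thesis using I_delta[OF L l(1)] by simp
  qed
  have h0: "h L {0} = 0" if "L \<in> I" for L using h_zero I_sub that by blast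
  have tS: "tv S = unit_vec l"
  proof
    fix L show "tv S L = unit_vec l L"
      using l(1) hS h0 by (cases "L \<in> I") (auto simp: tv_def unit_vec_def top_mult_def jS restrict0_out)
  qed
  have rS: "rv S = (\<lambda>_. 0)"
  proof
    fix L show "rv S L = 0" using h0 by (cases "L \<in> I") (auto simp: rv_def jS restrict0_out)
  qed
  have bK: "base K" by (rule base_ker[OF sC cov K base])
  have le: "stab_le (md S) (md K)" by (rule retract_stab_le[OF cf(8) sS SK e])
  have bS: "base S"
    unfolding base_def
  proof (intro conjI allI impI sS)
    show "jrad (jrad S) = {0}" using jS jrad_subset[OF sub_jrad[OF sS]] jrad_0 by blast
    show "ev i (md S) regA" for i
      using ev_sub_stab_le[OF lmodule_regA cf(8) lmodule_sub[OF sS] le] bK by (simp add: base_def)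
    fix L :: "(nat \<Rightarrow> 'a) set" assume L: "psub L"
    show "hom S L \<subseteq> hom S (jrad L)"
    proof
      fix g assume g: "g \<in> hom S L"
      have "(\<lambda>x. g (e x)) \<in> hom K L" using lhom_comp[OF e(1) g lmodule_sub[OF sS]] .
      then have "(\<lambda>x. g (e x)) \<in> hom K (jrad L)" using bK L by (auto simp: base_def)
      then have "g (e x) \<in> jrad L" if "x \<in> K" for x using lhom_closed[of _ "md K" "md (jrad L)" x] that by auto
      then have "g x \<in> jrad L" if "x \<in> S" for x using e(2) SK that by force
      then show "g \<in> hom S (jrad L)" using hom_codom[OF g] by blast
    qed
  qed
  show ?thesis by (rule that[OF fS _ ker sS SJ e jS tS rS bS]) (simp add: S_def)
qed

lemma summand_xgood:
  assumes S: "sub S" "S \<subseteq> K" "e \<in> hom K S" "\<forall>x\<in>S. e x = x" and x: "xgood X q K" and X: "sub X"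
  shows "xgood X q S"
  unfolding xgood_def
proof (intro conjI allI impI)
  have le: "stab_le (md S) (md K)" by (rule retract_stab_le[OF cf(8) S])
  show "ev i (md S) (md X)" if "i < q" for i
    using ev_sub_stab_le[OF lmodule_sub[OF X] cf(8) lmodule_sub[OF S(1)] le] x that by (simp add: xgood_def)
  show "hom S X \<subseteq> hom S (jrad X)"
  proof
    fix g assume g: "g \<in> hom S X"
    have "(\<lambda>x. g (e x)) \<in> hom K X" using lhom_comp[OF S(3) g lmodule_sub[OF S(1)]] .
    then have "(\<lambda>x. g (e x)) \<in> hom K (jrad X)" using x by (auto simp: xgood_def)
    then have "g (e x) \<in> jrad X" if "x \<in> K" for x using lhom_closed[of _ "md K" "md (jrad X)" x] that by auto
    then have "g x \<in> jrad X" if "x \<in> S" for x using S(2,4) that by force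
    then show "g \<in> hom S (jrad X)" using hom_codom[OF g] by blast
  qed
qed

text \<open>A map from the summand to \<open>Z\<close> extends to the cover, hence lands in \<open>J\<^sup>2 Z\<close>.\<close>

lemma summand_hom:
  assumes S: "sub S" "S \<subseteq> jrad (jrad P)" "e \<in> hom K S" "\<forall>x\<in>S. e x = x"
    and ext: "ev 0 (md C) (md Z)" and g: "g \<in> hom S Z"
  shows "x \<in> S \<Longrightarrow> g x \<in> jrad (jrad Z)"
proof -
  have ge: "(\<lambda>x. g (e x)) \<in> hom K Z" using lhom_comp[OF S(3) g lmodule_sub[OF S(1)]] .
  obtain F where F: "F \<in> hom P Z" "\<forall>x\<in>K. F x = g (e x)" by (rule extend_to_cover[OF sC cov K ext ge])
  have FP: "F ` P \<subseteq> Z" using lhom_closed[OF F(1)] by auto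
  have "F ` jrad (jrad P) = jrad (jrad (F ` P))"
    using jrad_image[OF F(1) cf(2,15)] jrad_image[OF F(1) cf(2) order_refl] by simp
  then have *: "F ` jrad (jrad P) \<subseteq> jrad (jrad Z)" using jrad_mono[OF jrad_mono[OF FP]] by simp
  assume x: "x \<in> S"
  then have "F x = g x" using F(2) S(2,4) cf(10) by force
  then show "g x \<in> jrad (jrad Z)" using * S(2) x by force
qed

end

text \<open>For a simple summand the backward relation holds at the shifted vector \<open>(0, e)\<close>.\<close>

lemma summand_relation:
  assumes base: "base C" and cov: "cover P p (md C)" and K: "K = {x \<in> P. p x = 0}"
    and l: "l \<in> I" "sg P K l \<noteq> 0" and L: "L \<in> I"
  shows "a1 L l = ip (a1 l) (a2 L)"
proof -
  obtain S e f where S: "f \<in> hom l S" "f ` l = S" "{x \<in> l. f x = 0} = jrad l" "sub S" "S \<subseteq> jrad (jrad P)" "e \<in> hom K S"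
    "\<forall>x\<in>S. e x = x" "jrad S = {0}" "tv S = unit_vec l" "rv S = (\<lambda>_. 0)" "base S"
    by (rule simple_summand_exists[OF base cov K l])
  have sL: "sub L" "sub (jrad L)" "sub (jrad (jrad L))" and pL: "psub L"
    using I_sub[OF L] I_psub[OF L] sub_jrad by blast+
  obtain Q q where Q: "cover Q q (md S)" by (rule cover_exists[OF fg_sub[OF S(4)]])
  have u: "ip (unit_vec l) y = y l" for y
    using l(1) finite_I by (simp add: ip_def unit_vec_def if_distrib[of "\<lambda>x. x * _"] cong: if_cong)
  have A: "A1 (unit_vec l) l' = a1 l l'" if "l' \<in> I" for l'
    using u[of "\<lambda>l. a1 l l'"] that by (simp add: A1_def ip_def)
  \<comment> \<open>dim Hom(S, J L) is computed twice: by \<open>h_jrad\<close> at the vector (e, 0)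
    of \<open>S\<close>, and as dim Hom(S, J^2 L) = \<open>a2 L l\<close>, because every map S -> L
    lands in J^2 L.\<close>
  have "h S (jrad L) = a1 L l + a2 L l - ip (a1 l) (a2 L)"
    using h_jrad[OF S(11) Q refl L] A by (simp add: S u) (simp add: ip_def)
  moreover have "hom S (jrad L) = hom S (jrad (jrad L))"
  proof
    show "hom S (jrad (jrad L)) \<subseteq> hom S (jrad L)" using hom_mono[OF _ jrad_subset[OF sL(2)]] by blast
    show "hom S (jrad L) \<subseteq> hom S (jrad (jrad L))"
    proof
      fix g assume g: "g \<in> hom S (jrad L)"
      have gL: "g \<in> hom S L" using hom_mono[OF g jrad_subset[OF sL(1)]] .
      have "g x \<in> jrad (jrad L)" if "x \<in> S" for x
        using summand_hom[OF base cov K S(4-7) base_ev_psub[OF base pL] gL that] .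
      then show "g \<in> hom S (jrad (jrad L))" using hom_codom[OF g] by blast
    qed
  qed
  then have "h S (jrad L) = h S (jrad (jrad L))" by (rule h_eqI)
  moreover have "h S (jrad (jrad L)) = a2 L l"
  proof -
    have "h S (jrad (jrad L)) = ip (tv S) (a2 L)"
      using hom_semisimple_top[OF S(4) sL(3) jrad_cube] by (simp add: ip_tv a2_def)
    then show ?thesis by (simp add: S u)
  qed
  ultimately show ?thesis by simp
qed

text \<open>A map from \<open>l\<close> to J X kills J l, since J^2 X = 0, and so factors through
  the summand \<open>S\<close>; by \<open>summand_hom\<close> it lands in J^2 X = 0. Thus the errors
  pair to zero with \<open>rv X\<close>.\<close>

lemma summand_rv:
  assumes base: "base C" and cov: "cover P p (md C)" and K: "K = {x \<in> P. p x = 0}"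
    and l: "l \<in> I" "sg P K l \<noteq> 0" and X: "sub X" "jrad (jrad X) = {0}" and ext: "ev 0 (md C) (md X)"
  shows "rv X l = 0"
proof -
  obtain S e f where S: "f \<in> hom l S" "f ` l = S" "{x \<in> l. f x = 0} = jrad l" "sub S" "S \<subseteq> jrad (jrad P)" "e \<in> hom K S"
    "\<forall>x\<in>S. e x = x" "jrad S = {0}" "tv S = unit_vec l" "rv S = (\<lambda>_. 0)" "base S"
    by (rule simple_summand_exists[OF base cov K l])
  have sl: "sub l" using I_sub l(1) by blast
  have "hom l (jrad X) \<subseteq> H.span {}"
  proof
    fix w assume w: "w \<in> hom l (jrad X)"
    have k: "w x = 0" if "x \<in> carr (md l)" "f x = 0" for x
      using jkill_jrad[OF jkill_md[OF sub_jrad[OF X(1)] X(2)] sl w] S(3) that by auto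
    have fs: "f ` carr (md l) = carr (md S)" using S(2) by simp
    obtain g where g: "g \<in> hom S (jrad X)" "\<And>x. x \<in> carr (md l) \<Longrightarrow> g (f x) = w x"
      using lhom_factor[OF S(1) fs w lmodule_sub[OF sl] k] by metis
    have gX: "g \<in> hom S X" using hom_mono[OF g(1) jrad_subset[OF X(1)]] .
    have "w x = 0" for x
    proof (cases "x \<in> l")
      case True
      then have "f x \<in> S" using S(2) by blast
      then have "g (f x) \<in> jrad (jrad X)" using summand_hom[OF base cov K S(4-7) ext gX] by blast
      then show ?thesis using X(2) g(2)[of x] True by simp
    next
      case False
      then show ?thesis using lhom_off[OF w, of x] by simp
    qed
    then have "w = 0" by (simp add: fun_eq_iff)
    then show "w \<in> H.span {}" by simp
  qed
  then have "h l (jrad X) = 0" using H.dim_le_card[of "hom l (jrad X)" "{}"] by (simp add: h_def)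
  then show ?thesis by (simp add: rv_def restrict0_def)
qed

end

section \<open>The Euler form and the recurrence\<close>

text \<open>Gaussian elimination on the equations indexed by \<open>X\<close>: an unknown
  \<open>k\<close> with nonzero coefficient in the new equation is solved for and eliminated from
  the others.\<close>

lemma linear_dependence:
  fixes w :: "'i \<Rightarrow> 'x \<Rightarrow> real"
  assumes "finite X" "finite J" "card X < card J"
  shows "\<exists>c. (\<exists>i\<in>J. c i \<noteq> 0) \<and> (\<forall>x\<in>X. (\<Sum>i\<in>J. c i * w i x) = 0)"
  using assms
proof (induction X arbitrary: J w rule: finite_induct)
  case empty
  then have "J \<noteq> {}" by auto
  then show ?case by (intro exI[of _ "\<lambda>_. 1"]) auto
next
  case (insert x X)
  show ?case
  proof (cases "\<forall>i\<in>J. w i x = 0")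
    case True
    have "card X < card J" using insert by simp
    from insert.IH[OF insert.prems(1) this, of w] show ?thesis using True by auto
  next
    case False
    then obtain k where k: "k \<in> J" "w k x \<noteq> 0" by blast
    define w' where "w' i y = w i y - w i x / w k x * w k y" for i y
    have "card X < card (J - {k})" using insert k by (simp add: card_Diff_singleton)
    from insert.IH[OF _ this, of w'] insert.prems obtain c where
      c: "\<exists>i\<in>J - {k}. c i \<noteq> 0" "\<forall>y\<in>X. (\<Sum>i\<in>J - {k}. c i * w' i y) = 0" by auto
    define c' where "c' = c(k := - (\<Sum>i\<in>J - {k}. c i * (w i x / w k x)))"
    have e: "(\<Sum>i\<in>J. c' i * w i y) = (\<Sum>i\<in>J - {k}. c i * w' i y)" for y
    proof -
      have "(\<Sum>i\<in>J. c' i * w i y) = c' k * w k y + (\<Sum>i\<in>J - {k}. c' i * w i y)"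
        using insert.prems k(1) by (simp add: sum.remove)
      also have "(\<Sum>i\<in>J - {k}. c' i * w i y) = (\<Sum>i\<in>J - {k}. c i * w i y)"
        by (intro sum.cong) (auto simp: c'_def)
      also have "c' k * w k y = - (\<Sum>i\<in>J - {k}. c i * (w i x / w k x * w k y))"
        by (simp add: c'_def sum_distrib_right sum_distrib_left mult.assoc)
      finally show ?thesis by (simp add: w'_def right_diff_distrib sum_subtractf)
    qed
    have "w' i x = 0" for i using k(2) by (simp add: w'_def)
    then have "\<forall>y\<in>insert x X. (\<Sum>i\<in>J. c' i * w i y) = 0" using c(2) by (auto simp: e)
    moreover have "\<exists>i\<in>J. c' i \<noteq> 0" using c(1) by (auto simp: c'_def)
    ultimately show ?thesis by blast
  qed
qed

text \<open>Joint linearity in the pair (t, r), not linearity in each argument separately.\<close>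

definition lin2 :: "(('x \<Rightarrow> real) \<Rightarrow> ('x \<Rightarrow> real) \<Rightarrow> real) \<Rightarrow> bool" where
  "lin2 f \<longleftrightarrow> (\<forall>t t' r r' c. f (\<lambda>l. t l + c * t' l) (\<lambda>l. r l + c * r' l) = f t r + c * f t' r')"

lemma lin2D: "lin2 f \<Longrightarrow> f (\<lambda>l. t l + c * t' l) (\<lambda>l. r l + c * r' l) = f t r + c * f t' r'"
  by (simp add: lin2_def)

lemma lin2_0: "lin2 f \<Longrightarrow> f (\<lambda>_. 0) (\<lambda>_. 0) = 0"
  using lin2D[of f "\<lambda>_. 0" "1" "\<lambda>_. 0" "\<lambda>_. 0" "\<lambda>_. 0"] by simp

lemma lin2_sum:
  assumes f: "lin2 f"
  shows "f (\<lambda>l. \<Sum>i\<in>J. c i * t i l) (\<lambda>l. \<Sum>i\<in>J. c i * r i l) = (\<Sum>i\<in>J. c i * f (t i) (r i))"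
proof (induction J rule: infinite_finite_induct)
  case (insert i J)
  have "f (\<lambda>l. (\<Sum>i\<in>J. c i * t i l) + c i * t i l) (\<lambda>l. (\<Sum>i\<in>J. c i * r i l) + c i * r i l) =
      (\<Sum>i\<in>J. c i * f (t i) (r i)) + c i * f (t i) (r i)"
    using lin2D[OF f] insert by simp
  then show ?case using insert by (simp add: add.commute)
qed (simp_all add: lin2_0[OF f])

context rad_cube_zero_index begin

lemma ip_lin: "ip (\<lambda>l. t l + c * t' l) y = ip t y + c * ip t' y"
  by (simp add: ip_def sum.distrib sum_distrib_left algebra_simps)

lemma ip_diff: "ip (\<lambda>l. t l - t' l) y = ip t y - ip t' y"
  using ip_lin[of t "-1" t' y] by simp

lemma ip_add: "ip (\<lambda>l. t l + t' l) y = ip t y + ip t' y"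
  using ip_lin[of t 1 t' y] by simp

lemma ip_0 [simp]: "ip (\<lambda>_. 0) y = 0"
  by (simp add: ip_def)

lemma ip_unit_vec: "l \<in> I \<Longrightarrow> ip (unit_vec l) y = y l"
  using finite_I by (simp add: ip_def unit_vec_def if_distrib[of "\<lambda>x. x * _"] cong: if_cong)

lemma ip_cong: "(\<And>l. l \<in> I \<Longrightarrow> t l = t' l) \<Longrightarrow> ip t y = ip t' y"
  by (simp add: ip_def)

lemma A1_lin: "A1 (\<lambda>l. t l + c * t' l) = (\<lambda>l. A1 t l + c * A1 t' l)"
  using ip_lin[of t c t'] by (auto simp: A1_def restrict0_def fun_eq_iff ip_def)

lemma A2_lin: "A2 (\<lambda>l. t l + c * t' l) = (\<lambda>l. A2 t l + c * A2 t' l)"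
  using ip_lin[of t c t'] by (auto simp: A2_def restrict0_def fun_eq_iff ip_def)

lemma A1_0: "A1 (\<lambda>_. 0) = (\<lambda>_. 0)" and A2_0: "A2 (\<lambda>_. 0) = (\<lambda>_. 0)"
  by (auto simp: A1_def A2_def restrict0_def fun_eq_iff)

lemma A1_unit_vec: "l \<in> I \<Longrightarrow> l' \<in> I \<Longrightarrow> A1 (unit_vec l) l' = a1 l l'"
  using ip_unit_vec[of l "\<lambda>l. a1 l l'"] by (simp add: A1_def ip_def)

text \<open>The map \<open>(t, r) \<mapsto> (A1 t - r, A2 t)\<close> is what a syzygy with linear resolution does to the
  dimension vector (top, radical); \<open>pull\<close> is its transpose.\<close>

definition pull :: "(((nat \<Rightarrow> 'a) set \<Rightarrow> real) \<Rightarrow> ((nat \<Rightarrow> 'a) set \<Rightarrow> real) \<Rightarrow> real) \<Rightarrow>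
    ((nat \<Rightarrow> 'a) set \<Rightarrow> real) \<Rightarrow> ((nat \<Rightarrow> 'a) set \<Rightarrow> real) \<Rightarrow> real" where
  "pull f t r = f (\<lambda>l. A1 t l - r l) (A2 t)"

lemma lin2_pull: assumes f: "lin2 f" shows "lin2 (pull f)"
  unfolding lin2_def
proof (intro allI)
  fix t t' r r' c
  have "(\<lambda>l. A1 (\<lambda>l. t l + c * t' l) l - (r l + c * r' l)) =
      (\<lambda>l. (A1 t l - r l) + c * (A1 t' l - r' l))"
    by (simp add: A1_lin algebra_simps)
  then show "pull f (\<lambda>l. t l + c * t' l) (\<lambda>l. r l + c * r' l) = pull f t r + c * pull f t' r'"
    using lin2D[OF f] by (simp add: pull_def A2_lin)
qed

lemma lin2_pull_iter: "lin2 f \<Longrightarrow> lin2 ((pull ^^ n) f)"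
  by (induction n) (simp_all add: lin2_pull)

text \<open>The map of \<open>pull\<close> sends (0, e) to (-e, 0), so it sends (e, -e) to the image
  of (e, 0) plus (e, 0). After one step only iterates of (e, 0) occur; the value at (0, e) matters
  for \<open>n = 0\<close>.\<close>

lemma pull_shift:
  assumes f: "lin2 f" and u: "\<And>m. m \<le> n \<Longrightarrow> (pull ^^ m) f (unit_vec l) (\<lambda>_. 0) = 0"
    and z: "f (\<lambda>_. 0) (unit_vec l) = 0"
  shows "(pull ^^ n) f (unit_vec l) (\<lambda>x. - unit_vec l x) = 0"
proof (cases n)
  case 0
  have "f (unit_vec l) (\<lambda>x. - unit_vec l x) = f (unit_vec l) (\<lambda>_. 0) + (- 1) * f (\<lambda>_. 0) (unit_vec l)"
    using lin2D[OF f, of "unit_vec l" "-1" "\<lambda>_. 0" "\<lambda>_. 0" "unit_vec l"] by simp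
  then show ?thesis using u[of 0] z 0 by simp
next
  case (Suc m)
  let ?g = "(pull ^^ m) f"
  have "?g (\<lambda>x. A1 (unit_vec l) x + unit_vec l x) (A2 (unit_vec l)) =
      ?g (A1 (unit_vec l)) (A2 (unit_vec l)) + ?g (unit_vec l) (\<lambda>_. 0)"
    using lin2D[OF lin2_pull_iter[OF f, of m], of "A1 (unit_vec l)" 1 "unit_vec l" "A2 (unit_vec l)" "\<lambda>_. 0"] by simp
  also have "?g (A1 (unit_vec l)) (A2 (unit_vec l)) = (pull ^^ Suc m) f (unit_vec l) (\<lambda>_. 0)"
    by (simp add: pull_def)
  finally have "?g (\<lambda>x. A1 (unit_vec l) x + unit_vec l x) (A2 (unit_vec l)) = 0" using u[of m] u[of "Suc m"] Suc by simp
  moreover have "(pull ^^ Suc m) f (unit_vec l) (\<lambda>x. - unit_vec l x) =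
      ?g (\<lambda>x. A1 (unit_vec l) x + unit_vec l x) (A2 (unit_vec l))" by (simp add: pull_def)
  ultimately show ?thesis using Suc by simp
qed

lemma sg_expand: "sg P K = (\<lambda>x. \<Sum>l\<in>I. sg P K l * unit_vec l x)"
proof
  fix x
  have "(\<Sum>l\<in>I. sg P K l * unit_vec l x) = (\<Sum>l\<in>I. if l = x then sg P K l else 0)"
    by (intro sum.cong) (auto simp: unit_vec_def)
  then show "sg P K x = (\<Sum>l\<in>I. sg P K l * unit_vec l x)"
    using finite_I by (cases "x \<in> I") (auto simp: sg_def restrict0_def)
qed

text \<open>The vector of \<open>K\<close> is the image of the vector of \<open>C\<close> plus
  multiples \<open>sg P K l\<close> of (e_l, -e_l). A linear functional that kills the error vectors
  that occur does not see the difference.\<close>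

lemma pull_syzygy:
  assumes base: "base C" and cov: "cover P p (md C)" and K: "K = {x \<in> P. p x = 0}" and f: "lin2 f"
    and z: "\<And>l. l \<in> I \<Longrightarrow> sg P K l \<noteq> 0 \<Longrightarrow> f (unit_vec l) (\<lambda>x. - unit_vec l x) = 0"
  shows "pull f (tv C) (rv C) = f (tv K) (rv K)"
proof -
  let ?s = "sg P K"
  have "f (tv K) (rv K) = f (\<lambda>l. (A1 (tv C) l - rv C l) + 1 * ?s l) (\<lambda>l. A2 (tv C) l + 1 * (- ?s l))"
    using tv_ker[OF base cov K] rv_ker[OF base cov K] by simp
  also have "\<dots> = pull f (tv C) (rv C) + 1 * f ?s (\<lambda>l. - ?s l)"
    unfolding pull_def by (rule lin2D[OF f])
  also have "f ?s (\<lambda>l. - ?s l) = f (\<lambda>x. \<Sum>l\<in>I. ?s l * unit_vec l x) (\<lambda>x. \<Sum>l\<in>I. ?s l * (- unit_vec l x))"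
    by (subst (1 2) sg_expand) (simp add: sum_negf)
  also have "\<dots> = (\<Sum>l\<in>I. ?s l * f (unit_vec l) (\<lambda>x. - unit_vec l x))" by (rule lin2_sum[OF f])
  also have "\<dots> = 0"
  proof (rule sum.neutral, rule ballI)
    fix l assume "l \<in> I"
    then show "?s l * f (unit_vec l) (\<lambda>x. - unit_vec l x) = 0" using z by (cases "?s l = 0") simp_all
  qed
  finally show ?thesis by simp
qed

text \<open>\<open>G q\<close> is a class closed, at the cost of one unit of \<open>q\<close>, under
  syzygies and the simple summands behind the errors. Replacing \<open>C\<close> by its syzygy
  lowers the number of iterations; the error of this step involves only lower iterates at vectors
  (e, 0) of summands in the class. For \<open>backward\<close> the class is independent of
  \<open>q\<close>; for \<open>euler\<close> the budget counts degrees of Ext.\<close>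

lemma functional_vanish:
  assumes f: "lin2 f"
    and base: "\<And>q C. G q C \<Longrightarrow> base C"
    and f0: "\<And>q C. G (Suc q) C \<Longrightarrow> f (tv C) (rv C) = 0"
    and syz: "\<And>q C P p K. G (Suc q) C \<Longrightarrow> cover P p (md C) \<Longrightarrow> K = {x \<in> P. p x = 0} \<Longrightarrow> G q K"
    and summand: "\<And>q C P p K l. G (Suc q) C \<Longrightarrow> cover P p (md C) \<Longrightarrow> K = {x \<in> P. p x = 0} \<Longrightarrow> l \<in> I \<Longrightarrow>
      sg P K l \<noteq> 0 \<Longrightarrow> f (\<lambda>_. 0) (unit_vec l) = 0 \<and> (\<exists>S. G q S \<and> tv S = unit_vec l \<and> rv S = (\<lambda>_. 0))"
  shows "n < q \<Longrightarrow> G q C \<Longrightarrow> (pull ^^ n) f (tv C) (rv C) = 0"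
proof (induction n arbitrary: q C rule: less_induct)
  case (less n)
  obtain q' where q: "q = Suc q'" using less(2) by (cases q) auto
  note G = less(3)[unfolded q]
  show ?case
  proof (cases n)
    case 0
    then show ?thesis using f0[OF G] by simp
  next
    case (Suc m)
    obtain P p where P: "cover P p (md C)"
      using cover_exists[OF fg_sub] base[OF G] unfolding base_def by metis
    define K where "K = {x \<in> P. p x = 0}"
    have m: "m < q'" "m < n" using less(2) q Suc by auto
    have "(pull ^^ m) f (unit_vec l) (\<lambda>x. - unit_vec l x) = 0" if l: "l \<in> I" "sg P K l \<noteq> 0" for l
    proof (rule pull_shift[OF f])
      show "f (\<lambda>_. 0) (unit_vec l) = 0" using summand[OF G P K_def l] by blast
      obtain S where S: "G q' S" "tv S = unit_vec l" "rv S = (\<lambda>_. 0)" using summand[OF G P K_def l] by blast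
      show "(pull ^^ k) f (unit_vec l) (\<lambda>_. 0) = 0" if "k \<le> m" for k
        using less(1)[of k q' S] S that m by simp
    qed
    then have "pull ((pull ^^ m) f) (tv C) (rv C) = (pull ^^ m) f (tv K) (rv K)"
      by (intro pull_syzygy[OF base[OF G] P K_def lin2_pull_iter[OF f]])
    also have "\<dots> = 0" using less(1)[OF m(2,1) syz[OF G P K_def]] .
    finally show ?thesis using Suc by simp
  qed
qed

text \<open>By \<open>h_jrad\<close> this is dim Hom(C, J L) at the vector of a module
  \<open>C\<close> with \<open>base C\<close>.\<close>

definition eta :: "(nat \<Rightarrow> 'a) set \<Rightarrow> ((nat \<Rightarrow> 'a) set \<Rightarrow> real) \<Rightarrow> ((nat \<Rightarrow> 'a) set \<Rightarrow> real) \<Rightarrow> real" where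
  "eta L t r = ip t (a1 L) + ip t (a2 L) - ip (\<lambda>l. A1 t l - r l) (a2 L)"

text \<open>Vanishing of \<open>backward L\<close> at \<open>(t, r)\<close> recovers the entry \<open>t L\<close> from \<open>(A1 t - r, A2 t)\<close>.\<close>

definition backward :: "(nat \<Rightarrow> 'a) set \<Rightarrow> ((nat \<Rightarrow> 'a) set \<Rightarrow> real) \<Rightarrow> ((nat \<Rightarrow> 'a) set \<Rightarrow> real) \<Rightarrow> real" where
  "backward L t r = pull (eta L) t r - t L - ip (\<lambda>l. A1 t l - r l) (a2 L)"

text \<open>At the vector of \<open>C\<close> with \<open>base C\<close> and Ext^1(C, X) = 0 this is
  dim Hom(C, J X) - dim Hom(C, X) by \<open>h_ker_X\<close>; so it vanishes when all maps C -> X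
  land in J X.\<close>

definition euler :: "(nat \<Rightarrow> 'a) set \<Rightarrow> ((nat \<Rightarrow> 'a) set \<Rightarrow> real) \<Rightarrow> ((nat \<Rightarrow> 'a) set \<Rightarrow> real) \<Rightarrow> real" where
  "euler X t r = ip (\<lambda>l. A1 t l - r l) (rv X) - ip t (tv X)"

lemma ip_A1_lin: "ip (\<lambda>l. A1 (\<lambda>l. t l + c * t' l) l - (r l + c * r' l)) y =
    ip (\<lambda>l. A1 t l - r l) y + c * ip (\<lambda>l. A1 t' l - r' l) y"
proof -
  have "(\<lambda>l. A1 (\<lambda>l. t l + c * t' l) l - (r l + c * r' l)) = (\<lambda>l. (A1 t l - r l) + c * (A1 t' l - r' l))"
    by (simp add: A1_lin algebra_simps)
  then show ?thesis by (simp only: ip_lin)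
qed

lemma lin2_eta: "lin2 (eta L)"
  by (simp add: lin2_def eta_def ip_A1_lin ip_lin algebra_simps)

lemma lin2_backward: "lin2 (backward L)"
  by (simp add: lin2_def backward_def lin2D[OF lin2_pull[OF lin2_eta]] ip_A1_lin algebra_simps)

lemma lin2_euler: "lin2 (euler X)"
  by (simp add: lin2_def euler_def ip_A1_lin ip_lin algebra_simps)

text \<open>At the indices of errors, \<open>summand_relation\<close> makes this value 0.\<close>

lemma eta_kappa:
  assumes "l \<in> I" shows "eta L (unit_vec l) (\<lambda>x. - unit_vec l x) = a1 L l - ip (a1 l) (a2 L)"
proof -
  have "ip (\<lambda>x. A1 (unit_vec l) x + unit_vec l x) (a2 L) = ip (a1 l) (a2 L) + a2 L l"
    using ip_cong[of "A1 (unit_vec l)" "a1 l"] A1_unit_vec[OF assms] ip_unit_vec[OF assms] by (simp add: ip_add)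
  then show ?thesis by (simp add: eta_def ip_unit_vec[OF assms])
qed

text \<open>dim Hom(K, J L) is evaluated twice: as \<open>eta L\<close> at \<open>K\<close>, which
  is \<open>pull (eta L)\<close> at \<open>C\<close> because the errors drop out, and by
  \<open>h_ker_jrad\<close>.\<close>

lemma backward_base:
  assumes base: "base C" and L: "L \<in> I" shows "backward L (tv C) (rv C) = 0"
proof -
  have sC: "sub C" "jrad (jrad C) = {0}" using base by (auto simp: base_def)
  obtain P p where P: "cover P p (md C)" by (rule cover_exists[OF fg_sub[OF sC(1)]])
  define K where "K = {x \<in> P. p x = 0}"
  have bK: "base K" by (rule base_ker[OF sC P K_def base])
  obtain Q q where Q: "cover Q q (md K)"
    using cover_exists[OF fg_sub] bK unfolding base_def by metis
  have "eta L (unit_vec l) (\<lambda>x. - unit_vec l x) = 0" if "l \<in> I" "sg P K l \<noteq> 0" for l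
    using eta_kappa[OF that(1)] summand_relation[OF base P K_def that L] by simp
  then have "pull (eta L) (tv C) (rv C) = eta L (tv K) (rv K)"
    by (intro pull_syzygy[OF base P K_def lin2_eta])
  also have "\<dots> = h K (jrad L)" using h_jrad[OF bK Q refl L] by (simp add: eta_def)
  also have "\<dots> = tv C L + ip (\<lambda>l. A1 (tv C) l - rv C l) (a2 L)" using h_ker_jrad[OF base P K_def L] .
  finally show ?thesis by (simp add: backward_def)
qed

lemma backward_shifted:
  assumes "l \<in> I" "L \<in> I" and rel: "a1 L l = ip (a1 l) (a2 L)"
  shows "backward L (\<lambda>_. 0) (unit_vec l) = 0"
proof -
  have "eta L (\<lambda>x. - unit_vec l x) (\<lambda>_. 0) = - eta L (unit_vec l) (\<lambda>_. 0)"
    using lin2D[OF lin2_eta, of L "\<lambda>_. 0" "-1" "unit_vec l" "\<lambda>_. 0" "\<lambda>_. 0"] lin2_0[OF lin2_eta, of L] by simp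
  also have "eta L (unit_vec l) (\<lambda>_. 0) = a1 L l + a2 L l - ip (a1 l) (a2 L)"
    using ip_cong[of "A1 (unit_vec l)" "a1 l"] A1_unit_vec[OF assms(1)] ip_unit_vec[OF assms(1)] by (simp add: eta_def)
  finally have "pull (eta L) (\<lambda>_. 0) (unit_vec l) = - a2 L l" using rel by (simp add: pull_def A1_0 A2_0)
  moreover have "ip (\<lambda>x. - unit_vec l x) (a2 L) = - a2 L l"
    using ip_diff[of "\<lambda>_. 0" "unit_vec l" "a2 L"] ip_unit_vec[OF assms(1)] by simp
  ultimately show ?thesis by (simp add: backward_def A1_0)
qed

lemma backward_vanish:
  assumes base: "base C" and L: "L \<in> I" shows "(pull ^^ n) (backward L) (tv C) (rv C) = 0"
proof (rule functional_vanish[OF lin2_backward, where G = "\<lambda>_. base"])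
  fix C P p K assume C: "base C" "cover P p (md C)" "K = {x \<in> P. p x = 0}"
  then have "sub C" "jrad (jrad C) = {0}" by (auto simp: base_def)
  then show "base K" using base_ker C by blast
  fix l assume l: "l \<in> I" "sg P K l \<noteq> 0"
  show "backward L (\<lambda>_. 0) (unit_vec l) = 0 \<and> (\<exists>S. base S \<and> tv S = unit_vec l \<and> rv S = (\<lambda>_. 0))"
    using backward_shifted[OF l(1) L summand_relation[OF C l L]] simple_summand_exists[OF C l] by metis
qed (use base L backward_base in auto)

context
  fixes X :: "(nat \<Rightarrow> 'a) set"
  assumes X: "sub X" "jrad (jrad X) = {0}"
begin

lemma rv_X: "l \<in> I \<Longrightarrow> rv X l = h l (jrad X)"
  by (simp add: rv_def)

text \<open>Ext^1(C, X) = 0 gives \<open>h P X = h C X + h K X\<close>. Maps K -> X land in the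
  semisimple module J X, so the last term is the pairing of \<open>tv K\<close> with
  \<open>rv X\<close>, to which the error part contributes nothing by
  \<open>summand_rv\<close>.\<close>

lemma h_ker_X:
  assumes base: "base C" and P: "cover P p (md C)" and K: "K = {x \<in> P. p x = 0}" and ext: "ev 0 (md C) (md X)"
  shows "ip (\<lambda>l. A1 (tv C) l - rv C l) (rv X) = ip (tv C) (tv X) + ip (tv C) (rv X) - h C X"
proof -
  have sC: "sub C" "jrad (jrad C) = {0}" using base by (auto simp: base_def)
  have sK: "sub K" using cov_facts(8)[OF sC P K] .
  have "hom K X = hom K (jrad X)"
    using ker_hom_jrad[OF sC P K ext] hom_mono[OF _ jrad_subset[OF X(1)]] by blast
  then have "h K X = h K (jrad X)" by (rule h_eqI)
  also have "\<dots> = ip (tv K) (rv X)"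
    using hom_semisimple_top[OF sK sub_jrad[OF X(1)] X(2)] by (simp add: ip_tv rv_X)
  also have "\<dots> = ip (\<lambda>l. A1 (tv C) l - rv C l) (rv X) + ip (sg P K) (rv X)"
    unfolding tv_ker[OF base P K] by (rule ip_add)
  also have "ip (sg P K) (rv X) = 0"
    unfolding ip_def
  proof (rule sum.neutral, rule ballI)
    fix l assume "l \<in> I"
    then show "sg P K l * rv X l = 0"
      using summand_rv[OF base P K _ _ X ext] by (cases "sg P K l = 0") simp_all
  qed
  finally have "h K X = ip (\<lambda>l. A1 (tv C) l - rv C l) (rv X)" by simp
  moreover have "h P X = ip (tv C) (tv X) + ip (tv C) (rv X)"
  proof -
    have "h P X = ip (tv C) (\<lambda>l. h l X)" by (rule h_cover_ip[OF base P K X(1)])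
    also have "\<dots> = (\<Sum>l\<in>I. tv C l * tv X l + tv C l * rv X l)"
      unfolding ip_def by (intro sum.cong) (auto simp: tv_def rv_def top_mult_def algebra_simps)
    finally show ?thesis by (simp add: ip_def sum.distrib)
  qed
  ultimately show ?thesis using h_cover[OF sC P K X(1) ext] by simp
qed

lemma h_jrad_X: "sub C \<Longrightarrow> h C (jrad X) = ip (tv C) (rv X)"
  using hom_semisimple_top[OF _ sub_jrad[OF X(1)] X(2)] by (simp add: ip_tv rv_X)

lemma euler_xgood:
  assumes C: "base C" "xgood X (Suc q) C" shows "euler X (tv C) (rv C) = 0"
proof -
  have sC: "sub C" using C by (auto simp: base_def)
  obtain P p where P: "cover P p (md C)" by (rule cover_exists[OF fg_sub[OF sC]])
  have "hom C X = hom C (jrad X)"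
    using C(2) hom_mono[OF _ jrad_subset[OF X(1)]] unfolding xgood_def by blast
  then have "h C X = ip (tv C) (rv X)" using h_eqI h_jrad_X[OF sC] by metis
  moreover have "ev 0 (md C) (md X)" using C(2) unfolding xgood_def by blast
  ultimately show ?thesis using h_ker_X[OF C(1) P refl] by (simp add: euler_def)
qed

lemma euler_shifted: "l \<in> I \<Longrightarrow> rv X l = 0 \<Longrightarrow> euler X (\<lambda>_. 0) (unit_vec l) = 0"
  using ip_diff[of "\<lambda>_. 0" "unit_vec l" "rv X"] by (simp add: euler_def A1_0 ip_unit_vec)

text \<open>Only the Ext part of \<open>xgood\<close> is assumed of \<open>C\<close>, so that the
  step also applies to \<open>C = X\<close>.\<close>

lemma xgood_step:
  assumes C: "base C" "\<forall>i<Suc q. ev i (md C) (md X)" and P: "cover P p (md C)" and K: "K = {x \<in> P. p x = 0}"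
  shows "base K" "xgood X q K"
    and "l \<in> I \<Longrightarrow> sg P K l \<noteq> 0 \<Longrightarrow>
      euler X (\<lambda>_. 0) (unit_vec l) = 0 \<and> (\<exists>S. (base S \<and> xgood X q S) \<and> tv S = unit_vec l \<and> rv S = (\<lambda>_. 0))"
proof -
  have sC: "sub C" "jrad (jrad C) = {0}" using C by (auto simp: base_def)
  show bK: "base K" by (rule base_ker[OF sC P K C(1)])
  show xK: "xgood X q K" by (rule xgood_ker[OF sC P K C(2)])
  assume l: "l \<in> I" "sg P K l \<noteq> 0"
  obtain S e f where S: "f \<in> hom l S" "f ` l = S" "{x \<in> l. f x = 0} = jrad l" "sub S" "S \<subseteq> jrad (jrad P)" "e \<in> hom K S"
    "\<forall>x\<in>S. e x = x" "jrad S = {0}" "tv S = unit_vec l" "rv S = (\<lambda>_. 0)" "base S"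
    by (rule simple_summand_exists[OF C(1) P K l])
  have "S \<subseteq> K" using S(5) cov_facts(10)[OF sC P K] by blast
  then have "xgood X q S" by (rule summand_xgood[OF C(1) P K S(4) _ S(6,7) xK X(1)])
  then have "(base S \<and> xgood X q S) \<and> tv S = unit_vec l \<and> rv S = (\<lambda>_. 0)" using S(9-11) by simp
  moreover have "ev 0 (md C) (md X)" using C(2) by blast
  then have "euler X (\<lambda>_. 0) (unit_vec l) = 0"
    by (intro euler_shifted[OF l(1)] summand_rv[OF C(1) P K l X])
  ultimately show "euler X (\<lambda>_. 0) (unit_vec l) = 0 \<and> (\<exists>S. (base S \<and> xgood X q S) \<and> tv S = unit_vec l \<and> rv S = (\<lambda>_. 0))"
    by (intro conjI exI[of _ S]) simp_all
qed

lemma euler_vanish: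
  "n < q \<Longrightarrow> base C \<and> xgood X q C \<Longrightarrow> (pull ^^ n) (euler X) (tv C) (rv C) = 0"
proof (rule functional_vanish[OF lin2_euler, where G = "\<lambda>q C. base C \<and> xgood X q C"])
  fix q C P p K l
  assume C: "base C \<and> xgood X (Suc q) C" and P: "cover P p (md C)" and K: "K = {x \<in> P. p x = 0}"
  have C': "base C" "\<forall>i<Suc q. ev i (md C) (md X)" using C unfolding xgood_def by blast+
  note step = xgood_step[OF C' P K]
  show "base K \<and> xgood X q K" using step(1,2) by blast
  show "l \<in> I \<Longrightarrow> sg P K l \<noteq> 0 \<Longrightarrow>
      euler X (\<lambda>_. 0) (unit_vec l) = 0 \<and> (\<exists>S. (base S \<and> xgood X q S) \<and> tv S = unit_vec l \<and> rv S = (\<lambda>_. 0))"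
    by (rule step(3))
qed (use euler_xgood in blast)+

text \<open>\<open>X\<close> itself is not \<open>xgood\<close> unless it is 0, so the first step is
  carried out separately; from its syzygy on, \<open>euler_vanish\<close> applies. This is why the
  iterates start at 1.\<close>

lemma euler_X_vanish:
  assumes b: "base X" and e: "\<forall>i<Suc q. ev i (md X) (md X)" and n: "n < q"
  shows "(pull ^^ Suc n) (euler X) (tv X) (rv X) = 0"
proof -
  obtain P p where P: "cover P p (md X)" by (rule cover_exists[OF fg_sub[OF X(1)]])
  define K where "K = {x \<in> P. p x = 0}"
  note step = xgood_step[OF b e P K_def]
  have "(pull ^^ n) (euler X) (unit_vec l) (\<lambda>x. - unit_vec l x) = 0" if l: "l \<in> I" "sg P K l \<noteq> 0" for l
  proof (rule pull_shift[OF lin2_euler])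
    show "euler X (\<lambda>_. 0) (unit_vec l) = 0" using step(3)[OF l] by blast
    obtain S where S: "base S \<and> xgood X q S" "tv S = unit_vec l" "rv S = (\<lambda>_. 0)" using step(3)[OF l] by blast
    show "(pull ^^ k) (euler X) (unit_vec l) (\<lambda>_. 0) = 0" if "k \<le> n" for k
      using euler_vanish[OF _ S(1), of k] S(2,3) that n by simp
  qed
  then have "pull ((pull ^^ n) (euler X)) (tv X) (rv X) = (pull ^^ n) (euler X) (tv K) (rv K)"
    by (intro pull_syzygy[OF b P K_def lin2_pull_iter[OF lin2_euler]])
  also have "\<dots> = 0" using euler_vanish[OF n] step(1,2) by blast
  finally show ?thesis by simp
qed

lemma euler_X_negative:
  assumes b: "base X" and e: "ev 0 (md X) (md X)" and ne: "X \<noteq> {0}"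
  shows "euler X (tv X) (rv X) < 0"
proof -
  obtain P p where P: "cover P p (md X)" by (rule cover_exists[OF fg_sub[OF X(1)]])
  let ?id = "restrict0 X (\<lambda>x. x)"
  obtain x where x: "x \<in> X" "x \<notin> jrad X" using jrad_neq[OF X(1) ne] jrad_subset[OF X(1)] by blast
  have "?id \<in> hom X X" using lhom_id[OF lmodule_sub[OF X(1)]] by simp
  moreover have "?id \<notin> hom X (jrad X)" using lhom_closed[of ?id "md X" "md (jrad X)" x] x by auto
  ultimately have "hom X (jrad X) \<noteq> hom X X" by blast
  moreover have "hom X (jrad X) \<subseteq> hom X X" using hom_mono[OF _ jrad_subset[OF X(1)]] by blast
  ultimately have "H.dim (hom X (jrad X)) < H.dim (hom X X)"
    using H.dim_psubset_fd[OF fdim_hom[OF X(1) X(1)]] subspace_lhom[OF natural_sub[OF sub_jrad[OF X(1)]]] by blast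
  then have "h X (jrad X) < h X X" by (simp add: h_def)
  then show ?thesis using h_ker_X[OF b P refl e] h_jrad_X[OF X(1)] by (simp add: euler_def)
qed

end

section \<open>The two-sided recurrence\<close>

definition step :: "((nat \<Rightarrow> 'a) set \<Rightarrow> real) \<times> ((nat \<Rightarrow> 'a) set \<Rightarrow> real) \<Rightarrow>
    ((nat \<Rightarrow> 'a) set \<Rightarrow> real) \<times> ((nat \<Rightarrow> 'a) set \<Rightarrow> real)" where
  "step w = (\<lambda>l. A1 (fst w) l - snd w l, A2 (fst w))"

lemma pull_iter: "(pull ^^ n) f (fst w) (snd w) = f (fst ((step ^^ n) w)) (snd ((step ^^ n) w))"
proof (induction n arbitrary: f)
  case (Suc n)
  have "(pull ^^ Suc n) f (fst w) (snd w) = (pull ^^ n) (pull f) (fst w) (snd w)"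
    by (simp add: funpow_swap1)
  also have "\<dots> = pull f (fst ((step ^^ n) w)) (snd ((step ^^ n) w))" by (rule Suc)
  also have "\<dots> = f (fst ((step ^^ Suc n) w)) (snd ((step ^^ Suc n) w))" by (simp add: pull_def step_def)
  finally show ?case .
qed simp

text \<open>The vectors \<open>step\<^sup>n w\<close> live in a space of dimension \<open>2 |I|\<close>, and \<open>step\<close> is invertible on their
  span; so \<open>w\<close> is a linear combination of the next \<open>2 |I|\<close> vectors.\<close>

lemma two_sided_recurrence:
  assumes supp: "\<And>l. l \<notin> I \<Longrightarrow> fst w l = 0 \<and> snd w l = 0"
    and bwd: "\<And>n L. L \<in> I \<Longrightarrow> (pull ^^ n) (backward L) (fst w) (snd w) = 0"
    and f: "lin2 f" and van: "\<And>n. 1 \<le> n \<Longrightarrow> n \<le> 2 * card I \<Longrightarrow> (pull ^^ n) f (fst w) (snd w) = 0"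
  shows "f (fst w) (snd w) = 0"
proof -
  define T where "T n = fst ((step ^^ n) w)" for n
  define R where "R n = snd ((step ^^ n) w)" for n
  have TS: "T (Suc n) = (\<lambda>l. A1 (T n) l - R n l)" and RS: "R (Suc n) = A2 (T n)" for n
    by (simp_all add: T_def R_def step_def)
  have off: "T n l = 0 \<and> R n l = 0" if "l \<notin> I" for n l
  proof (induction n)
    case 0
    show ?case using supp[OF that] by (simp add: T_def R_def)
  next
    case (Suc n)
    then show ?case using that by (simp add: TS RS A1_def A2_def restrict0_out)
  qed
  have Tback: "T n L = eta L (T (Suc n)) (R (Suc n)) - ip (T (Suc n)) (a2 L)" if "L \<in> I" for n L
  proof -
    have "backward L (T n) (R n) = 0" using bwd[OF that, of n] by (simp add: pull_iter T_def R_def)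
    then show ?thesis by (simp add: backward_def pull_def TS RS)
  qed
  \<comment> \<open>The vectors have \<open>2 * card I\<close> coordinates, indexed by
    \<open>I \<times> UNIV\<close> with a Boolean selecting top or radical; so the iterates 0 to
    \<open>m\<close> are dependent.\<close>
  define m where "m = 2 * card I"
  have card: "card (I \<times> (UNIV :: bool set)) < card {..m}" by (simp add: m_def card_cartesian_product)
  obtain c where c: "\<exists>i\<in>{..m}. c i \<noteq> 0"
    "\<forall>x\<in>I \<times> (UNIV :: bool set). (\<Sum>i\<in>{..m}. c i * (if snd x then T i (fst x) else R i (fst x))) = 0"
    using linear_dependence[OF finite_cartesian_product[OF finite_I finite] finite_atMost card,
        of "\<lambda>i x. if snd x then T i (fst x) else R i (fst x)"] by (elim exE conjE)
  \<comment> \<open>Taking the least index with a nonzero coefficient and shifting the relation back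
    by it puts iterate 0 first, with coefficient \<open>c j\<close>.\<close>
  define j where "j = (LEAST i. c i \<noteq> 0)"
  have j: "c j \<noteq> 0" and jl: "\<And>i. i < j \<Longrightarrow> c i = 0"
    using c(1) LeastI_ex[of "\<lambda>i. c i \<noteq> 0"] not_less_Least[of _ "\<lambda>i. c i \<noteq> 0"] unfolding j_def by blast+
  have jm: "j \<le> m" using c(1) jl by (metis atMost_iff leI le_trans)
  have restr: "(\<Sum>i\<in>{..m}. c i * u i) = (\<Sum>i\<in>{j..m}. c i * u i)" for u
    by (intro sum.mono_neutral_right) (auto simp: jl not_le)
  \<comment> \<open>A relation among iterates passes to their predecessors: \<open>Tback\<close>
    recovers the earlier tops linearly, and the earlier radicals are A1 of these tops minus the
    later tops.\<close>
  have shift: "d \<le> j \<Longrightarrow> (\<lambda>l. \<Sum>i\<in>{j..m}. c i * T (i - d) l) = (\<lambda>_. 0) \<and>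
      (\<lambda>l. \<Sum>i\<in>{j..m}. c i * R (i - d) l) = (\<lambda>_. 0)" for d
  proof (induction d)
    case 0
    have "(\<Sum>i\<in>{j..m}. c i * T i l) = 0 \<and> (\<Sum>i\<in>{j..m}. c i * R i l) = 0" for l
    proof (cases "l \<in> I")
      case True
      then show ?thesis using c(2)[rule_format, of "(l, True)"] c(2)[rule_format, of "(l, False)"] restr by simp
    qed (simp add: off)
    then show ?case by simp
  next
    case (Suc d)
    then have IH: "(\<lambda>l. \<Sum>i\<in>{j..m}. c i * T (i - d) l) = (\<lambda>_. 0)"
      "(\<lambda>l. \<Sum>i\<in>{j..m}. c i * R (i - d) l) = (\<lambda>_. 0)" by simp_all
    have S: "i - d = Suc (i - Suc d)" if "i \<in> {j..m}" for i using that Suc(2) by auto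
    have T0: "(\<Sum>i\<in>{j..m}. c i * T (i - Suc d) L) = 0" for L
    proof (cases "L \<in> I")
      case True
      have "(\<Sum>i\<in>{j..m}. c i * T (i - Suc d) L) =
          (\<Sum>i\<in>{j..m}. c i * (eta L (T (i - d)) (R (i - d)) - ip (T (i - d)) (a2 L)))"
        using Tback[OF True] S by (intro sum.cong) auto
      also have "\<dots> = (\<Sum>i\<in>{j..m}. c i * eta L (T (i - d)) (R (i - d))) - (\<Sum>i\<in>{j..m}. c i * ip (T (i - d)) (a2 L))"
        by (simp add: right_diff_distrib sum_subtractf)
      also have "(\<Sum>i\<in>{j..m}. c i * eta L (T (i - d)) (R (i - d))) = 0"
        using lin2_sum[OF lin2_eta, of L c "\<lambda>i. T (i - d)" "{j..m}" "\<lambda>i. R (i - d)"] IH lin2_0[OF lin2_eta, of L] by simp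
      also have "(\<Sum>i\<in>{j..m}. c i * ip (T (i - d)) (a2 L)) = 0"
      proof -
        have l: "lin2 (\<lambda>t (r :: (nat \<Rightarrow> 'a) set \<Rightarrow> real). ip t (a2 L))" by (simp add: lin2_def ip_lin)
        show ?thesis using lin2_sum[OF l, of c "\<lambda>i. T (i - d)" "{j..m}"] IH by simp
      qed
      finally show ?thesis by simp
    qed (simp add: off)
    have "(\<Sum>i\<in>{j..m}. c i * R (i - Suc d) L) = 0" for L
    proof -
      have "(\<Sum>i\<in>{j..m}. c i * R (i - Suc d) L) = (\<Sum>i\<in>{j..m}. c i * (A1 (T (i - Suc d)) L - T (i - d) L))"
        using S TS by (intro sum.cong) auto
      also have "\<dots> = (\<Sum>i\<in>{j..m}. c i * A1 (T (i - Suc d)) L) - (\<Sum>i\<in>{j..m}. c i * T (i - d) L)"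
        by (simp add: right_diff_distrib sum_subtractf)
      also have "(\<Sum>i\<in>{j..m}. c i * T (i - d) L) = 0" using fun_cong[OF IH(1), of L] by simp
      also have "(\<Sum>i\<in>{j..m}. c i * A1 (T (i - Suc d)) L) = 0"
      proof -
        have l: "lin2 (\<lambda>t (r :: (nat \<Rightarrow> 'a) set \<Rightarrow> real). A1 t L)" by (simp add: lin2_def A1_lin)
        show ?thesis
          using lin2_sum[OF l, of c "\<lambda>i. T (i - Suc d)" "{j..m}"] T0 by (simp add: A1_0)
      qed
      finally show ?thesis by simp
    qed
    then show ?case using T0 by simp
  qed
  have "(\<Sum>i\<in>{j..m}. c i * f (T (i - j)) (R (i - j))) = 0"
    using lin2_sum[OF f, of c "\<lambda>i. T (i - j)" "{j..m}" "\<lambda>i. R (i - j)"] shift[of j] lin2_0[OF f] by simp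
  moreover have "(\<Sum>i\<in>{j..m}. c i * f (T (i - j)) (R (i - j))) = (\<Sum>i\<in>{j..m}. if i = j then c j * f (T 0) (R 0) else 0)"
  proof (rule sum.cong[OF refl])
    fix i assume i: "i \<in> {j..m}"
    show "c i * f (T (i - j)) (R (i - j)) = (if i = j then c j * f (T 0) (R 0) else 0)"
    proof (cases "i = j")
      case False
      then have "(pull ^^ (i - j)) f (fst w) (snd w) = 0" using i by (intro van) (auto simp: m_def)
      then show ?thesis using False by (simp add: pull_iter T_def R_def)
    qed simp
  qed
  ultimately have "c j * f (T 0) (R 0) = 0" using jm by simp
  then show ?thesis using j by (simp add: T_def R_def)
qed

theorem syzygy_zero:
  assumes b: "base X" and e: "\<forall>i<3 * num_simples TYPE('a) + 1. ev i (md X) (md X)"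
  shows "X = {0}"
proof (rule ccontr)
  assume ne: "X \<noteq> {0}"
  have X: "sub X" "jrad (jrad X) = {0}" using b by (auto simp: base_def)
  let ?s = "num_simples TYPE('a)"
  have e': "\<forall>i<Suc (3 * ?s). ev i (md X) (md X)" using e by simp
  have "euler X (fst (tv X, rv X)) (snd (tv X, rv X)) = 0"
  proof (rule two_sided_recurrence[OF _ _ lin2_euler])
    show "(pull ^^ n) (backward L) (fst (tv X, rv X)) (snd (tv X, rv X)) = 0" if "L \<in> I" for n L
      using backward_vanish[OF b that] by simp
    show "(pull ^^ n) (euler X) (fst (tv X, rv X)) (snd (tv X, rv X)) = 0" if "1 \<le> n" "n \<le> 2 * card I" for n
    proof -
      obtain k where k: "n = Suc k" using \<open>1 \<le> n\<close> by (cases n) auto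
      \<comment> \<open>\<open>Suc k \<le> 2 * card I\<close> and \<open>card_I\<close> keep
        \<open>k\<close> within the range that \<open>e'\<close> covers.\<close>
      have "k < 3 * ?s" using that k card_I by simp
      then show ?thesis using euler_X_vanish[OF X b e'] k by simp
    qed
  qed (simp add: tv_def rv_def restrict0_out)
  moreover have "ev 0 (md X) (md X)" by (rule e[rule_format]) simp
  then have "euler X (tv X) (rv X) < 0" by (rule euler_X_negative[OF X b _ ne])
  ultimately show False by simp
qed

end

section \<open>From the vanishing syzygy to projectivity\<close>

theorem (in rad_cube_zero) projective_if_Ext_zero:
  fixes M :: "('a, 'm::ab_group_add) lmod"
  assumes M: "fg_module M"
    and A: "\<forall>i>0. Ext_zero i M (regular_module :: ('a, 'a) lmod)"
    and E: "\<forall>q\<in>{1..3 * num_simples TYPE('a) + 1}. Ext_zero q M M"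
  shows "projective M"
proof -
  have lM: "lmodule M" using M by (simp add: fg_module_def)
  obtain I where I: "proj_index I" using proj_index_exists by blast
  interpret rad_cube_zero_index scale I by unfold_locales (rule I)
  obtain P p where c: "cover P p M" by (rule cover_exists[OF M])
  then have P: "psub P" "sub P" "p \<in> lhom (md P) M" "p ` P = carr M" using psub_sub by (auto simp: cover_def)
  define X where "X = {x \<in> P. p x = 0}"
  note ev = syzygy_ev[OF M c X_def A E]
  have "submodule (md P) X" using submodule_ker[OF P(3) lmodule_sub[OF P(2)] lM] by (simp add: X_def)
  then have sX: "sub X" using submodule_mdD P(2) by blast
  have XJ: "X \<subseteq> jrad P" using c by (auto simp: cover_def X_def)
  have "base X"
    unfolding base_def
  proof (intro conjI allI impI sX)
    have "jrad (jrad X) \<subseteq> jrad (jrad (jrad P))" by (intro jrad_mono XJ)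
    then show "jrad (jrad X) = {0}" using jrad_cube jrad_0 by blast
    show "ev i (md X) regA" for i by (rule ev(1))
    fix L :: "(nat \<Rightarrow> 'a) set" assume L: "psub L"
    show "hom X L \<subseteq> hom X (jrad L)"
    proof
      fix f assume f: "f \<in> hom X L"
      then have "f \<in> lhom (ker (md P) p) (md L)" by (simp add: ker_md X_def)
      then obtain F where F: "F \<in> hom P L" "\<forall>x\<in>carr (md P). p x = 0 \<longrightarrow> F x = f x"
        by (rule ext_okD[OF ev(3)[OF L]])
      have FP: "F ` P \<subseteq> L" using lhom_closed[OF F(1)] by auto
      have "f x \<in> jrad L" if x: "x \<in> X" for x
      proof -
        have "F x \<in> jrad (F ` P)" using jrad_hom[OF F(1) P(2) _ order_refl] x XJ by blast
        moreover have "F x = f x" using F(2) x by (simp add: X_def)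
        ultimately show ?thesis using jrad_mono[OF FP] by auto
      qed
      then show "f \<in> hom X (jrad L)" using hom_codom[OF f] by blast
    qed
  qed
  then have X0: "X = {0}" using syzygy_zero ev(2) by simp
  \<comment> \<open>With zero kernel the projective cover is an isomorphism onto
    \<open>M\<close>.\<close>
  have "bij_betw p (carr (md P)) (carr M)"
    unfolding bij_betw_def
  proof
    show "inj_on p (carr (md P))"
    proof (rule inj_onI)
      fix x y assume x: "x \<in> carr (md P)" "y \<in> carr (md P)" "p x = p y"
      then have "x - y \<in> X" using lhom_diff[OF P(3) lmodule_sub[OF P(2)], of x y] sub_diff[OF P(2)] by (simp add: X_def)
      then show "x = y" using X0 by simp
    qed
  qed (use P(4) in simp)
  then show ?thesis using rfree_imp_projective isomorphic_via_rfree[OF psub_rfree[OF P(1)] P(3) _ lM] by blast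
qed

theorem theorem1p1:
  fixes scale :: "'k::field \<Rightarrow> 'a::{ring,monoid_mult} \<Rightarrow> 'a"
    and M :: "('a, 'm::ab_group_add) lmod"
    and s :: nat
  defines "s \<equiv> num_simples TYPE('a)"
  assumes "split_fd_algebra scale"
    and "ideal_product (ideal_product jacobson_radical jacobson_radical) jacobson_radical = {0::'a}"
    and "fg_module M"
    and "\<forall>i>0. Ext_zero i M (regular_module :: ('a, 'a) lmod)"
  shows "projective M \<longleftrightarrow> (\<forall>q\<in>{1..3 * s + 1}. Ext_zero q M M)"
proof -
  interpret split_fd_algebra scale by fact
  interpret rad_cube_zero scale by unfold_locales fact
  show ?thesis
  proof
    assume "projective M"
    then have r: "rfree M" by (rule projective_imp_rfree[OF assms(4)])
    have l: "lmodule M" using assms(4) by (simp add: fg_module_def)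
    show "\<forall>q\<in>{1..3 * s + 1}. Ext_zero q M M"
    proof
      fix q assume "q \<in> {1..3 * s + 1}"
      then obtain n where "q = Suc n" using not0_implies_Suc[of q] by auto
      then show "Ext_zero q M M" using rfree_Ext_zero[OF assms(4) r l] by simp
    qed
  next
    assume "\<forall>q\<in>{1..3 * s + 1}. Ext_zero q M M"
    then show "projective M" using projective_if_Ext_zero[OF assms(4,5)] by (simp add: s_def)
  qed
qed

end
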